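(* Let $\Lambda$ be the algebra of symmetric functions over $\mathbb{F}=\mathbb{Q}(q,t)$ and let $A^{(1)},A^{(2)},\ldots$ be the Macdonald operators at infinity, that is, the linear operators on $\Lambda$ determined by the expansion $$A(u)=1+\frac{A^{(1)}}{(u;t^{-1})_1}+\frac{A^{(2)}}{(u;t^{-1})_2}+\cdots$$ of the limit $A(u)$ of the renormalised Macdonald operators $A_N(u)$ as $N\to\infty$. Then for every $k=1,2,\ldots$ $$A^{(k)}=\sum_{\ell(\lambda)=k} q^{-\lambda_1-\lambda_2-\cdots}\,Q_\lambda\,P_\lambda^{*},$$ where $\lambda$ ranges over all partitions of length $k$, $P_\lambda$ and $Q_\lambda$ are the Hall-Littlewood symmetric functions with parameter $t$, $Q_\lambda$ stands for the operator of multiplication by $Q_\lambda$, and $P_\lambda^{*}$ is the operator adjoint to multiplication by $P_\lambda$ relative to the Macdonald bilinear form $\langle\ ,\ \rangle$ with parameters $q,t$. (The sum is well defined, as only finitely many summands act non-trivially on any given element of $\Lambda$.)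
   Context: Notation. $\mathbb{F}=\mathbb{Q}(q,t)$ with $q,t$ independent formal parameters. $\Lambda_N$ is the graded $\mathbb{F}$-algebra of symmetric polynomials in $x_1,\ldots,x_N$; $\rho_N:\Lambda_N\to\Lambda_{N-1}$ is the substitution $x_N=0$ (with $\Lambda_0=\mathbb{F}$); $\Lambda$ is the inverse limit of the $\Lambda_N$ in the category of graded algebras. It is freely generated by the power sums $p_n$, $n\ge1$, and has basis $p_\lambda=p_{\lambda_1}p_{\lambda_2}\cdots$ over all partitions $\lambda$. $\ell(\lambda)$ is the number of non-zero parts of $\lambda$, and $k_i$ denotes the multiplicity of the part $i\ge1$ in $\lambda$. Put $(u;a)_N=\prod_{k=0}^{N-1}(1-u\,a^{k})$. Bilinear form. $\langle p_\lambda,p_\mu\rangle=\delta_{\lambda\mu}\,z_\lambda\prod_{i=1}^{\ell(\lambda)}\frac{1-q^{\lambda_i}}{1-t^{\lambda_i}}$, where $z_\lambda=\prod_{i\ge1}i^{k_i}k_i!$. For $f\in\Lambda$, $f^{*}$ is the operator on $\Lambda$ adjoint to multiplication by $f$ relative to $\langle\ ,\ \rangle$. Hall-Littlewood functions. For $\ell(\lambda)\le N$ set $k_0=N-\ell(\lambda)$ and $v_\lambda(t)=\prod_{i\ge0}\prod_{j=1}^{k_i}\frac{1-t^j}{1-t}$. Then $P_\lambda(x_1,\ldots,x_N)$ is $v_\lambda(t)^{-1}$ times the sum of all $N!$ products obtained from $x_1^{\lambda_1}\cdots x_N^{\lambda_N}\prod_{1\le i<j\le N}\frac{x_i-t\,x_j}{x_i-x_j}$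 by permuting $x_1,\ldots,x_N$. These polynomials are stable under $\rho_N$, and $P_\lambda\in\Lambda$ is their limit. $Q_\lambda=b_\lambda(t)P_\lambda$ with $b_\lambda(t)=\prod_{i\ge1}\prod_{j=1}^{k_i}(1-t^j)$. Macdonald operators. Let $(T_if)(x_1,\ldots,x_N)=f(x_1,\ldots,q x_i,\ldots,x_N)$, let $\Delta(x_1,\ldots,x_N)=\prod_{i<j}(x_i-x_j)$, and put $$D_N(u)=\Delta(x_1,\ldots,x_N)^{-1}\sum_{\sigma\in\mathfrak{S}_N}(-1)^\sigma\prod_{i=1}^N\Bigl(x_i^{N-\sigma(i)}\bigl(1-u\,t^{1-\sigma(i)}T_i\bigr)\Bigr),$$ a polynomial in $u$ whose coefficients are operators preserving $\Lambda_N$. Put $A_N(u)=(T_1\cdots T_N)^{-1}D_N(u)/(u;t^{-1})_N$, a rational function of $u$ with values in operators on $\Lambda_N$. One has $\rho_NA_N(u)=A_{N-1}(u)\rho_N$ with $A_0(u)=1$, so the $A_N(u)$ have a limit $A(u)$ as $N\to\infty$ acting on $\Lambda$: it is the operator compatible with all $A_N(u)$ under the projections $\Lambda\to\Lambda_N$. Equivalently, on the Macdonald symmetric functions $M_\lambda$ (the unique family in $\Lambda$ orthogonal for $\langle\ ,\ \rangle$ with $M_\lambda$ equal to the monomial symmetric function $m_\lambda$ plus a linear combination of $m_\mu$ with $\mu<\lambda$ in the dominance order) one has $A(u)M_\lambda=M_\lambda\prod_{i\ge1}\frac{q^{-\lambda_i}-u\,t^{1-i}}{1-u\,t^{1-i}}$.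 The coefficients $A^{(k)}$ in the expansion of $A(u)$ in $1,\,1/(u;t^{-1})_1,\,1/(u;t^{-1})_2,\ldots$ are uniquely determined linear operators on $\Lambda$ (only finitely many of them act non-trivially on a given element). *)

theory Defs
  imports
    Complex_Main
    "HOL-Library.Poly_Mapping"
    "HOL-Computational_Algebra.Polynomial"
    "HOL-Computational_Algebra.Fraction_Field"
    "HOL-Combinatorics.Permutations"
begin

section \<open>Polynomials in the variables \<open>x\<^sub>1, x\<^sub>2, \<dots>\<close>\<close>

type_synonym 'a mpoly = "(nat \<Rightarrow>\<^sub>0 nat) \<Rightarrow>\<^sub>0 'a"

definition Const :: "'a::zero \<Rightarrow> 'a mpoly" where
  "Const c = Poly_Mapping.single 0 c"

definition X :: "nat \<Rightarrow> 'a::zero_neq_one mpoly" where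
  "X i = Poly_Mapping.single (Poly_Mapping.single i 1) 1"

definition mono_eval :: "(nat \<Rightarrow> 'a::comm_semiring_1 mpoly) \<Rightarrow> (nat \<Rightarrow>\<^sub>0 nat) \<Rightarrow> 'a mpoly" where
  "mono_eval s m = (\<Prod>i\<in>Poly_Mapping.keys m. s i ^ Poly_Mapping.lookup m i)"

text \<open>Simultaneous substitution \<open>x\<^sub>i := s i\<close>.\<close>

definition subst :: "(nat \<Rightarrow> 'a::comm_semiring_1 mpoly) \<Rightarrow> 'a mpoly \<Rightarrow> 'a mpoly" where
  "subst s f = (\<Sum>m\<in>Poly_Mapping.keys f. Const (Poly_Mapping.lookup f m) * mono_eval s m)"

definition mono_deg :: "(nat \<Rightarrow>\<^sub>0 nat) \<Rightarrow> nat" where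
  "mono_deg m = (\<Sum>i\<in>Poly_Mapping.keys m. Poly_Mapping.lookup m i)"

definition deg_le :: "nat \<Rightarrow> 'a::zero mpoly \<Rightarrow> bool" where
  "deg_le d f \<longleftrightarrow> (\<forall>m\<in>Poly_Mapping.keys f. mono_deg m \<le> d)"

definition sym_polys :: "nat \<Rightarrow> 'a::comm_ring_1 mpoly set" where
  "sym_polys N = {f. (\<forall>m\<in>Poly_Mapping.keys f. Poly_Mapping.keys m \<subseteq> {1..N}) \<and>
                     (\<forall>w. w permutes {1..N} \<longrightarrow> subst (\<lambda>i. X (w i)) f = f)}"

text \<open>The substitution \<open>x\<^sub>N = 0\<close>.\<close>

definition restr :: "nat \<Rightarrow> 'a::comm_ring_1 mpoly \<Rightarrow> 'a mpoly" where
  "restr N = subst (\<lambda>i. if i = N then 0 else X i)"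

lemma Const_0 [simp]: "Const 0 = 0"
  by (simp add: Const_def)

lemma Const_1 [simp]: "Const 1 = 1"
  by (simp add: Const_def)

lemma Const_add: "Const (a + b) = Const a + Const b"
  by (simp add: Const_def single_add)

lemma Const_mult: "Const (a * b) = Const a * (Const b :: 'a::comm_semiring_1 mpoly)"
  by (simp add: Const_def mult_single)

lemma mono_eval_superset:
  assumes "finite A" "Poly_Mapping.keys m \<subseteq> A"
  shows "mono_eval s m = (\<Prod>i\<in>A. s i ^ Poly_Mapping.lookup m i)"
  unfolding mono_eval_def using assms
  by (intro prod.mono_neutral_left) (auto simp: in_keys_iff)

lemma mono_eval_0 [simp]: "mono_eval s 0 = 1"
  by (simp add: mono_eval_def)

lemma mono_eval_add: "mono_eval s (m + n) = mono_eval s m * mono_eval s n"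
proof -
  let ?A = "Poly_Mapping.keys m \<union> Poly_Mapping.keys n"
  have "mono_eval s (m + n) = (\<Prod>i\<in>?A. s i ^ Poly_Mapping.lookup (m + n) i)"
    using keys_add[of m n] by (intro mono_eval_superset) auto
  also have "\<dots> = (\<Prod>i\<in>?A. s i ^ Poly_Mapping.lookup m i) * (\<Prod>i\<in>?A. s i ^ Poly_Mapping.lookup n i)"
    by (simp add: lookup_add power_add prod.distrib)
  also have "\<dots> = mono_eval s m * mono_eval s n"
    by (subst (1 2) mono_eval_superset[of ?A]) auto
  finally show ?thesis .
qed

lemma subst_superset:
  assumes "finite A" "Poly_Mapping.keys f \<subseteq> A"
  shows "subst s f = (\<Sum>m\<in>A. Const (Poly_Mapping.lookup f m) * mono_eval s m)"
  unfolding subst_def using assms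
  by (intro sum.mono_neutral_left) (auto simp: in_keys_iff)

lemma subst_0 [simp]: "subst s 0 = 0"
  by (simp add: subst_def)

lemma subst_add: "subst s (f + g) = subst s f + subst s g"
proof -
  let ?A = "Poly_Mapping.keys f \<union> Poly_Mapping.keys g"
  have "subst s (f + g) = (\<Sum>m\<in>?A. Const (Poly_Mapping.lookup (f + g) m) * mono_eval s m)"
    using keys_add[of f g] by (intro subst_superset) auto
  also have "\<dots> = (\<Sum>m\<in>?A. Const (Poly_Mapping.lookup f m) * mono_eval s m) +
                  (\<Sum>m\<in>?A. Const (Poly_Mapping.lookup g m) * mono_eval s m)"
    by (simp add: lookup_add Const_add distrib_right sum.distrib)
  also have "\<dots> = subst s f + subst s g"
    by (subst (1 2) subst_superset[of ?A]) auto
  finally show ?thesis .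
qed

lemma subst_sum: "subst s (sum f A) = (\<Sum>a\<in>A. subst s (f a))"
  by (induction A rule: infinite_finite_induct) (simp_all add: subst_add)

lemma subst_single: "subst s (Poly_Mapping.single m c) = Const c * mono_eval s m"
  by (cases "c = 0") (simp_all add: subst_def)

lemma subst_Const [simp]: "subst s (Const c) = Const c"
  using subst_single[of s 0 c] by (simp add: Const_def)

lemma subst_1 [simp]: "subst s 1 = 1"
  using subst_Const[of s 1] by simp

lemma mpoly_sum_single: "f = (\<Sum>m\<in>Poly_Mapping.keys f. Poly_Mapping.single m (Poly_Mapping.lookup f m))"
  by (rule poly_mapping_eqI)
     (auto simp: lookup_sum lookup_single when_def in_keys_iff)

lemma subst_mult: "subst s (f * g) = subst s f * subst s g"
proof -
  have "f * g = (\<Sum>m\<in>Poly_Mapping.keys f. Poly_Mapping.single m (Poly_Mapping.lookup f m)) *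
                (\<Sum>n\<in>Poly_Mapping.keys g. Poly_Mapping.single n (Poly_Mapping.lookup g n))"
    using mpoly_sum_single[of f] mpoly_sum_single[of g] by simp
  also have "\<dots> = (\<Sum>m\<in>Poly_Mapping.keys f. \<Sum>n\<in>Poly_Mapping.keys g.
                     Poly_Mapping.single (m + n) (Poly_Mapping.lookup f m * Poly_Mapping.lookup g n))"
    by (simp add: sum_product mult_single)
  finally have "subst s (f * g) = (\<Sum>m\<in>Poly_Mapping.keys f. \<Sum>n\<in>Poly_Mapping.keys g.
      (Const (Poly_Mapping.lookup f m) * mono_eval s m) * (Const (Poly_Mapping.lookup g n) * mono_eval s n))"
    by (simp add: subst_sum subst_single Const_mult mono_eval_add mult_ac)
  also have "\<dots> = subst s f * subst s g"
    by (simp add: subst_def sum_product)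
  finally show ?thesis .
qed

lemma subst_uminus: "subst s (- f) = - subst s (f :: 'a::comm_ring_1 mpoly)"
  using subst_add[of s f "- f"] by (simp add: eq_neg_iff_add_eq_0 add.commute)

lemma mono_deg_superset:
  assumes "finite A" "Poly_Mapping.keys m \<subseteq> A"
  shows "mono_deg m = (\<Sum>i\<in>A. Poly_Mapping.lookup m i)"
  unfolding mono_deg_def using assms
  by (intro sum.mono_neutral_left) (auto simp: in_keys_iff)

lemma mono_deg_add: "mono_deg (m + n) = mono_deg m + mono_deg n"
proof -
  let ?A = "Poly_Mapping.keys m \<union> Poly_Mapping.keys n"
  have "mono_deg (m + n) = (\<Sum>i\<in>?A. Poly_Mapping.lookup (m + n) i)"
    using keys_add[of m n] by (intro mono_deg_superset) auto
  also have "\<dots> = (\<Sum>i\<in>?A. Poly_Mapping.lookup m i) + (\<Sum>i\<in>?A. Poly_Mapping.lookup n i)"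
    by (simp add: lookup_add sum.distrib)
  also have "\<dots> = mono_deg m + mono_deg n"
    by (subst (1 2) mono_deg_superset[of ?A]) auto
  finally show ?thesis .
qed

lemma deg_le_mono: "deg_le d f \<Longrightarrow> d \<le> e \<Longrightarrow> deg_le e f"
  by (auto simp: deg_le_def)

lemma deg_le_add: "deg_le d f \<Longrightarrow> deg_le d g \<Longrightarrow> deg_le d (f + g)"
  unfolding deg_le_def using keys_add[of f g] by blast

lemma deg_le_uminus: "deg_le d f \<Longrightarrow> deg_le d (- f :: 'a::comm_ring_1 mpoly)"
  by (simp add: deg_le_def)

lemma deg_le_mult:
  assumes "deg_le d f" "deg_le e g"
  shows "deg_le (d + e) (f * g)"
  unfolding deg_le_def
proof
  fix k assume "k \<in> Poly_Mapping.keys (f * g)"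
  then obtain m n where "k = m + n" "m \<in> Poly_Mapping.keys f" "n \<in> Poly_Mapping.keys g"
    using keys_mult[of f g] by blast
  then show "mono_deg k \<le> d + e"
    using assms by (auto simp: deg_le_def mono_deg_add intro!: add_mono)
qed

lemma keys_Const: "Poly_Mapping.keys (Const c) \<subseteq> {0}"
  by (simp add: Const_def)

lemma deg_le_Const: "deg_le 0 (Const c)"
  using keys_Const[of c] by (auto simp: deg_le_def mono_deg_def)

lemma sym_polys_Const: "Const c \<in> sym_polys N"
  using keys_Const[of c] by (auto simp: sym_polys_def)

lemma sym_polys_add: "f \<in> sym_polys N \<Longrightarrow> g \<in> sym_polys N \<Longrightarrow> f + g \<in> sym_polys N"
  using keys_add[of f g] unfolding sym_polys_def subst_add mem_Collect_eq by (metis Un_iff subsetD)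

lemma sym_polys_uminus: "f \<in> sym_polys N \<Longrightarrow> - f \<in> sym_polys N"
  unfolding sym_polys_def by (simp add: subst_uminus)

lemma sym_polys_mult:
  assumes "f \<in> sym_polys N" "g \<in> sym_polys N"
  shows "f * g \<in> sym_polys N"
proof -
  have "Poly_Mapping.keys k \<subseteq> {1..N}" if k: "k \<in> Poly_Mapping.keys (f * g)" for k
  proof -
    obtain m n where "k = m + n" "m \<in> Poly_Mapping.keys f" "n \<in> Poly_Mapping.keys g"
      using keys_mult[of f g] k by blast
    then show ?thesis
      using keys_add[of m n] assms unfolding sym_polys_def by blast
  qed
  then show ?thesis
    using assms by (auto simp: sym_polys_def subst_mult)
qed

section \<open>The algebra of symmetric functions\<close>

text \<open>
  The inverse limit of the \<^const>\<open>sym_polys\<close> in the category of \<^emph>\<open>graded\<close> algebras: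
  compatible sequences whose members have uniformly bounded degree.
\<close>

typedef (overloaded) ('a::comm_ring_1) symf =
  "{f :: nat \<Rightarrow> 'a mpoly. (\<forall>N. f N \<in> sym_polys N) \<and>
      (\<forall>N. restr (Suc N) (f (Suc N)) = f N) \<and> (\<exists>d. \<forall>N. deg_le d (f N))}"
  morphisms proj_fun Abs_symf
proof
  have "deg_le 0 (Const 0 :: 'a mpoly)" by (rule deg_le_Const)
  then show "(\<lambda>N. Const 0) \<in> {f :: nat \<Rightarrow> 'a mpoly. (\<forall>N. f N \<in> sym_polys N) \<and>
      (\<forall>N. restr (Suc N) (f (Suc N)) = f N) \<and> (\<exists>d. \<forall>N. deg_le d (f N))}"
    by (auto simp: sym_polys_Const restr_def simp del: Const_0)
qed

setup_lifting type_definition_symf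

text \<open>The projection \<open>\<Lambda> \<rightarrow> \<Lambda>\<^sub>N\<close>.\<close>

definition proj :: "nat \<Rightarrow> 'a::comm_ring_1 symf \<Rightarrow> 'a mpoly" where
  "proj N f = proj_fun f N"

instantiation symf :: (comm_ring_1) comm_ring_1
begin

lift_definition zero_symf :: "'a symf" is "\<lambda>N. 0"
  by (metis (mono_tags, lifting) Const_0 deg_le_Const restr_def subst_0 sym_polys_Const)

lift_definition one_symf :: "'a symf" is "\<lambda>N. 1"
  by (metis (mono_tags, lifting) Const_1 deg_le_Const restr_def subst_1 sym_polys_Const)

lift_definition plus_symf :: "'a symf \<Rightarrow> 'a symf \<Rightarrow> 'a symf" is "\<lambda>f g N. f N + g N"
proof -
  fix f g :: "nat \<Rightarrow> 'a mpoly"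
  assume f: "(\<forall>N. f N \<in> sym_polys N) \<and> (\<forall>N. restr (Suc N) (f (Suc N)) = f N) \<and> (\<exists>d. \<forall>N. deg_le d (f N))"
    and g: "(\<forall>N. g N \<in> sym_polys N) \<and> (\<forall>N. restr (Suc N) (g (Suc N)) = g N) \<and> (\<exists>d. \<forall>N. deg_le d (g N))"
  then obtain d e where "\<forall>N. deg_le d (f N)" "\<forall>N. deg_le e (g N)" by blast
  then have "\<forall>N. deg_le (d + e) (f N + g N)"
    by (meson deg_le_add deg_le_mono le_add1 le_add2)
  then show "(\<forall>N. f N + g N \<in> sym_polys N) \<and>
      (\<forall>N. restr (Suc N) (f (Suc N) + g (Suc N)) = f N + g N) \<and> (\<exists>d. \<forall>N. deg_le d (f N + g N))"
    using f g by (auto simp: restr_def subst_add sym_polys_add)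
qed

lift_definition uminus_symf :: "'a symf \<Rightarrow> 'a symf" is "\<lambda>f N. - f N"
  by (auto simp: restr_def subst_uminus sym_polys_uminus) (blast intro: deg_le_uminus)

definition minus_symf :: "'a symf \<Rightarrow> 'a symf \<Rightarrow> 'a symf" where
  "minus_symf f g = f + (- g)"

lift_definition times_symf :: "'a symf \<Rightarrow> 'a symf \<Rightarrow> 'a symf" is "\<lambda>f g N. f N * g N"
proof -
  fix f g :: "nat \<Rightarrow> 'a mpoly"
  assume f: "(\<forall>N. f N \<in> sym_polys N) \<and> (\<forall>N. restr (Suc N) (f (Suc N)) = f N) \<and> (\<exists>d. \<forall>N. deg_le d (f N))"
    and g: "(\<forall>N. g N \<in> sym_polys N) \<and> (\<forall>N. restr (Suc N) (g (Suc N)) = g N) \<and> (\<exists>d. \<forall>N. deg_le d (g N))"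
  then obtain d e where "\<forall>N. deg_le d (f N)" "\<forall>N. deg_le e (g N)" by blast
  then have "\<forall>N. deg_le (d + e) (f N * g N)"
    by (simp add: deg_le_mult)
  then show "(\<forall>N. f N * g N \<in> sym_polys N) \<and>
      (\<forall>N. restr (Suc N) (f (Suc N) * g (Suc N)) = f N * g N) \<and> (\<exists>d. \<forall>N. deg_le d (f N * g N))"
    using f g by (auto simp: restr_def subst_mult sym_polys_mult)
qed

instance
proof
  fix a b c :: "'a symf"
  show "a * b * c = a * (b * c)" by transfer (simp add: mult.assoc)
  show "a * b = b * a" by transfer (simp add: mult.commute)
  show "1 * a = a" by transfer simp
  show "a + b + c = a + (b + c)" by transfer (simp add: add.assoc)
  show "a + b = b + a" by transfer (simp add: add.commute)
  show "0 + a = a" by transfer simp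
  show "- a + a = 0" by transfer simp
  show "a - b = a + - b" by (rule minus_symf_def)
  show "(a + b) * c = a * c + b * c" by transfer (simp add: distrib_right)
  show "(0 :: 'a symf) \<noteq> 1" by transfer (auto simp: fun_eq_iff)
qed

end

lift_definition scale :: "'a::comm_ring_1 \<Rightarrow> 'a symf \<Rightarrow> 'a symf" (infixr \<open>\<cdot>\<close> 75)
  is "\<lambda>c f N. Const c * f N"
  by (auto simp: restr_def subst_mult sym_polys_mult sym_polys_Const)
     (metis deg_le_mult deg_le_Const)

lemma vector_space_scale: "vector_space (scale :: 'a::field \<Rightarrow> 'a symf \<Rightarrow> 'a symf)"
  by unfold_locales (transfer, simp add: distrib_left distrib_right mult.assoc Const_add Const_mult)+

text \<open>
  The element of \<open>\<Lambda>\<close> with projections \<open>h N\<close> for \<open>N \<ge> n\<close>.  It is unique; the projections for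
  \<open>N < n\<close> are images of the later ones under \<^const>\<open>restr\<close>.
\<close>

definition symf_lim :: "nat \<Rightarrow> (nat \<Rightarrow> 'a::comm_ring_1 mpoly) \<Rightarrow> 'a symf" where
  "symf_lim n h = (THE g. \<forall>N\<ge>n. proj N g = h N)"

lemma symf_eqI:
  assumes "\<And>N. N \<ge> n \<Longrightarrow> proj N f = proj N g"
  shows "f = g"
proof -
  have step: "proj N k = restr (Suc N) (proj (Suc N) k)" for N and k :: "'a symf"
    using proj_fun[of k] by (simp add: proj_def)
  have "proj (n - j) f = proj (n - j) g" if "j \<le> n" for j
    using that
  proof (induction j)
    case 0
    then show ?case by (simp add: assms)
  next
    case (Suc j)
    then have eq: "Suc (n - Suc j) = n - j" by simp
    from Suc have "proj (n - j) f = proj (n - j) g" by simp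
    then show ?case
      using step[of "n - Suc j" f] step[of "n - Suc j" g] unfolding eq by simp
  qed
  then have "proj N f = proj N g" for N
    using assms[of N] by (cases "N \<ge> n") (metis, metis diff_diff_cancel diff_le_self nle_le)
  then have "proj_fun f = proj_fun g"
    by (simp add: proj_def fun_eq_iff)
  then show ?thesis
    by (simp add: proj_fun_inject)
qed

lemma symf_limI:
  assumes "\<And>N. N \<ge> n \<Longrightarrow> proj N g = h N"
  shows "symf_lim n h = g"
  unfolding symf_lim_def
proof (rule the_equality)
  show "\<forall>N\<ge>n. proj N g = h N" using assms by blast
  show "k = g" if "\<forall>N\<ge>n. proj N k = h N" for k
    using that assms by (intro symf_eqI[of n]) simp
qed

section \<open>Parameters and partitions\<close>

text \<open>\<open>\<F> = \<rat>(q,t)\<close> as the fraction field of \<open>\<rat>[t][q]\<close>, and \<open>\<F>(u)\<close>.\<close>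

type_synonym F = "rat poly poly fract"
type_synonym K = "F poly fract"

definition q_par :: F where "q_par = Fract [:0, 1:] 1"
definition t_par :: F where "t_par = Fract [:[:0, 1:]:] 1"
definition u_par :: K where "u_par = Fract [:0, 1:] 1"

definition emb :: "F \<Rightarrow> K" where "emb c = Fract [:c:] 1"

definition qpoch :: "'a::comm_ring_1 \<Rightarrow> 'a \<Rightarrow> nat \<Rightarrow> 'a" where
  "qpoch u a N = (\<Prod>k<N. 1 - u * a ^ k)"

definition is_partition :: "nat list \<Rightarrow> bool" where
  "is_partition \<mu> \<longleftrightarrow> sorted_wrt (\<ge>) \<mu> \<and> 0 \<notin> set \<mu>"

text \<open>Parts are numbered from 1, and \<open>\<mu>\<^sub>i = 0\<close> for \<open>i > \<ell>(\<mu>)\<close>.\<close>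

definition part :: "nat list \<Rightarrow> nat \<Rightarrow> nat" where
  "part \<mu> i = (if 1 \<le> i \<and> i \<le> length \<mu> then \<mu> ! (i - 1) else 0)"

section \<open>Power sums and the bilinear form\<close>

text \<open>For \<open>n \<ge> 1\<close>; the family is not compatible when \<open>n = 0\<close>.\<close>

definition power_sum :: "nat \<Rightarrow> F symf" where
  "power_sum n = symf_lim 0 (\<lambda>N. \<Sum>i=1..N. X i ^ n)"

definition power_sum_list :: "nat list \<Rightarrow> F symf" where
  "power_sum_list \<mu> = prod_list (map power_sum \<mu>)"

definition z_number :: "nat list \<Rightarrow> nat" where
  "z_number \<mu> = (\<Prod>i\<in>set \<mu>. i ^ count_list \<mu> i * fact (count_list \<mu> i))"

definition is_macdonald_form :: "(F symf \<Rightarrow> F symf \<Rightarrow> F) \<Rightarrow> bool" where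
  "is_macdonald_form B \<longleftrightarrow>
     (\<forall>f. Vector_Spaces.linear scale (*) (\<lambda>g. B f g)) \<and>
     (\<forall>g. Vector_Spaces.linear scale (*) (\<lambda>f. B f g)) \<and>
     (\<forall>\<mu> \<nu>. is_partition \<mu> \<longrightarrow> is_partition \<nu> \<longrightarrow>
        B (power_sum_list \<mu>) (power_sum_list \<nu>) =
          (if \<mu> = \<nu> then of_nat (z_number \<mu>) *
             (\<Prod>i=1..length \<mu>. (1 - q_par ^ part \<mu> i) / (1 - t_par ^ part \<mu> i)) else 0))"

definition macdonald_form :: "F symf \<Rightarrow> F symf \<Rightarrow> F" where
  "macdonald_form = (THE B. is_macdonald_form B)"

text \<open>The operator \<open>f\<^sup>*\<close> adjoint to multiplication by \<open>f\<close>.\<close>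

definition adj :: "F symf \<Rightarrow> F symf \<Rightarrow> F symf" where
  "adj f = (THE S. \<forall>g h. macdonald_form (f * g) h = macdonald_form g (S h))"

section \<open>Hall-Littlewood symmetric functions\<close>

text \<open>The polynomial equal to a given rational function.\<close>

definition the_poly :: "'a::field mpoly fract \<Rightarrow> 'a mpoly" where
  "the_poly r = (THE p. Fract p 1 = r)"

definition HL_v :: "nat \<Rightarrow> nat list \<Rightarrow> F" where
  "HL_v N \<mu> = (let k = (\<lambda>i. if i = 0 then N - length \<mu> else count_list \<mu> i) in
     \<Prod>i\<in>insert 0 (set \<mu>). \<Prod>j=1..k i. (1 - t_par ^ j) / (1 - t_par))"

definition HL_poly :: "nat \<Rightarrow> nat list \<Rightarrow> F mpoly" where
  "HL_poly N \<mu> = Const (inverse (HL_v N \<mu>)) * the_poly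
     (\<Sum>w | w permutes {1..N}.
        (\<Prod>i=1..N. Fract (X (w i) ^ part \<mu> i) 1) *
        (\<Prod>i=1..N. \<Prod>j=i+1..N.
           Fract (X (w i) - Const t_par * X (w j)) (X (w i) - X (w j))))"

definition HL_P :: "nat list \<Rightarrow> F symf" where
  "HL_P \<mu> = symf_lim (length \<mu>) (\<lambda>N. HL_poly N \<mu>)"

definition HL_b :: "nat list \<Rightarrow> F" where
  "HL_b \<mu> = (\<Prod>i\<in>set \<mu>. \<Prod>j=1..count_list \<mu> i. 1 - t_par ^ j)"

definition HL_Q :: "nat list \<Rightarrow> F symf" where
  "HL_Q \<mu> = HL_b \<mu> \<cdot> HL_P \<mu>"

section \<open>Macdonald operators\<close>

text \<open>
  The operators depend on \<open>u\<close> rationally, so they act on polynomials with coefficients in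
  \<open>\<F>(u)\<close>.
\<close>

definition T_op :: "nat \<Rightarrow> K mpoly \<Rightarrow> K mpoly" where
  "T_op i = subst (\<lambda>j. if j = i then Const (emb q_par) * X j else X j)"

definition vandermonde :: "nat \<Rightarrow> K mpoly" where
  "vandermonde N = (\<Prod>i=1..N. \<Prod>j=i+1..N. X i - X j)"

definition D_factor :: "nat \<Rightarrow> (nat \<Rightarrow> nat) \<Rightarrow> nat \<Rightarrow> K mpoly \<Rightarrow> K mpoly" where
  "D_factor N \<sigma> i f =
     X i ^ (N - \<sigma> i) * (f - Const (u_par * emb t_par powi (1 - int (\<sigma> i))) * T_op i f)"

definition compose_upto :: "nat \<Rightarrow> (nat \<Rightarrow> 'b \<Rightarrow> 'b) \<Rightarrow> 'b \<Rightarrow> 'b" where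
  "compose_upto N F = foldr (\<circ>) (map F [1..<Suc N]) id"

definition macdonald_D :: "nat \<Rightarrow> K mpoly \<Rightarrow> K mpoly" where
  "macdonald_D N f = the_poly
     (Fract (\<Sum>\<sigma> | \<sigma> permutes {1..N}. of_int (sign \<sigma>) * compose_upto N (D_factor N \<sigma>) f)
            (vandermonde N))"

definition macdonald_A :: "nat \<Rightarrow> K mpoly \<Rightarrow> K mpoly" where
  "macdonald_A N f =
     Const (inverse (qpoch u_par (inverse (emb t_par)) N)) *
     inv (compose_upto N T_op) (macdonald_D N f)"

text \<open>The limit \<open>A(u)\<close>, acting on \<open>\<Lambda>\<close> with scalars extended to \<open>\<F>(u)\<close>.\<close>

definition macdonald_A_inf :: "K symf \<Rightarrow> K symf" where
  "macdonald_A_inf f = symf_lim 0 (\<lambda>N. macdonald_A N (proj N f))"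

definition ext_scalars :: "F symf \<Rightarrow> K symf" where
  "ext_scalars f = symf_lim 0 (\<lambda>N. Poly_Mapping.map emb (proj N f))"

text \<open>
  \<open>A(u) = 1 + A\<^sup>(\<^sup>1\<^sup>)/(u;t\<^sup>-\<^sup>1)\<^sub>1 + \<dots>\<close>; the index 0 carries the leading coefficient 1.
\<close>

definition is_A_expansion :: "(nat \<Rightarrow> F symf \<Rightarrow> F symf) \<Rightarrow> bool" where
  "is_A_expansion A \<longleftrightarrow>
     A 0 = id \<and> (\<forall>k. Vector_Spaces.linear scale scale (A k)) \<and>
     (\<forall>f. finite {k. A k f \<noteq> 0} \<and>
        macdonald_A_inf (ext_scalars f) =
          (\<Sum>k | A k f \<noteq> 0.
             inverse (qpoch u_par (inverse (emb t_par)) k) \<cdot> ext_scalars (A k f)))"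

definition macdonald_op :: "nat \<Rightarrow> F symf \<Rightarrow> F symf" where
  "macdonald_op = (THE A. is_A_expansion A)"

end

theory Submission
  imports Defs "HOL-Computational_Algebra.Formal_Laurent_Series"
    "HOL-Combinatorics.Multiset_Permutations"
begin

text \<open>
  Identify \<open>\<Lambda>\<close> with \<open>\<F>[p\<^sub>1, p\<^sub>2, \<dots>]\<close>.  Taylor's formula expresses the
  substitution \<open>p\<^sub>n \<mapsto> a\<^sub>n + (1 - q\<^sup>n) b\<^sub>n\<close> through operators adjoint to multiplication; in terms of the
  Hall-Littlewood functions, which are dual bases for the form at \<open>q = 0\<close>, it reads
  \<open>\<Sum>\<^sub>\<lambda> P\<^sub>\<lambda>(b) (Q\<^sub>\<lambda>\<^sup>* f)(a)\<close> with the adjoint relative to the Macdonald form.  Dividing the variables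
  \<open>x\<^sub>i\<close>, \<open>i \<in> I\<close>, by \<open>q\<close> is such a substitution with \<open>b\<^sub>n = \<Sum>\<^sub>i\<^sub>\<in>\<^sub>I (x\<^sub>i / q)\<^sup>n\<close>.  The determinant in
  \<open>D\<^sub>N(u)\<close> thus acts on the functions \<open>P\<^sub>\<lambda>(x\<^sub>I)\<close>, and there it is Macdonald's operator at \<open>q = 0\<close>,
  of which \<open>P\<^sub>\<lambda>\<close> is an eigenvector whose eigenvalue depends on \<open>\<ell>(\<lambda>)\<close> only.
\<close>

text \<open>The factor (T_1...T_N)^(-1) in A_N(u) turns the shift of the variables in a set J into
  the inverse shift of the complement I, which is why q enters through negative powers. The number 1
  - q^n plays two roles: it is the ratio of the Macdonald norm of p_n to its norm at q = 0, and the
  change of x^n under x -> x/q is (1 - q^n)(x/q)^n. Hence an adjoint for the q-form can be combined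
  with bases that are dual at q = 0, and q leaves the determinant altogether. The eigenvalue at q =
  0 is the product of 1 - u t^(-j) for \<ell>(\<lambda>) \<le> j < N; divided by (u;t^(-1))_N it
  becomes 1/(u;t^(-1))_k with k = \<ell>(\<lambda>), which no longer depends on N. The obstacle is
  that the sets I have different sizes while the symmetrized definition of \<open>HL_poly\<close>
  fixes N. Therefore the functions are first built in the power sums by vertex operators, and
  identities are checked at distinct nonzero points of a field, where the denominators x_i - x_j
  make sense. One branching rule, removing a point (\<open>ev_HLM\<close>), yields the
  orthogonality, the agreement with the symmetrized definition and the eigenvalue.\<close>

abbreviation lookup where "lookup \<equiv> Poly_Mapping.lookup"
abbreviation keys where "keys \<equiv> Poly_Mapping.keys"

section \<open>Evaluation of polynomials\<close>

text \<open>Unlike for \<open>mono_eval\<close>, the values may lie in any commutative monoid, since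
  points are later taken in fraction fields, Laurent series and the ring of symmetric
  functions.\<close>

definition pwr :: "(nat \<Rightarrow> 'b::comm_monoid_mult) \<Rightarrow> (nat \<Rightarrow>\<^sub>0 nat) \<Rightarrow> 'b" where
  "pwr a m = (\<Prod>i\<in>keys m. a i ^ lookup m i)"

lemma pwr_superset:
  assumes "finite A" "keys m \<subseteq> A"
  shows "pwr a m = (\<Prod>i\<in>A. a i ^ lookup m i)"
  unfolding pwr_def using assms
  by (intro prod.mono_neutral_left) (auto simp: in_keys_iff)

lemma pwr_0 [simp]: "pwr a 0 = 1"
  by (simp add: pwr_def)

lemma pwr_add: "pwr a (m + n) = pwr a m * pwr a n"
proof -
  let ?A = "keys m \<union> keys n"
  have "pwr a (m + n) = (\<Prod>i\<in>?A. a i ^ lookup (m + n) i)"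
    using keys_add[of m n] by (intro pwr_superset) auto
  also have "\<dots> = pwr a m * pwr a n"
    by (subst (1 2) pwr_superset[of ?A]) (auto simp: lookup_add power_add prod.distrib)
  finally show ?thesis .
qed

lemma pwr_single [simp]: "pwr a (Poly_Mapping.single i k) = a i ^ k"
  by (cases "k = 0") (simp_all add: pwr_def)

lemma pwr_mult: "pwr (\<lambda>i. a i * b i) m = pwr a m * pwr b m"
  by (simp add: pwr_def power_mult_distrib prod.distrib)

lemma mono_eval_eq_pwr: "mono_eval s m = pwr s m"
  by (simp add: mono_eval_def pwr_def)

lemma Const_times_single: "Const c * Poly_Mapping.single m d = Poly_Mapping.single m (c * d :: 'a::comm_semiring_1)"
  by (simp add: Const_def mult_single)

lemma pwr_X: "pwr X m = (Poly_Mapping.single m 1 :: 'a::comm_semiring_1 mpoly)"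
proof -
  have pw: "X i ^ k = (Poly_Mapping.single (Poly_Mapping.single i k) 1 :: 'a mpoly)" for i k
    by (induction k) (simp_all add: X_def mult_single flip: single_add)
  have "(\<Prod>i\<in>A. Poly_Mapping.single (Poly_Mapping.single i (f i)) (1::'a)) =
          Poly_Mapping.single (\<Sum>i\<in>A. Poly_Mapping.single i (f i)) 1" if "finite A" for A and f :: "nat \<Rightarrow> nat"
    using that by induction (simp_all add: mult_single)
  then have "pwr X m = Poly_Mapping.single (\<Sum>i\<in>keys m. Poly_Mapping.single i (lookup m i)) (1::'a)"
    by (simp add: pwr_def pw)
  also have "(\<Sum>i\<in>keys m. Poly_Mapping.single i (lookup m i)) = m"
    by (rule poly_mapping_eqI) (auto simp: lookup_sum lookup_single when_def in_keys_iff)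
  finally show ?thesis .
qed

lemma mpoly_linear_induct [case_names zero add single]:
  fixes f :: "'a::comm_semiring_1 mpoly"
  assumes "P 0" "\<And>f g. P f \<Longrightarrow> P g \<Longrightarrow> P (f + g)" "\<And>m c. P (Poly_Mapping.single m c)"
  shows "P f"
proof -
  have "P (\<Sum>m\<in>A. Poly_Mapping.single m (lookup f m))" if "finite A" for A
    using that by induction (auto intro: assms)
  then show ?thesis by (subst mpoly_sum_single) simp
qed

text \<open>Coefficients and values usually lie in different rings. With the coefficient map as a
  parameter, one evaluation \<open>ev\<close> serves all targets, and \<open>hom_comp_ev\<close>
  moves between them.\<close>

locale hom_of_rings =
  fixes \<iota> :: "'a::comm_ring_1 \<Rightarrow> 'b::comm_ring_1"
  assumes hom_add: "\<iota> (x + y) = \<iota> x + \<iota> y"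
    and hom_mult: "\<iota> (x * y) = \<iota> x * \<iota> y"
    and hom_1 [simp]: "\<iota> 1 = 1"
begin

lemma hom_0 [simp]: "\<iota> 0 = 0"
  using hom_add[of 0 0] by simp

lemma hom_uminus: "\<iota> (- x) = - \<iota> x"
  using hom_add[of x "- x"] by (simp add: eq_neg_iff_add_eq_0 add.commute)

lemma hom_diff: "\<iota> (x - y) = \<iota> x - \<iota> y"
  using hom_add[of x "- y"] by (simp add: hom_uminus)

lemma hom_sum: "\<iota> (sum f A) = (\<Sum>i\<in>A. \<iota> (f i))"
  by (induction A rule: infinite_finite_induct) (simp_all add: hom_add)

lemma hom_prod: "\<iota> (prod f A) = (\<Prod>i\<in>A. \<iota> (f i))"
  by (induction A rule: infinite_finite_induct) (simp_all add: hom_mult)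

lemma hom_power: "\<iota> (x ^ n) = \<iota> x ^ n"
  by (induction n) (simp_all add: hom_mult)

lemma hom_of_nat: "\<iota> (of_nat n) = of_nat n"
  by (induction n) (simp_all add: hom_add)

definition ev :: "(nat \<Rightarrow> 'b) \<Rightarrow> 'a mpoly \<Rightarrow> 'b" where
  "ev a f = (\<Sum>m\<in>keys f. \<iota> (lookup f m) * pwr a m)"

lemma ev_superset:
  assumes "finite A" "keys f \<subseteq> A"
  shows "ev a f = (\<Sum>m\<in>A. \<iota> (lookup f m) * pwr a m)"
  unfolding ev_def using assms
  by (intro sum.mono_neutral_left) (auto simp: in_keys_iff)

lemma ev_0 [simp]: "ev a 0 = 0"
  by (simp add: ev_def)

lemma ev_add: "ev a (f + g) = ev a f + ev a g"
proof -
  let ?A = "keys f \<union> keys g"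
  have "ev a (f + g) = (\<Sum>m\<in>?A. \<iota> (lookup (f + g) m) * pwr a m)"
    using keys_add[of f g] by (intro ev_superset) auto
  also have "\<dots> = ev a f + ev a g"
    by (subst (1 2) ev_superset[of ?A]) (auto simp: lookup_add hom_add distrib_right sum.distrib)
  finally show ?thesis .
qed

lemma ev_single: "ev a (Poly_Mapping.single m c) = \<iota> c * pwr a m"
  by (cases "c = 0") (simp_all add: ev_def)

lemma ev_Const [simp]: "ev a (Const c) = \<iota> c"
  by (simp add: Const_def ev_single)

lemma ev_1 [simp]: "ev a 1 = 1"
  using ev_Const[of a 1] by simp

lemma ev_X [simp]: "ev a (X i) = a i"
  by (simp add: X_def ev_single)

lemma ev_mult: "ev a (f * g) = ev a f * ev a g"
proof (induction f rule: mpoly_linear_induct)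
  case (single m c)
  show ?case
    by (induction g rule: mpoly_linear_induct)
       (simp_all add: mult_single ev_single hom_mult pwr_add ev_add distrib_left distrib_right mult_ac)
qed (simp_all add: ev_add distrib_right)

lemma hom_ev: "hom_of_rings (ev a)"
  by unfold_locales (simp_all add: ev_add ev_mult)

lemmas ev_sum = hom_of_rings.hom_sum[OF hom_ev]
  and ev_power = hom_of_rings.hom_power[OF hom_ev]
  and ev_diff = hom_of_rings.hom_diff[OF hom_ev]

lemma pwr_hom: "\<iota> (pwr a m) = pwr (\<lambda>i. \<iota> (a i)) m"
  by (simp add: pwr_def hom_prod hom_power)

end

lemma hom_of_rings_comp:
  assumes "hom_of_rings f" "hom_of_rings g"
  shows "hom_of_rings (\<lambda>x. g (f x))"
proof -
  interpret f: hom_of_rings f by fact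
  interpret g: hom_of_rings g by fact
  show ?thesis by unfold_locales (simp_all add: f.hom_add g.hom_add f.hom_mult g.hom_mult)
qed

lemma hom_comp_ev:
  assumes "hom_of_rings f" "hom_of_rings g"
  shows "g (hom_of_rings.ev f a p) = hom_of_rings.ev (\<lambda>x. g (f x)) (\<lambda>i. g (a i)) p"
proof -
  interpret f: hom_of_rings f by fact
  interpret g: hom_of_rings g by fact
  interpret gf: hom_of_rings "\<lambda>x. g (f x)" by (rule hom_of_rings_comp) fact+
  show ?thesis by (simp add: f.ev_def gf.ev_def g.hom_sum g.hom_mult g.pwr_hom)
qed

lemma ev_eq_hom:
  assumes "hom_of_rings h"
  shows "h p = hom_of_rings.ev (\<lambda>c. h (Const c)) (\<lambda>i. h (X i)) p"
proof -
  interpret h: hom_of_rings h by fact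
  interpret hc: hom_of_rings "\<lambda>c. h (Const c)"
    by unfold_locales (simp_all add: Const_add Const_mult h.hom_add h.hom_mult)
  show ?thesis
  proof (induction p rule: mpoly_linear_induct)
    case (single m c)
    have "Poly_Mapping.single m c = Const c * pwr X m"
      by (simp add: pwr_X Const_times_single)
    then have "h (Poly_Mapping.single m c) = h (Const c) * pwr (\<lambda>i. h (X i)) m"
      by (simp add: h.hom_mult h.pwr_hom)
    then show ?case by (simp add: hc.ev_single)
  qed (simp_all add: h.hom_add hc.ev_add)
qed

lemma hom_Const: "hom_of_rings (Const :: 'a::comm_ring_1 \<Rightarrow> 'a mpoly)"
  by unfold_locales (simp_all add: Const_add Const_mult)

lemma subst_eq_ev: "subst = hom_of_rings.ev (Const :: 'a::comm_ring_1 \<Rightarrow> 'a mpoly)"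
  by (intro ext) (simp add: subst_def hom_of_rings.ev_def[OF hom_Const] mono_eval_eq_pwr)

lemma hom_subst: "hom_of_rings (subst s :: 'a::comm_ring_1 mpoly \<Rightarrow> _)"
  unfolding subst_eq_ev by (rule hom_of_rings.hom_ev[OF hom_Const])

lemma subst_X [simp]: "subst s (X i) = (s i :: 'a::comm_ring_1 mpoly)"
  unfolding subst_eq_ev by (rule hom_of_rings.ev_X[OF hom_Const])

section \<open>Weighted degree\<close>

text \<open>The variable \<^term>\<open>X i\<close> will stand for the power sum of degree \<open>i + 1\<close>.\<close>

definition wt :: "(nat \<Rightarrow>\<^sub>0 nat) \<Rightarrow> nat" where
  "wt m = (\<Sum>i\<in>keys m. Suc i * lookup m i)"

lemma wt_superset:
  assumes "finite A" "keys m \<subseteq> A"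
  shows "wt m = (\<Sum>i\<in>A. Suc i * lookup m i)"
  unfolding wt_def using assms by (intro sum.mono_neutral_left) (auto simp: in_keys_iff)

lemma wt_add: "wt (m + n) = wt m + wt n"
proof -
  let ?A = "keys m \<union> keys n"
  have "wt (m + n) = (\<Sum>i\<in>?A. Suc i * lookup (m + n) i)"
    using keys_add[of m n] by (intro wt_superset) auto
  also have "\<dots> = wt m + wt n"
    by (subst (1 2) wt_superset[of ?A]) (auto simp: lookup_add distrib_left sum.distrib)
  finally show ?thesis .
qed

lemma wt_0 [simp]: "wt 0 = 0" by (simp add: wt_def)

lemma wt_single [simp]: "wt (Poly_Mapping.single i k) = Suc i * k"
  by (cases "k = 0") (simp_all add: wt_def)

lemma wt_eq_0_iff [simp]: "wt m = 0 \<longleftrightarrow> m = 0"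
  by (auto simp: wt_def in_keys_iff intro!: poly_mapping_eqI)

lemma lookup_le_wt: "Suc i * lookup m i \<le> wt m"
proof (cases "i \<in> keys m")
  case True
  then show ?thesis unfolding wt_def by (intro member_le_sum) auto
qed (simp add: in_keys_iff)

definition exps :: "nat \<Rightarrow> (nat \<Rightarrow>\<^sub>0 nat) set" where
  "exps d = {m. wt m \<le> d}"

lemma finite_exps [simp]: "finite (exps d)"
proof -
  have "inj_on lookup (exps d)"
    by (intro inj_onI poly_mapping_eqI) simp
  moreover have "lookup m \<in> {f. \<forall>i. (i \<in> {..d} \<longrightarrow> f i \<in> {..d}) \<and> (i \<notin> {..d} \<longrightarrow> f i = 0)}" if "m \<in> exps d" for m
  proof -
    have le: "Suc i * lookup m i \<le> d" for i
      using that lookup_le_wt[of i m] by (simp add: exps_def)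
    have "lookup m i \<le> d" for i by (rule order.trans[OF _ le[of i]]) simp
    moreover have "lookup m i = 0" if "\<not> i \<le> d" for i
      using le[of i] that by (cases "lookup m i") auto
    ultimately show ?thesis by auto
  qed
  then have "lookup ` exps d \<subseteq> {f. \<forall>i. (i \<in> {..d} \<longrightarrow> f i \<in> {..d}) \<and> (i \<notin> {..d} \<longrightarrow> f i = 0)}"
    by (rule image_subsetI)
  moreover have "finite {f. \<forall>i. (i \<in> {..d} \<longrightarrow> f i \<in> {..d}) \<and> (i \<notin> {..d} \<longrightarrow> f i = (0::nat))}"
    by (rule finite_set_of_finite_funs) simp_all
  ultimately show ?thesis
    by (intro finite_imageD[of lookup] finite_subset[of "lookup ` exps d"])
qed

definition homog :: "nat \<Rightarrow> 'a::zero mpoly \<Rightarrow> bool" where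
  "homog d f \<longleftrightarrow> (\<forall>m\<in>keys f. wt m = d)"

definition bounded_wt :: "nat \<Rightarrow> 'a::zero mpoly \<Rightarrow> bool" where
  "bounded_wt d f \<longleftrightarrow> keys f \<subseteq> exps d"

lemma homog_imp_bounded: "homog d f \<Longrightarrow> bounded_wt d f"
  by (auto simp: homog_def bounded_wt_def exps_def)

lemma bounded_wt_mono: "bounded_wt d f \<Longrightarrow> d \<le> e \<Longrightarrow> bounded_wt e f"
  by (force simp: bounded_wt_def exps_def)

lemma bounded_wt_ex: "\<exists>d. bounded_wt d f"
  by (rule exI[of _ "Max (insert 0 (wt ` keys f))"]) (auto simp: bounded_wt_def exps_def)

lemma homog_0 [simp]: "homog d 0" by (simp add: homog_def)

lemma homog_add: "homog d f \<Longrightarrow> homog d g \<Longrightarrow> homog d (f + g)"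
  unfolding homog_def using keys_add[of f g] by blast

lemma homog_sum: "(\<And>i. i \<in> A \<Longrightarrow> homog d (f i)) \<Longrightarrow> homog d (sum f A)"
  by (induction A rule: infinite_finite_induct) (auto intro: homog_add)

lemma homog_mult: "homog d f \<Longrightarrow> homog e g \<Longrightarrow> homog (d + e) (f * g)"
  unfolding homog_def using keys_mult[of f g] by (fastforce simp: wt_add)

lemma homog_single: "wt m = d \<Longrightarrow> homog d (Poly_Mapping.single m c)"
  by (simp add: homog_def)

lemma homog_Const: "homog 0 (Const c)"
  by (simp add: Const_def homog_single)

text \<open>Used with \<open>s\<close> the image of 1/q, where it produces the power of q in the
  theorem, and with \<open>s = 0\<close>, where it makes elements of positive degree vanish on the
  empty set of points.\<close>

lemma (in hom_of_rings) ev_homog: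
  assumes "homog d f"
  shows "ev (\<lambda>i. s ^ Suc i * a i) f = s ^ d * ev a f"
proof -
  have "pwr (\<lambda>i. s ^ Suc i) m = s ^ wt m" for m
    by (simp add: pwr_def wt_def power_sum flip: power_mult power_Suc)
  then show ?thesis
    using assms unfolding ev_def sum_distrib_left pwr_mult
    by (intro sum.cong) (auto simp: homog_def)
qed

section \<open>Diagonal bilinear forms\<close>

instance fract :: ("{idom,ring_char_0}") ring_char_0
proof
  show "inj (of_nat :: nat \<Rightarrow> 'a fract)"
    by (auto simp: inj_on_def of_nat_fract eq_fract)
qed

instance fract :: ("{idom,ring_char_0}") field_char_0 ..

text \<open>The squared norm of the monomial with exponent \<open>m\<close> when the variables have weights \<open>w\<close>.\<close>

definition nrm :: "(nat \<Rightarrow> 'a::field_char_0) \<Rightarrow> (nat \<Rightarrow>\<^sub>0 nat) \<Rightarrow> 'a" where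
  "nrm w m = (\<Prod>i\<in>keys m. fact (lookup m i) * w i ^ lookup m i)"

lemma nrm_superset:
  assumes "finite A" "keys m \<subseteq> A"
  shows "nrm w m = (\<Prod>i\<in>A. fact (lookup m i) * w i ^ lookup m i)"
  unfolding nrm_def using assms by (intro prod.mono_neutral_left) (auto simp: in_keys_iff)

lemma nrm_nonzero: "(\<And>i. w i \<noteq> 0) \<Longrightarrow> nrm w m \<noteq> 0"
  by (simp add: nrm_def)

lemma nrm_0 [simp]: "nrm w 0 = 1" by (simp add: nrm_def)

text \<open>Monomials in the power sums are orthogonal for every form that occurs, so the weights
  determine it: \<open>w0\<close> gives the form at q = 0, \<open>wq\<close> the Macdonald
  form.\<close>

definition form :: "(nat \<Rightarrow> 'a::field_char_0) \<Rightarrow> 'a mpoly \<Rightarrow> 'a mpoly \<Rightarrow> 'a" where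
  "form w f g = (\<Sum>m\<in>keys f. lookup f m * lookup g m * nrm w m)"

lemma form_superset:
  assumes "finite A" "keys f \<subseteq> A"
  shows "form w f g = (\<Sum>m\<in>A. lookup f m * lookup g m * nrm w m)"
  unfolding form_def using assms by (intro sum.mono_neutral_left) (auto simp: in_keys_iff)

lemma form_sym: "form w f g = form w g f"
  by (subst (1 2) form_superset[of "keys f \<union> keys g"]) (auto simp: mult_ac)

lemma form_add_left: "form w (f + f') g = form w f g + form w f' g"
proof -
  have "form w (f + f') g = (\<Sum>m\<in>keys f \<union> keys f'. lookup (f + f') m * lookup g m * nrm w m)"
    using keys_add[of f f'] by (intro form_superset) auto
  also have "\<dots> = form w f g + form w f' g"
    by (subst (1 2) form_superset[of "keys f \<union> keys f'"])
       (auto simp: lookup_add distrib_right sum.distrib)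
  finally show ?thesis .
qed

lemma form_add_right: "form w f (g + g') = form w f g + form w f g'"
  by (metis form_add_left form_sym)

lemma form_0 [simp]: "form w 0 g = 0" "form w f 0 = 0"
  by (simp_all add: form_def)

lemma lookup_Const_mult: "lookup (Const c * f) m = c * lookup f (m :: nat \<Rightarrow>\<^sub>0 nat)"
  for f :: "'a::comm_ring_1 mpoly"
  by (induction f rule: mpoly_linear_induct)
     (simp_all add: Const_times_single lookup_single when_def lookup_add distrib_left)

lemma keys_Const_mult: "keys (Const c * f) \<subseteq> keys (f :: 'a::comm_ring_1 mpoly)"
  by (auto simp: in_keys_iff lookup_Const_mult)

lemma homog_Const_mult: "homog d f \<Longrightarrow> homog d (Const c * f)" for f :: "'a::comm_ring_1 mpoly"
  using keys_Const_mult[of c f] by (auto simp: homog_def)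

lemma form_scale_left: "form w (Const c * f) g = c * form w f g"
  unfolding form_superset[OF finite_keys keys_Const_mult[of c f]]
  unfolding form_def lookup_Const_mult sum_distrib_left by (simp only: mult.assoc)

lemma form_scale_right: "form w f (Const c * g) = c * form w f g"
  by (metis form_sym form_scale_left)

lemma form_sum_left: "form w (sum f A) g = (\<Sum>i\<in>A. form w (f i) g)"
  by (induction A rule: infinite_finite_induct) (simp_all add: form_add_left)

lemma form_sum_right: "form w g (sum f A) = (\<Sum>i\<in>A. form w g (f i))"
  by (induction A rule: infinite_finite_induct) (simp_all add: form_add_right)

lemma form_single_left: "form w (Poly_Mapping.single m c) g = c * lookup g m * nrm w m"
  by (cases "c = 0") (simp_all add: form_def)

lemma form_homog_neq:
  "homog d f \<Longrightarrow> homog e g \<Longrightarrow> d \<noteq> e \<Longrightarrow> form w f g = 0"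
  unfolding form_def homog_def by (intro sum.neutral) (auto simp: in_keys_iff)

lemma form_nondegenerate:
  assumes "\<And>i. w i \<noteq> 0" and "\<And>g. form w g f = form w g f'"
  shows "f = f'"
proof (rule poly_mapping_eqI)
  fix m
  show "lookup f m = lookup f' m"
    using assms(2)[of "Poly_Mapping.single m 1"] nrm_nonzero[of w m] assms(1)
    by (simp add: form_single_left)
qed

subsection \<open>Adjoint operators\<close>

definition dvm :: "(nat \<Rightarrow>\<^sub>0 nat) \<Rightarrow> (nat \<Rightarrow>\<^sub>0 nat) \<Rightarrow> bool" where
  "dvm m n \<longleftrightarrow> (\<forall>i. lookup m i \<le> lookup n i)"

lemma dvm_add [simp]: "dvm m (m + n)" by (simp add: dvm_def lookup_add)

lemma dvm_diff: "dvm m n \<Longrightarrow> m + (n - m) = n"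
  by (auto simp: dvm_def lookup_add lookup_minus intro!: poly_mapping_eqI)

lemma dvm_iff: "dvm m n \<longleftrightarrow> (\<exists>k. n = m + k)"
  by (metis dvm_add dvm_diff)

text \<open>The coefficient is forced by pairing with the monomial \<open>n - m\<close>. For a
  single variable the operator is \<open>w i\<close> times the derivative with respect to
  \<open>X i\<close>.\<close>

definition star_single :: "(nat \<Rightarrow> 'a::field_char_0) \<Rightarrow> (nat \<Rightarrow>\<^sub>0 nat) \<Rightarrow> (nat \<Rightarrow>\<^sub>0 nat) \<Rightarrow> 'a mpoly" where
  "star_single w m n = (if dvm m n then Poly_Mapping.single (n - m) (nrm w n / nrm w (n - m)) else 0)"

text \<open>The adjoint, for \<^const>\<open>form\<close>, of multiplication by \<open>f\<close>.\<close>

definition star :: "(nat \<Rightarrow> 'a::field_char_0) \<Rightarrow> 'a mpoly \<Rightarrow> 'a mpoly \<Rightarrow> 'a mpoly" where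
  "star w f h = (\<Sum>m\<in>keys f. \<Sum>n\<in>keys h. Const (lookup f m * lookup h n) * star_single w m n)"

lemma star_superset:
  assumes "finite A" "keys f \<subseteq> A" "finite B" "keys h \<subseteq> B"
  shows "star w f h = (\<Sum>m\<in>A. \<Sum>n\<in>B. Const (lookup f m * lookup h n) * star_single w m n)"
proof -
  have "star w f h = (\<Sum>m\<in>keys f. \<Sum>n\<in>B. Const (lookup f m * lookup h n) * star_single w m n)"
    unfolding star_def using assms
    by (intro sum.cong refl sum.mono_neutral_left) (auto simp: in_keys_iff)
  also have "\<dots> = (\<Sum>m\<in>A. \<Sum>n\<in>B. Const (lookup f m * lookup h n) * star_single w m n)"
    using assms by (intro sum.mono_neutral_left) (auto simp: in_keys_iff)
  finally show ?thesis .
qed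

lemma star_0 [simp]: "star w 0 h = 0" "star w f 0 = 0"
  by (simp_all add: star_def)

lemma star_add_left: "star w (f + f') h = star w f h + star w f' h"
proof -
  let ?A = "keys f \<union> keys f'"
  have "star w (f + f') h = (\<Sum>m\<in>?A. \<Sum>n\<in>keys h. Const (lookup (f + f') m * lookup h n) * star_single w m n)"
    using keys_add[of f f'] by (intro star_superset) auto
  also have "\<dots> = star w f h + star w f' h"
    by (subst (1 2) star_superset[of ?A _ "keys h"])
       (auto simp: lookup_add distrib_right Const_add sum.distrib)
  finally show ?thesis .
qed

lemma star_add_right: "star w f (h + h') = star w f h + star w f h'"
proof -
  let ?A = "keys h \<union> keys h'"
  have "star w f (h + h') = (\<Sum>m\<in>keys f. \<Sum>n\<in>?A. Const (lookup f m * lookup (h + h') n) * star_single w m n)"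
    using keys_add[of h h'] by (intro star_superset) auto
  also have "\<dots> = star w f h + star w f h'"
    by (subst (1 2) star_superset[of "keys f" _ ?A])
       (auto simp: lookup_add distrib_left distrib_right Const_add sum.distrib)
  finally show ?thesis .
qed

lemma star_sum_left: "star w (sum f A) h = (\<Sum>i\<in>A. star w (f i) h)"
  by (induction A rule: infinite_finite_induct) (simp_all add: star_add_left)

lemma star_sum_right: "star w f (sum h A) = (\<Sum>i\<in>A. star w f (h i))"
  by (induction A rule: infinite_finite_induct) (simp_all add: star_add_right)

lemma star_single_single:
  "star w (Poly_Mapping.single m a) (Poly_Mapping.single n b) = Const (a * b) * star_single w m n"
  by (subst star_superset[of "{m}" _ "{n}"]) simp_all

lemma star_scale_left: "star w (Const c * f) h = Const c * star w f h"
proof (induction f rule: mpoly_linear_induct)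
  case (single m a)
  show ?case
    by (induction h rule: mpoly_linear_induct)
       (simp_all add: star_add_right distrib_left Const_times_single star_single_single Const_mult mult_ac)
qed (simp_all add: star_add_left distrib_left)

lemma star_scale_right: "star w f (Const c * h) = Const c * star w f h"
proof (induction f rule: mpoly_linear_induct)
  case (single m a)
  show ?case
    by (induction h rule: mpoly_linear_induct)
       (simp_all add: star_add_right distrib_left Const_times_single star_single_single Const_mult mult_ac)
qed (simp_all add: star_add_left distrib_left)

lemma form_star:
  assumes "\<And>i. w i \<noteq> 0"
  shows "form w (f * g) h = form w g (star w f h)"
proof (induction f rule: mpoly_linear_induct)
  case (single m a)
  show ?case
  proof (induction g rule: mpoly_linear_induct)
    case g: (single k b)
    show ?case
    proof (induction h rule: mpoly_linear_induct)
      case (single n c)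
      show ?case
        using nrm_nonzero[of w k] assms dvm_diff[of m n]
        by (auto simp: mult_single form_single_left star_single_single lookup_single when_def
            lookup_Const_mult star_single_def)
    qed (simp_all add: star_add_right form_add_right)
  qed (simp_all add: distrib_left form_add_left)
qed (simp_all add: distrib_right form_add_left form_add_right star_add_left)

lemma star_1 [simp]:
  assumes "\<And>i. w i \<noteq> 0"
  shows "star w 1 h = h"
  by (rule form_nondegenerate[of w, OF assms]) (simp_all add: form_star[OF assms, symmetric])

text \<open>The adjoint lowers the weight by \<open>e\<close>. This makes every sum over partitions
  below finite.\<close>

lemma star_homog_zero:
  assumes "homog e f" "bounded_wt d h" "d < e"
  shows "star w f h = 0"
  unfolding star_def
proof (intro sum.neutral ballI)
  fix m n assume "m \<in> keys f" "n \<in> keys h"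
  with assms have "wt m = e" "wt n \<le> d" by (auto simp: homog_def bounded_wt_def exps_def)
  with assms(3) have "\<not> dvm m n" by (auto simp: dvm_iff wt_add)
  then show "Const (lookup f m * lookup h n) * star_single w m n = 0"
    by (simp add: star_single_def)
qed

lemma star_homog:
  assumes "homog e f" "homog d h"
  shows "homog (d - e) (star w f h)"
  unfolding star_def
proof (intro homog_sum homog_Const_mult)
  fix m n assume "m \<in> keys f" "n \<in> keys h"
  with assms have "wt m = e" "wt n = d" by (auto simp: homog_def)
  then show "homog (d - e) (star_single w m n)"
    by (auto simp: star_single_def dvm_iff wt_add intro!: homog_single)
qed

subsection \<open>Taylor expansion\<close>

text \<open>The binomial theorem in each variable; choosing one exponent per variable amounts to
  choosing a monomial that divides \<open>n\<close>.\<close>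

lemma (in hom_of_rings) pwr_add_expand:
  "pwr (\<lambda>i. a i + b i) n =
     (\<Sum>m | dvm m n. of_nat (\<Prod>i\<in>keys n. lookup n i choose lookup m i) * pwr b m * pwr a (n - m) :: 'b)"
proof -
  let ?K = "keys n" and ?P = "PiE (keys n) (\<lambda>i. {..lookup n i})"
  let ?F = "\<lambda>g. Abs_poly_mapping (\<lambda>i. if i \<in> ?K then g i else 0) :: nat \<Rightarrow>\<^sub>0 nat"
  have lF: "lookup (?F g) = (\<lambda>i. if i \<in> ?K then g i else 0)" for g
  proof -
    have "finite {i. (if i \<in> ?K then g i else 0) \<noteq> 0}"
      by (rule finite_subset[of _ ?K]) (auto split: if_splits)
    then show ?thesis by simp
  qed
  have "pwr (\<lambda>i. a i + b i) n = (\<Prod>i\<in>?K. \<Sum>k\<le>lookup n i. of_nat (lookup n i choose k) * b i ^ k * a i ^ (lookup n i - k))"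
    unfolding pwr_def by (intro prod.cong refl) (subst add.commute, simp add: binomial_ring)
  also have "\<dots> = (\<Sum>g\<in>?P. \<Prod>i\<in>?K. of_nat (lookup n i choose g i) * b i ^ g i * a i ^ (lookup n i - g i))"
    by (rule prod_sum_PiE) simp_all
  also have "\<dots> = (\<Sum>m | dvm m n. of_nat (\<Prod>i\<in>?K. lookup n i choose lookup m i) * pwr b m * pwr a (n - m))"
  proof (rule sum.reindex_bij_witness[of _ "\<lambda>m. restrict (lookup m) ?K" ?F])
    fix g assume g: "g \<in> ?P"
    have FK: "keys (?F g) \<subseteq> ?K" "keys (n - ?F g) \<subseteq> ?K"
      by (auto simp: in_keys_iff lF lookup_minus split: if_splits)
    show "restrict (lookup (?F g)) ?K = g"
      using g by (auto simp: lF PiE_def extensional_def)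
    show "?F g \<in> {m. dvm m n}"
      using g by (auto simp: dvm_def lF PiE_def Pi_def)
    show "of_nat (\<Prod>i\<in>?K. lookup n i choose lookup (?F g) i) * pwr b (?F g) * pwr a (n - ?F g)
        = (\<Prod>i\<in>?K. of_nat (lookup n i choose g i) * b i ^ g i * a i ^ (lookup n i - g i))"
      unfolding pwr_superset[OF finite_keys FK(1)] pwr_superset[OF finite_keys FK(2)]
      by (simp add: lF lookup_minus prod.distrib)
  next
    fix m assume m: "m \<in> {m. dvm m n}"
    have "lookup m i = 0" if "i \<notin> ?K" for i
      using m that by (simp add: dvm_def in_keys_iff) (metis le_zero_eq)
    then show "?F (restrict (lookup m) ?K) = m"
      by (intro poly_mapping_eqI) (auto simp: lF)
    show "restrict (lookup m) ?K \<in> ?P"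
      using m by (auto simp: dvm_def)
  qed
  finally show ?thesis .
qed

text \<open>The binomial coefficients of a Taylor expansion are quotients of norms, and rescaling
  the weights by \<open>c\<close> only contributes \<open>pwr c m\<close>.\<close>

lemma nrm_choose:
  assumes "dvm m n" "\<And>i. w i \<noteq> 0" "\<And>i. c i \<noteq> 0"
  shows "nrm (\<lambda>i. c i * w i) n / nrm (\<lambda>i. c i * w i) (n - m) =
    of_nat (\<Prod>i\<in>keys n. lookup n i choose lookup m i) * pwr c m * nrm w m"
proof -
  let ?K = "keys n"
  have K: "keys m \<subseteq> ?K" "keys (n - m) \<subseteq> ?K"
  proof -
    have "x \<in> ?K" if "x \<in> keys m" for x
      using assms(1) that by (metis dvm_def in_keys_iff le_zero_eq)
    then show "keys m \<subseteq> ?K" by blast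
    show "keys (n - m) \<subseteq> ?K" by (auto simp: in_keys_iff lookup_minus)
  qed
  have *: "(fact (lookup n i) * (c i * w i) ^ lookup n i) / (fact (lookup (n - m) i) * (c i * w i) ^ lookup (n - m) i) =
     of_nat (lookup n i choose lookup m i) * c i ^ lookup m i * (fact (lookup m i) * w i ^ lookup m i)" for i
  proof -
    have le: "lookup m i \<le> lookup n i" using assms(1) by (simp add: dvm_def)
    have nz: "c i * w i \<noteq> 0" using assms by simp
    have "(c i * w i) ^ lookup n i = (c i * w i) ^ lookup m i * (c i * w i) ^ (lookup n i - lookup m i)"
      using le by (simp flip: power_add)
    then show ?thesis
      using nz le by (simp add: binomial_fact lookup_minus power_mult_distrib field_simps)
  qed
  show ?thesis
    unfolding nrm_superset[OF finite_keys K(1)] nrm_superset[OF finite_keys K(2)]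
      pwr_superset[OF finite_keys K(1)] nrm_def[of _ n]
    unfolding prod_dividef[symmetric] unfolding * unfolding of_nat_prod prod.distrib by (rule refl)
qed

locale hom_of_field = hom_of_rings \<iota> for \<iota> :: "'a::field_char_0 \<Rightarrow> 'b::comm_ring_1"
begin

text \<open>On monomials this is the binomial expansion with its coefficients rewritten by
  \<open>nrm_choose\<close>. The factor \<open>c\<close> is absorbed by the adjoint, while the
  inverse norms still belong to the weights \<open>w\<close>; so an adjoint for one form meets a
  dual basis for another.\<close>

lemma taylor:
  assumes "bounded_wt d f" "\<And>i. w i \<noteq> 0" "\<And>i. c i \<noteq> 0"
  shows "ev (\<lambda>i. a i + \<iota> (c i) * b i) f =
    (\<Sum>m\<in>exps d. \<iota> (1 / nrm w m) * pwr b m * ev a (star (\<lambda>i. c i * w i) (Poly_Mapping.single m 1) f))"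
proof -
  let ?w = "\<lambda>i. c i * w i"
  have *: "ev (\<lambda>i. a i + \<iota> (c i) * b i) (Poly_Mapping.single n x) =
    (\<Sum>m\<in>exps d. \<iota> (1 / nrm w m) * pwr b m * ev a (star ?w (Poly_Mapping.single m 1) (Poly_Mapping.single n x)))"
    if "n \<in> exps d" for n x
  proof -
    have sub: "{m. dvm m n} \<subseteq> exps d"
      using that by (auto simp: exps_def dvm_iff wt_add)
    have trm: "\<iota> (1 / nrm w m) * pwr b m * ev a (star ?w (Poly_Mapping.single m 1) (Poly_Mapping.single n x)) =
       \<iota> x * (of_nat (\<Prod>i\<in>keys n. lookup n i choose lookup m i) * pwr (\<lambda>i. \<iota> (c i) * b i) m * pwr a (n - m))"
      if "dvm m n" for m
    proof -
      have "\<iota> (1 / nrm w m) * \<iota> (nrm ?w n / nrm ?w (n - m)) = of_nat (\<Prod>i\<in>keys n. lookup n i choose lookup m i) * \<iota> (pwr c m)"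
        unfolding nrm_choose[OF that assms(2,3)] using nrm_nonzero[of w m] assms(2)
        by (simp flip: hom_mult hom_of_nat)
      moreover have "ev a (star ?w (Poly_Mapping.single m 1) (Poly_Mapping.single n x)) =
          \<iota> x * \<iota> (nrm ?w n / nrm ?w (n - m)) * pwr a (n - m)"
        using that by (simp add: star_single_single star_single_def ev_single ev_mult)
      ultimately show ?thesis
        unfolding pwr_mult pwr_hom by (simp only: mult.assoc mult.left_commute mult.commute)
    qed
    have "(\<Sum>m\<in>exps d. \<iota> (1 / nrm w m) * pwr b m * ev a (star ?w (Poly_Mapping.single m 1) (Poly_Mapping.single n x)))
      = (\<Sum>m | dvm m n. \<iota> (1 / nrm w m) * pwr b m * ev a (star ?w (Poly_Mapping.single m 1) (Poly_Mapping.single n x)))"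
      using sub by (intro sum.mono_neutral_right) (auto simp: star_single_single star_single_def)
    also have "\<dots> = \<iota> x * pwr (\<lambda>i. a i + \<iota> (c i) * b i) n"
      unfolding pwr_add_expand sum_distrib_left by (intro sum.cong refl trm) simp
    finally show ?thesis by (simp add: ev_single)
  qed
  have "ev (\<lambda>i. a i + \<iota> (c i) * b i) f =
      (\<Sum>n\<in>keys f. ev (\<lambda>i. a i + \<iota> (c i) * b i) (Poly_Mapping.single n (lookup f n)))"
    by (subst mpoly_sum_single) (simp only: ev_sum)
  also have "\<dots> = (\<Sum>n\<in>keys f. \<Sum>m\<in>exps d. \<iota> (1 / nrm w m) * pwr b m *
       ev a (star ?w (Poly_Mapping.single m 1) (Poly_Mapping.single n (lookup f n))))"
    using assms(1) by (intro sum.cong refl *) (auto simp: bounded_wt_def)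
  also have "\<dots> = (\<Sum>m\<in>exps d. \<iota> (1 / nrm w m) * pwr b m *
       ev a (star ?w (Poly_Mapping.single m 1) (\<Sum>n\<in>keys f. Poly_Mapping.single n (lookup f n))))"
    by (subst sum.swap) (simp add: star_sum_right ev_sum sum_distrib_left)
  finally show ?thesis by (simp flip: mpoly_sum_single)
qed

end

section \<open>The Hall-Littlewood functions of one row\<close>

lemma monom_power_neq_1:
  assumes "n \<ge> 1" shows "[:0, 1 :: 'a::comm_ring_1:] ^ n \<noteq> 1"
proof
  assume "[:0, 1 :: 'a:] ^ n = 1"
  then have "poly ([:0, 1 :: 'a:] ^ n) 0 = poly 1 0" by (simp only:)
  then show False using assms by (simp add: poly_power power_0_left split: if_splits)
qed

lemma q_par_power: "n \<ge> 1 \<Longrightarrow> q_par ^ n \<noteq> 1"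
proof -
  have "q_par ^ n = Fract ([:0, 1:] ^ n) 1"
    by (induction n) (simp_all add: q_par_def One_fract_def)
  then show "n \<ge> 1 \<Longrightarrow> q_par ^ n \<noteq> 1"
    by (simp add: One_fract_def eq_fract monom_power_neq_1)
qed

lemma t_par_power: "n \<ge> 1 \<Longrightarrow> t_par ^ n \<noteq> 1"
proof -
  have "t_par ^ n = Fract [:[:0, 1:] ^ n:] 1"
    by (induction n) (simp_all add: t_par_def One_fract_def mult_ac one_pCons)
  moreover have "[:p:] = 1 \<longleftrightarrow> p = 1" for p :: "rat poly"
    by (simp add: one_pCons)
  ultimately show "n \<ge> 1 \<Longrightarrow> t_par ^ n \<noteq> 1"
    by (simp add: One_fract_def eq_fract monom_power_neq_1)
qed

lemma q_par_nonzero [simp]: "q_par \<noteq> 0"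
  using q_par_power[of 1] by (simp add: q_par_def Zero_fract_def eq_fract)

lemma t_par_nonzero [simp]: "t_par \<noteq> 0"
  by (simp add: t_par_def Zero_fract_def eq_fract)

text \<open>The squared norm of the power sum of degree \<open>i + 1\<close> in the form at q =
  0.\<close>

definition w0 :: "nat \<Rightarrow> F" where
  "w0 i = of_nat (Suc i) / (1 - t_par ^ Suc i)"

lemma w0_nonzero: "w0 i \<noteq> 0"
  using t_par_power[of "Suc i"] by (simp add: w0_def del: power_Suc of_nat_Suc)

text \<open>The one-row function q_r: the part of degree r of exp(\<Sum> (1 - t^n) p_n / n),
  expanded into monomials in the p_n.\<close>

definition qs :: "nat \<Rightarrow> F mpoly" where
  "qs r = (\<Sum>m | wt m = r. Poly_Mapping.single m (1 / nrm w0 m))"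

lemma finite_wt_eq [simp]: "finite {m. wt m = r}"
  by (rule finite_subset[OF _ finite_exps[of r]]) (auto simp: exps_def)

lemma homog_qs: "homog r (qs r)"
  unfolding qs_def by (intro homog_sum homog_single) simp

lemma qs_0 [simp]: "qs 0 = 1"
  by (simp add: qs_def)

lemma star_qs: "star w (qs r) f = (\<Sum>m | wt m = r. Const (1 / nrm w0 m) * star w (Poly_Mapping.single m 1) f)"
proof -
  have "qs r = (\<Sum>m | wt m = r. Const (1 / nrm w0 m) * Poly_Mapping.single m 1)"
    by (simp add: qs_def Const_times_single)
  then show ?thesis by (simp add: star_sum_left star_scale_left)
qed

text \<open>The coefficients of \<open>qs r\<close> are the inverse norms, so pairing with it
  evaluates the component of weight \<open>r\<close> at p_n = 1.\<close>

lemma form_qs: "form w0 (qs r) g = (\<Sum>m | wt m = r. lookup g m)"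
  by (simp add: qs_def form_sum_left form_single_left nrm_nonzero w0_nonzero)

text \<open>The value of q_r at p_n = 1, that is, at a single variable equal to 1.\<close>

definition theta :: "nat \<Rightarrow> F" where
  "theta r = (\<Sum>m | wt m = r. 1 / nrm w0 m)"

lemma theta_0 [simp]: "theta 0 = 1"
  by (simp add: theta_def)

lemma nrm_Suc:
  "nrm w (Poly_Mapping.single i 1 + m) = of_nat (Suc (lookup m i)) * w i * nrm w m"
proof -
  let ?A = "insert i (keys m)"
  have "nrm w (Poly_Mapping.single i 1 + m) = (\<Prod>j\<in>?A. fact (lookup (Poly_Mapping.single i 1 + m) j) * w j ^ lookup (Poly_Mapping.single i 1 + m) j)"
    by (rule nrm_superset) (auto simp: in_keys_iff lookup_add lookup_single when_def split: if_splits)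
  also have "\<dots> = (fact (Suc (lookup m i)) * w i ^ Suc (lookup m i)) * (\<Prod>j\<in>?A - {i}. fact (lookup m j) * w j ^ lookup m j)"
    by (subst prod.remove[of _ i]) (auto simp: lookup_add lookup_single when_def intro!: arg_cong2[of _ _ _ _ "(*)"] prod.cong)
  also have "\<dots> = of_nat (Suc (lookup m i)) * w i * ((fact (lookup m i) * w i ^ lookup m i) * (\<Prod>j\<in>?A - {i}. fact (lookup m j) * w j ^ lookup m j))"
    by (simp add: algebra_simps)
  also have "(fact (lookup m i) * w i ^ lookup m i) * (\<Prod>j\<in>?A - {i}. fact (lookup m j) * w j ^ lookup m j) = nrm w m"
    by (subst nrm_superset[of ?A], simp, blast, subst (2) prod.remove[of _ i]) simp_all
  finally show ?thesis .
qed

text \<open>The logarithmic derivative of the exponential series, in coefficients: each monomial is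
  counted with its weight, and taking off one factor \<open>X i\<close> changes the norm as in
  \<open>nrm_Suc\<close>.\<close>

lemma theta_rec: "of_nat r * theta r = (\<Sum>i<r. (1 - t_par ^ Suc i) * theta (r - Suc i))"
proof -
  have wt_eq: "wt m = (\<Sum>i<r. Suc i * lookup m i)" if "wt m = r" for m
  proof (rule wt_superset)
    show "keys m \<subseteq> {..<r}"
    proof
      fix i assume "i \<in> keys m"
      then have "1 \<le> lookup m i" by (simp add: in_keys_iff)
      then have "Suc i * 1 \<le> Suc i * lookup m i" by (rule mult_le_mono2)
      also have "\<dots> \<le> r" using lookup_le_wt[of i m] that by simp
      finally show "i \<in> {..<r}" by simp
    qed
  qed simp
  have inner: "(\<Sum>m | wt m = r. of_nat (Suc i) * of_nat (lookup m i) / nrm w0 m) = (1 - t_par ^ Suc i) * theta (r - Suc i)"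
    if "i < r" for i
  proof -
    let ?e = "Poly_Mapping.single i (1::nat)"
    have "(\<Sum>m | wt m = r. of_nat (Suc i) * of_nat (lookup m i) / nrm w0 m) =
          (\<Sum>m | wt m = r \<and> lookup m i \<noteq> 0. of_nat (Suc i) * of_nat (lookup m i) / nrm w0 m)"
      by (rule sum.mono_neutral_right) auto
    also have "\<dots> = (\<Sum>m | wt m = r - Suc i. (1 - t_par ^ Suc i) / nrm w0 m)"
    proof (rule sum.reindex_bij_witness[of _ "\<lambda>m. ?e + m" "\<lambda>m. m - ?e"])
      fix m assume m: "m \<in> {m. wt m = r \<and> lookup m i \<noteq> 0}"
      then have "dvm ?e m" by (auto simp: dvm_def lookup_single when_def)
      then show eq: "?e + (m - ?e) = m" by (rule dvm_diff)
      show "m - ?e \<in> {m. wt m = r - Suc i}"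
        using m arg_cong[OF eq, of wt] by (simp add: wt_add)
      have "nrm w0 m = of_nat (Suc (lookup (m - ?e) i)) * w0 i * nrm w0 (m - ?e)"
        using nrm_Suc[of w0 i "m - ?e"] eq by simp
      moreover have "Suc (lookup (m - ?e) i) = lookup m i"
        using m by (simp add: lookup_minus)
      ultimately have "nrm w0 m = of_nat (lookup m i) * w0 i * nrm w0 (m - ?e)" by (simp only:)
      moreover have "T / N = S * L / (L * (S / T) * N)" if "L \<noteq> 0" "S \<noteq> 0" "T \<noteq> 0" "N \<noteq> 0" for L S T N :: F
        using that by (simp add: field_simps)
      ultimately show "(1 - t_par ^ Suc i) / nrm w0 (m - ?e) = of_nat (Suc i) * of_nat (lookup m i) / nrm w0 m"
        using m t_par_power[of "Suc i"] nrm_nonzero[of w0 "m - ?e", OF w0_nonzero]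
        by (simp add: w0_def del: power_Suc of_nat_Suc)
    next
      fix m assume "m \<in> {m. wt m = r - Suc i}"
      with that show "?e + m - ?e = m" "?e + m \<in> {m. wt m = r \<and> lookup m i \<noteq> 0}"
        by (simp_all add: wt_add lookup_add)
    qed
    finally show ?thesis by (simp add: theta_def sum_distrib_left)
  qed
  have "of_nat r * theta r = (\<Sum>m | wt m = r. of_nat (wt m) / nrm w0 m)"
    by (simp add: theta_def sum_distrib_left)
  also have "\<dots> = (\<Sum>m | wt m = r. \<Sum>i<r. of_nat (Suc i) * of_nat (lookup m i) / nrm w0 m)"
  proof (rule sum.cong[OF refl])
    fix m assume "m \<in> {m. wt m = r}"
    then have "wt m = (\<Sum>i<r. Suc i * lookup m i)" by (intro wt_eq) simp
    then show "of_nat (wt m) / nrm w0 m = (\<Sum>i<r. of_nat (Suc i) * of_nat (lookup m i) / nrm w0 m)"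
      by (simp only: of_nat_sum of_nat_mult sum_divide_distrib)
  qed
  also have "\<dots> = (\<Sum>i<r. (1 - t_par ^ Suc i) * theta (r - Suc i))"
    by (subst sum.swap) (intro sum.cong refl, simp only: inner lessThan_iff)
  finally show ?thesis .
qed

text \<open>The generating function of \<open>theta\<close> is (1 - t z)/(1 - z). The recursion
  determines its coefficients, and a geometric sum closes the induction.\<close>

lemma theta_Suc: "theta (Suc r) = 1 - t_par"
proof (induction r rule: less_induct)
  case (less r)
  have "of_nat (Suc r) * theta (Suc r) = (\<Sum>i<Suc r. (1 - t_par ^ Suc i) * theta (r - i))"
    using theta_rec[of "Suc r"] by simp
  also have "\<dots> = (\<Sum>i<r. (1 - t_par ^ Suc i) * (1 - t_par)) + (1 - t_par ^ Suc r)"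
  proof -
    have "theta (r - i) = 1 - t_par" if "i < r" for i
      using less[of "r - i - 1"] that by (simp add: Suc_diff_Suc)
    then show ?thesis by simp
  qed
  also have "\<dots> = (\<Sum>i<r. 1 - t_par ^ Suc i) * (1 - t_par) + (1 - t_par) * (\<Sum>i<Suc r. t_par ^ i)"
    by (simp only: one_diff_power_eq sum_distrib_right)
  also have "\<dots> = (1 - t_par) * ((\<Sum>i<r. 1 - t_par ^ Suc i) + (\<Sum>i<r. t_par ^ Suc i) + 1)"
    by (subst sum.lessThan_Suc_shift) (simp add: algebra_simps)
  also have "\<dots> = (1 - t_par) * of_nat (Suc r)"
    by (simp flip: sum.distrib)
  finally have "of_nat (Suc r) * (theta (Suc r) - (1 - t_par)) = 0" by (simp add: algebra_simps)
  then show ?case using of_nat_neq_0[of r, where 'a = F] by (simp del: of_nat_Suc)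
qed

text \<open>Both sides pair with \<open>g\<close> to the value at \<open>p\<^sub>n = 1\<close> of a homogeneous component of \<open>q\<^sub>j g\<close>.\<close>

lemma star_qs_qs: "j \<le> r \<Longrightarrow> star w0 (qs j) (qs r) = Const (theta j) * qs (r - j)"
proof (rule form_nondegenerate[of w0, OF w0_nonzero])
  fix g assume "j \<le> r"
  have "form w0 (qs j * g) (qs r) = form w0 g (Const (theta j) * qs (r - j))"
  proof (induction g rule: mpoly_linear_induct)
    case (single m c)
    have "form w0 (qs j * Poly_Mapping.single m c) (qs r)
        = (\<Sum>k | wt k = j. form w0 (Poly_Mapping.single (k + m) (c / nrm w0 k)) (qs r))"
      by (simp add: qs_def[of j] sum_distrib_right mult_single form_sum_left)
    also have "\<dots> = (\<Sum>k | wt k = j. if wt m = r - j then c / nrm w0 k else 0)"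
    proof (rule sum.cong[OF refl])
      fix k assume "k \<in> {k. wt k = j}"
      then show "form w0 (Poly_Mapping.single (k + m) (c / nrm w0 k)) (qs r) = (if wt m = r - j then c / nrm w0 k else 0)"
        using \<open>j \<le> r\<close> by (subst form_sym) (auto simp: form_qs lookup_single when_def wt_add)
    qed
    also have "\<dots> = theta j * (if wt m = r - j then c else 0)"
      by (simp add: theta_def sum_distrib_right)
    also have "\<dots> = form w0 (Poly_Mapping.single m c) (Const (theta j) * qs (r - j))"
      by (subst form_sym) (auto simp: form_scale_left form_qs lookup_single when_def)
    finally show ?case .
  qed (simp_all add: distrib_left form_add_left)
  then show "form w0 g (star w0 (qs j) (qs r)) = form w0 g (Const (theta j) * qs (r - j))"
    by (simp add: form_star w0_nonzero)
qed

lemma (in hom_of_rings) ev_cong: "(\<And>i. a i = b i) \<Longrightarrow> ev a f = ev b f"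
  by (metis ext)

section \<open>Evaluation at the power sums of finitely many points\<close>

context hom_of_rings
begin

definition psums :: "(nat \<Rightarrow> 'b) \<Rightarrow> nat set \<Rightarrow> nat \<Rightarrow> 'b" where
  "psums a I i = (\<Sum>j\<in>I. a j ^ Suc i)"

lemma psums_empty [simp]: "psums a {} = (\<lambda>i. 0)"
  by (simp add: psums_def fun_eq_iff)

lemma psums_insert: "finite I \<Longrightarrow> j \<notin> I \<Longrightarrow> psums a (insert j I) i = psums a I i + a j ^ Suc i"
  by (simp add: psums_def)

lemma ev_psums_empty_homog:
  assumes "homog d f" "d > 0" shows "ev (psums a {}) f = 0"
  using ev_homog[OF assms(1), of 0 "\<lambda>i. 0"] assms(2) by (simp add: zero_power)

end

locale F_hom = hom_of_rings \<iota> for \<iota> :: "F \<Rightarrow> 'b::comm_ring_1"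
begin

sublocale hom_of_field \<iota> ..

text \<open>For b_n = z^n the value of a monomial depends on its weight only, so the terms of
  Taylor's formula collect into the one-row functions.\<close>

lemma taylor_qs:
  assumes "bounded_wt d f" "\<And>i. c i \<noteq> 0"
  shows "ev (\<lambda>i. a i + \<iota> (c i) * z ^ Suc i) f = (\<Sum>r\<le>d. z ^ r * ev a (star (\<lambda>i. c i * w0 i) (qs r) f))"
proof -
  have pz: "pwr (\<lambda>i. z ^ Suc i) m = z ^ wt m" for m
    by (simp add: pwr_def wt_def power_sum flip: power_mult power_Suc)
  have "ev (\<lambda>i. a i + \<iota> (c i) * z ^ Suc i) f =
     (\<Sum>m\<in>exps d. \<iota> (1 / nrm w0 m) * pwr (\<lambda>i. z ^ Suc i) m * ev a (star (\<lambda>i. c i * w0 i) (Poly_Mapping.single m 1) f))"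
    by (rule taylor) (use assms w0_nonzero in auto)
  also have "\<dots> = (\<Sum>m\<in>exps d. \<iota> (1 / nrm w0 m) * z ^ wt m * ev a (star (\<lambda>i. c i * w0 i) (Poly_Mapping.single m 1) f))"
    by (simp only: pz)
  also have "\<dots> = (\<Sum>r\<le>d. \<Sum>m | m \<in> exps d \<and> wt m = r. \<iota> (1 / nrm w0 m) * z ^ wt m * ev a (star (\<lambda>i. c i * w0 i) (Poly_Mapping.single m 1) f))"
    by (rule sum.group[symmetric]) (simp, simp, simp add: exps_def image_subset_iff)
  also have "\<dots> = (\<Sum>r\<le>d. z ^ r * ev a (star (\<lambda>i. c i * w0 i) (qs r) f))"
  proof (rule sum.cong[OF refl])
    fix r assume "r \<in> {..d}"
    then have "{m. m \<in> exps d \<and> wt m = r} = {m. wt m = r}" by (auto simp: exps_def)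
    then show "(\<Sum>m | m \<in> exps d \<and> wt m = r. \<iota> (1 / nrm w0 m) * z ^ wt m * ev a (star (\<lambda>i. c i * w0 i) (Poly_Mapping.single m 1) f))
        = z ^ r * ev a (star (\<lambda>i. c i * w0 i) (qs r) f)"
      by (simp add: star_qs ev_sum ev_mult sum_distrib_left mult_ac)
  qed
  finally show ?thesis .
qed

lemma ev_add_point:
  assumes "bounded_wt d f" "finite I" "j \<notin> I"
  shows "ev (psums a (insert j I)) f = (\<Sum>r\<le>d. a j ^ r * ev (psums a I) (star w0 (qs r) f))"
proof -
  have "ev (psums a (insert j I)) f = ev (\<lambda>i. psums a I i + \<iota> 1 * a j ^ Suc i) f"
    by (rule ev_cong) (simp add: psums_insert assms(2,3))
  then show ?thesis
    using taylor_qs[OF assms(1), of "\<lambda>i. 1" "psums a I" "a j"] by simp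
qed

text \<open>Removing a point is adding it with sign -1 in all power sums: the constants
  \<open>c\<close> are -1, and the adjoint is taken for the weights \<open>- w0\<close>.\<close>

lemma ev_remove_point:
  assumes "bounded_wt d f" "finite I" "j \<in> I"
  shows "ev (psums a (I - {j})) f = (\<Sum>r\<le>d. a j ^ r * ev (psums a I) (star (\<lambda>i. - w0 i) (qs r) f))"
proof -
  have "psums a (I - {j}) i = psums a I i + \<iota> (- 1) * a j ^ Suc i" for i
    using psums_insert[of "I - {j}" j a i] assms(2,3) by (simp add: insert_absorb hom_uminus)
  then have "ev (psums a (I - {j})) f = ev (\<lambda>i. psums a I i + \<iota> (- 1) * a j ^ Suc i) f"
    by (rule ev_cong)
  then show ?thesis
    using taylor_qs[OF assms(1), of "\<lambda>i. - 1" "psums a I" "a j"] by simp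
qed

text \<open>A new point x multiplies the generating function of the q_r by (1 - t x z)/(1 - x z);
  this is the coefficient form after clearing the denominator. In the proof only k = 0 survives
  because \<open>theta\<close> is constant from index 1 on.\<close>

lemma ev_qs_insert:
  assumes "finite I" "j \<notin> I"
  shows "ev (psums a (insert j I)) (qs (Suc r)) - a j * ev (psums a (insert j I)) (qs r) =
    ev (psums a I) (qs (Suc r)) - \<iota> t_par * a j * ev (psums a I) (qs r)"
proof -
  let ?h = "\<lambda>r. ev (psums a I) (qs r)"
  have h: "ev (psums a (insert j I)) (qs r) = (\<Sum>k\<le>r. a j ^ k * (\<iota> (theta k) * ?h (r - k)))" for r
    unfolding ev_add_point[OF homog_imp_bounded[OF homog_qs] assms]
    by (intro sum.cong refl) (simp add: star_qs_qs ev_mult)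
  have "(\<Sum>k\<le>Suc r. a j ^ k * (\<iota> (theta k) * ?h (Suc r - k))) =
      ?h (Suc r) + (\<Sum>k\<le>r. a j ^ Suc k * (\<iota> (theta (Suc k)) * ?h (r - k)))"
    by (subst sum.atMost_Suc_shift) simp
  then have "ev (psums a (insert j I)) (qs (Suc r)) - a j * ev (psums a (insert j I)) (qs r)
     = ?h (Suc r) + (\<Sum>k\<le>r. a j ^ Suc k * (\<iota> (theta (Suc k) - theta k) * ?h (r - k)))"
    unfolding h by (simp add: sum_distrib_left hom_diff algebra_simps sum_subtractf)
  also have "(\<Sum>k\<le>r. a j ^ Suc k * (\<iota> (theta (Suc k) - theta k) * ?h (r - k))) =
      (\<Sum>k\<in>{0}. a j ^ Suc k * (\<iota> (theta (Suc k) - theta k) * ?h (r - k)))"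
  proof (rule sum.mono_neutral_right)
    show "\<forall>k\<in>{..r} - {0}. a j ^ Suc k * (\<iota> (theta (Suc k) - theta k) * ?h (r - k)) = 0"
    proof
      fix k assume "k \<in> {..r} - {0}"
      then obtain l where "k = Suc l" by (cases k) auto
      then show "a j ^ Suc k * (\<iota> (theta (Suc k) - theta k) * ?h (r - k)) = 0"
        by (simp add: theta_Suc)
    qed
  qed auto
  also have "\<dots> = - \<iota> t_par * a j * ?h r"
    by (simp add: theta_Suc hom_uminus)
  finally show ?thesis by simp
qed

end

section \<open>Branching\<close>

locale F_field_hom = F_hom \<iota> for \<iota> :: "F \<Rightarrow> 'b::field"
begin

abbreviation tt :: 'b where "tt \<equiv> \<iota> t_par"

definition cross :: "(nat \<Rightarrow> 'b) \<Rightarrow> nat set \<Rightarrow> nat set \<Rightarrow> 'b" where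
  "cross a I J = (\<Prod>i\<in>I. \<Prod>j\<in>J. (a i - tt * a j) / (a i - a j))"

text \<open>Lagrange interpolation. The product of the z - t a_j minus the product of the z - a_j
  has degree below \<open>card I\<close>, since the leading terms cancel; hence it equals its
  interpolation polynomial at the a_i. Comparing the values at z = 0 gives the claim.\<close>

lemma lagrange_sum:
  assumes "finite I" "inj_on a I" "\<And>i. i \<in> I \<Longrightarrow> a i \<noteq> 0"
  shows "(1 - tt) * (\<Sum>i\<in>I. cross a {i} (I - {i})) = 1 - tt ^ card I"
proof -
  define L where "L j = [:- a j, 1:]" for j
  \<comment> \<open>The interpolation coefficient at \<open>a i\<close>: the factor
    \<open>(1 - tt) * a i\<close> is the term j = i of the product of the a_i - t a_j, the other
    terms form the cross factor.\<close>
  define c where "c i = (1 - tt) * a i * cross a {i} (I - {i})" for i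
  define P where "P = (\<Prod>j\<in>I. [:- tt * a j, 1:]) - (\<Prod>j\<in>I. L j)"
  define Q where "Q = (\<Sum>i\<in>I. smult (c i) (\<Prod>j\<in>I - {i}. L j))"
  have lin: "degree (\<Prod>j\<in>J. [:f j, 1:]) = card J \<and> lead_coeff (\<Prod>j\<in>J. [:f j, 1:]) = 1"
    if "finite J" for J and f :: "nat \<Rightarrow> 'b"
  proof
    show "degree (\<Prod>j\<in>J. [:f j, 1:]) = card J" by (simp add: degree_prod_sum_eq)
    show "lead_coeff (\<Prod>j\<in>J. [:f j, 1:]) = 1" unfolding lead_coeff_prod by simp
  qed
  have pval: "poly P (a i) = c i * (\<Prod>j\<in>I - {i}. a i - a j)" if "i \<in> I" for i
  proof -
    have nz: "(\<Prod>j\<in>I - {i}. a i - a j) \<noteq> 0"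
      using assms that by (auto simp: inj_on_def)
    have "poly P (a i) = (\<Prod>j\<in>I. a i - tt * a j)"
      using assms(1) that by (auto simp: P_def L_def poly_prod)
    also have "\<dots> = (a i - tt * a i) * (\<Prod>j\<in>I - {i}. a i - tt * a j)"
      using assms(1) that by (rule prod.remove)
    also have "\<dots> = c i * (\<Prod>j\<in>I - {i}. a i - a j)"
    proof -
      have "a i - tt * a i = (1 - tt) * a i" by (simp add: left_diff_distrib)
      then show ?thesis using nz by (simp add: c_def cross_def prod_dividef)
    qed
    finally show ?thesis .
  qed
  have qval: "poly Q (a i) = c i * (\<Prod>j\<in>I - {i}. a i - a j)" if "i \<in> I" for i
  proof -
    have "poly Q (a i) = (\<Sum>k\<in>I. c k * (\<Prod>j\<in>I - {k}. a i - a j))"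
      by (simp add: Q_def L_def poly_sum poly_prod)
    also have "\<dots> = (\<Sum>k\<in>{i}. c k * (\<Prod>j\<in>I - {k}. a i - a j))"
    proof (rule sum.mono_neutral_right)
      show "\<forall>k\<in>I - {i}. c k * (\<Prod>j\<in>I - {k}. a i - a j) = 0"
        using assms(1) that by (auto intro!: prod_zero)
    qed (use assms(1) that in auto)
    finally show ?thesis by simp
  qed
  have "P = Q"
  proof (cases "I = {}")
    case True
    then show ?thesis by (simp add: P_def Q_def)
  next
    case False
    then have pos: "card I > 0" using assms(1) by (simp add: card_gt_0_iff)
    have card: "card (a ` I) = card I" using assms(2) by (rule card_image)
    show ?thesis
    proof (rule poly_eqI_degree)
      show "degree P < card (a ` I)" unfolding card
      proof (rule degree_lessI)
        show "\<forall>k\<ge>card I. coeff P k = 0"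
        proof safe
          fix k assume k: "card I \<le> k"
          show "coeff P k = 0"
          proof (cases "k = card I")
            case True
            have "coeff (\<Prod>j\<in>I. [:f j, 1:]) k = 1" for f :: "nat \<Rightarrow> 'b"
              unfolding True by (metis lin[OF assms(1)])
            then show ?thesis by (simp only: P_def L_def coeff_diff) simp
          next
            case False
            then show ?thesis using k lin[OF assms(1), of "\<lambda>j. - tt * a j"] lin[OF assms(1), of "\<lambda>j. - a j"]
              by (simp add: P_def L_def coeff_eq_0)
          qed
        qed
      qed (use pos in simp)
      show "degree Q < card (a ` I)" unfolding card Q_def
      proof (rule degree_sum_less)
        fix i assume i: "i \<in> I"
        have "degree (\<Prod>j\<in>I - {i}. L j) = card I - 1"
          using lin[of "I - {i}" "\<lambda>j. - a j"] assms(1) i by (simp add: L_def)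
        then show "degree (smult (c i) (\<Prod>j\<in>I - {i}. L j)) < card I"
          using pos by (simp add: order.strict_trans1[OF degree_smult_le])
      qed (use pos in simp)
    qed (use pval qval in auto)
  qed
  then have "poly P 0 = poly Q 0" by simp
  moreover have "poly P 0 = (tt ^ card I - 1) * (\<Prod>j\<in>I. - a j)"
    by (simp add: P_def L_def poly_prod prod.distrib algebra_simps flip: minus_mult_right)
       (simp add: prod.distrib flip: mult_minus_right)
  moreover have "poly Q 0 = - ((1 - tt) * (\<Sum>i\<in>I. cross a {i} (I - {i}))) * (\<Prod>j\<in>I. - a j)"
  proof -
    have "c i * (\<Prod>j\<in>I - {i}. - a j) = - ((1 - tt) * cross a {i} (I - {i})) * (\<Prod>j\<in>I. - a j)" if "i \<in> I" for i
      using assms(1) that by (subst prod.remove[of I i]) (simp_all add: c_def)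
    then have "poly Q 0 = (\<Sum>i\<in>I. - ((1 - tt) * cross a {i} (I - {i})) * (\<Prod>j\<in>I. - a j))"
      by (simp add: Q_def L_def poly_sum poly_prod)
    then show ?thesis
      by (simp only: sum_distrib_right[symmetric] sum_distrib_left sum_negf)
  qed
  moreover have "(\<Prod>j\<in>I. - a j) \<noteq> 0" using assms(1,3) by simp
  ultimately have "tt ^ card I - 1 = - ((1 - tt) * (\<Sum>i\<in>I. cross a {i} (I - {i})))"
    by (metis mult_cancel_right)
  then show ?thesis by (simp add: algebra_simps)
qed

lemma cross_insert:
  assumes "finite I" "j \<notin> I" "i \<in> I"
  shows "cross a {i} (insert j I - {i}) = (a i - tt * a j) / (a i - a j) * cross a {i} (I - {i})"
proof -
  have "insert j I - {i} = insert j (I - {i})" using assms by auto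
  then show ?thesis using assms by (simp add: cross_def)
qed

text \<open>Both sides satisfy the recursion of \<open>ev_qs_insert\<close>.\<close>

lemma ev_qs:
  assumes "finite I" "inj_on a I" "\<And>i. i \<in> I \<Longrightarrow> a i \<noteq> 0"
  shows "ev (psums a I) (qs (Suc r)) = (1 - tt) * (\<Sum>i\<in>I. a i ^ Suc r * cross a {i} (I - {i}))"
  using assms
proof (induction I arbitrary: r rule: finite_induct)
  case empty
  then show ?case by (simp only: ev_psums_empty_homog[OF homog_qs]) simp
next
  case (insert j I)
  define s where "s I r = (1 - tt) * (\<Sum>i\<in>I. a i ^ r * cross a {i} (I - {i}))" for I r
  have IH: "ev (psums a I) (qs (Suc r)) = s I (Suc r)" for r
    unfolding s_def using insert.prems by (intro insert.IH) auto
  have s0: "s I 0 = 1 - tt ^ card I" "s (insert j I) 0 = 1 - tt ^ Suc (card I)"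
    using lagrange_sum[of I a] lagrange_sum[of "insert j I" a] insert
    by (simp_all add: s_def)
  have s_rec: "s (insert j I) (Suc r) - a j * s (insert j I) r = s I (Suc r) - tt * a j * s I r" for r
  proof -
    have "(a i ^ Suc r - a j * a i ^ r) * cross a {i} (insert j I - {i}) =
        (a i ^ Suc r - tt * a j * a i ^ r) * cross a {i} (I - {i})" if "i \<in> I" for i
    proof -
      have "a i - a j \<noteq> 0" using insert.prems(1) insert.hyps that by (auto simp: inj_on_def)
      then have "(a i - a j) * cross a {i} (insert j I - {i}) = (a i - tt * a j) * cross a {i} (I - {i})"
        using cross_insert[OF insert.hyps(1,2) that, of a] by simp
      then have "a i ^ r * ((a i - a j) * cross a {i} (insert j I - {i})) = a i ^ r * ((a i - tt * a j) * cross a {i} (I - {i}))"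
        by (simp only:)
      then show ?thesis by (simp add: algebra_simps)
    qed
    then have "(\<Sum>i\<in>I. (a i ^ Suc r - a j * a i ^ r) * cross a {i} (insert j I - {i})) =
        (\<Sum>i\<in>I. (a i ^ Suc r - tt * a j * a i ^ r) * cross a {i} (I - {i}))"
      by simp
    moreover have "s (insert j I) (Suc r) - a j * s (insert j I) r =
        (1 - tt) * (\<Sum>i\<in>I. (a i ^ Suc r - a j * a i ^ r) * cross a {i} (insert j I - {i}))"
      using insert.hyps
      by (simp add: s_def left_diff_distrib sum_subtractf right_diff_distrib sum_distrib_left distrib_left mult_ac)
    moreover have "s I (Suc r) - tt * a j * s I r =
        (1 - tt) * (\<Sum>i\<in>I. (a i ^ Suc r - tt * a j * a i ^ r) * cross a {i} (I - {i}))"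
      by (simp add: s_def left_diff_distrib sum_subtractf right_diff_distrib sum_distrib_left mult_ac)
    ultimately show ?thesis by simp
  qed
  note rec = ev_qs_insert[OF insert.hyps(1,2), of a]
  have "ev (psums a (insert j I)) (qs (Suc r)) = s (insert j I) (Suc r)"
  proof (induction r)
    \<comment> \<open>The formula fails for q_0 = 1, as \<open>s I 0\<close> is 1 - t^(card I). The
      defects t^(card I + 1) for the larger set and t^(card I) for \<open>I\<close> enter the
      recursion with coefficients differing by t, so they cancel.\<close>
    case 0
    have "tt * a j + ev (psums a (insert j I)) (qs (Suc 0)) = tt * a j + s (insert j I) (Suc 0)"
      using rec[of 0] s_rec[of 0] s0 IH[of 0] by (simp add: algebra_simps)
    then show ?case by (simp only: add_left_cancel)
  next
    case (Suc r)
    have "ev (psums a (insert j I)) (qs (Suc (Suc r))) - a j * s (insert j I) (Suc r) =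
        s (insert j I) (Suc (Suc r)) - a j * s (insert j I) (Suc r)"
      using rec[of "Suc r"] unfolding s_rec IH Suc .
    then show ?case by simp
  qed
  then show ?case by (simp add: s_def)
qed

end

section \<open>Hall-Littlewood functions\<close>

text \<open>The function \<open>Q\<^sub>\<mu>\<close> as a polynomial in the power sums, by Jing's vertex operators.\<close>

fun HLM :: "nat list \<Rightarrow> F mpoly" where
  "HLM [] = 1"
| "HLM (r # \<mu>) = (\<Sum>m\<le>sum_list \<mu>. qs (r + m) * star (\<lambda>i. - w0 i) (qs m) (HLM \<mu>))"

lemma homog_HLM: "homog (sum_list \<mu>) (HLM \<mu>)"
proof (induction \<mu>)
  case Nil
  then show ?case using homog_Const[of "1::F"] by simp
next
  case (Cons r \<mu>)
  show ?case unfolding HLM.simps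
  proof (intro homog_sum)
    fix m assume "m \<in> {..sum_list \<mu>}"
    then have "sum_list (r # \<mu>) = (r + m) + (sum_list \<mu> - m)" by simp
    then show "homog (sum_list (r # \<mu>)) (qs (r + m) * star (\<lambda>i. - w0 i) (qs m) (HLM \<mu>))"
      by (simp only:) (intro homog_mult star_homog homog_qs Cons.IH)
  qed
qed

text \<open>The branching rule, and the reason for the shape of the vertex operator. By
  \<open>ev_qs\<close> the factor q_(r+m) contributes a_i^(r+m), and the sum over m of a_i^m times
  the adjoint of q_m for \<open>- w0\<close> removes the point a_i. Since r is positive, every index
  r + m is in the range of \<open>ev_qs\<close>.\<close>

lemma (in F_field_hom) ev_HLM:
  assumes "finite I" "inj_on a I" "\<And>i. i \<in> I \<Longrightarrow> a i \<noteq> 0" "r \<ge> 1"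
  shows "ev (psums a I) (HLM (r # \<mu>)) =
    (1 - tt) * (\<Sum>i\<in>I. a i ^ r * cross a {i} (I - {i}) * ev (psums a (I - {i})) (HLM \<mu>))"
proof -
  obtain r' where r: "r = Suc r'" using assms(4) by (cases r) auto
  have "ev (psums a I) (HLM (r # \<mu>)) = (\<Sum>m\<le>sum_list \<mu>.
      ((1 - tt) * (\<Sum>i\<in>I. a i ^ (r + m) * cross a {i} (I - {i}))) * ev (psums a I) (star (\<lambda>i. - w0 i) (qs m) (HLM \<mu>)))"
    using ev_qs[OF assms(1-3)] by (simp add: ev_sum ev_mult r)
  also have "\<dots> = (1 - tt) * (\<Sum>i\<in>I. a i ^ r * cross a {i} (I - {i}) *
      (\<Sum>m\<le>sum_list \<mu>. a i ^ m * ev (psums a I) (star (\<lambda>i. - w0 i) (qs m) (HLM \<mu>))))"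
    unfolding sum_distrib_left sum_distrib_right
    by (subst sum.swap) (simp add: power_add mult_ac)
  also have "\<dots> = (1 - tt) * (\<Sum>i\<in>I. a i ^ r * cross a {i} (I - {i}) * ev (psums a (I - {i})) (HLM \<mu>))"
    using ev_remove_point[OF homog_imp_bounded[OF homog_HLM] assms(1)] by simp
  finally show ?thesis .
qed

section \<open>Symmetric functions as polynomials in the power sums\<close>

lemma proj_add: "proj N (f + g) = proj N f + proj N g"
  and proj_mult: "proj N (f * g) = proj N f * proj N g"
  and proj_0 [simp]: "proj N 0 = 0"
  and proj_1 [simp]: "proj N 1 = 1"
  and proj_scale: "proj N (c \<cdot> f) = Const c * proj N f"
  by (simp_all add: proj_def plus_symf.rep_eq times_symf.rep_eq zero_symf.rep_eq
      one_symf.rep_eq scale.rep_eq)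

lemma hom_proj: "hom_of_rings (proj N)"
  by unfold_locales (simp_all add: proj_add proj_mult)

lemma proj_diff: "proj N (f - g) = proj N f - proj N g"
  by (rule hom_of_rings.hom_diff[OF hom_proj])

lemma proj_sum: "proj N (sum f A) = (\<Sum>i\<in>A. proj N (f i))"
  by (rule hom_of_rings.hom_sum[OF hom_proj])

lemma hom_scale_1: "hom_of_rings (\<lambda>c. c \<cdot> (1 :: 'a::comm_ring_1 symf))"
  by unfold_locales
     (rule symf_eqI[of 0]; simp add: proj_add proj_mult proj_scale Const_add Const_mult distrib_right)+

lemma scale_eq_mult: "c \<cdot> f = (c \<cdot> 1) * f"
  by (rule symf_eqI[of 0]) (simp add: proj_scale proj_mult)

lemma proj_symf: "proj N f \<in> sym_polys N" "restr (Suc N) (proj (Suc N) f) = proj N f"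
  using proj_fun[of f] by (simp_all add: proj_def)

lemma symf_ex:
  assumes "\<And>N. h N \<in> sym_polys N" "\<And>N. restr (Suc N) (h (Suc N)) = h N" "\<And>N. deg_le d (h N)"
  shows "proj N (symf_lim 0 h) = h N"
proof -
  have "h \<in> {f. (\<forall>N. f N \<in> sym_polys N) \<and> (\<forall>N. restr (Suc N) (f (Suc N)) = f N) \<and> (\<exists>d. \<forall>N. deg_le d (f N))}"
    using assms by blast
  then have h: "proj N (Abs_symf h) = h N" for N
    unfolding proj_def by (simp add: Abs_symf_inverse)
  have "symf_lim 0 h = Abs_symf h" by (rule symf_limI) (rule h)
  then show ?thesis by (simp add: h)
qed

lemma X_power: "X i ^ n = (Poly_Mapping.single (Poly_Mapping.single i n) 1 :: 'a::comm_semiring_1 mpoly)"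
  using pwr_X[of "Poly_Mapping.single i n"] by simp

lemma proj_power_sum:
  assumes "n \<ge> 1"
  shows "proj N (power_sum n) = (\<Sum>i=1..N. X i ^ n)"
  unfolding power_sum_def
proof (rule symf_ex)
  fix N
  have k: "\<exists>i\<in>{1..N}. m = Poly_Mapping.single i n" if "m \<in> keys (\<Sum>i=1..N. X i ^ n :: F mpoly)" for m
    using that keys_sum[of "\<lambda>i. X i ^ n :: F mpoly" "{1..N}"] by (auto simp: X_power)
  show "(\<Sum>i=1..N. X i ^ n :: F mpoly) \<in> sym_polys N"
    unfolding sym_polys_def
  proof (safe)
    fix m x assume "m \<in> keys (\<Sum>i=1..N. X i ^ n :: F mpoly)" "x \<in> keys m"
    then show "x \<in> {1..N}" using k by (force split: if_splits)
  next
    fix w assume w: "w permutes {1..N}"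
    have "subst (\<lambda>i. X (w i)) (\<Sum>i=1..N. X i ^ n :: F mpoly) = (\<Sum>i=1..N. X (w i) ^ n)"
      by (simp add: subst_sum hom_of_rings.hom_power[OF hom_subst])
    also have "\<dots> = (\<Sum>i=1..N. X i ^ n)"
      by (rule sum.reindex_bij_betw[OF permutes_imp_bij[OF w]])
    finally show "subst (\<lambda>i. X (w i)) (\<Sum>i=1..N. X i ^ n :: F mpoly) = (\<Sum>i=1..N. X i ^ n)" .
  qed
  show "deg_le n (\<Sum>i=1..N. X i ^ n :: F mpoly)"
    unfolding deg_le_def using k by (force simp: mono_deg_def)
  have "restr (Suc N) (\<Sum>i=1..Suc N. X i ^ n :: F mpoly) = (\<Sum>i=1..Suc N. (if i = Suc N then 0 else X i) ^ n)"
    unfolding restr_def subst_sum hom_of_rings.hom_power[OF hom_subst] subst_X by (rule refl)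
  also have "\<dots> = (\<Sum>i=1..N. X i ^ n)"
    using assms by (simp add: zero_power)
  finally show "restr (Suc N) (\<Sum>i=1..Suc N. X i ^ n :: F mpoly) = (\<Sum>i=1..N. X i ^ n)" .
qed

definition of_psums :: "F mpoly \<Rightarrow> F symf" where
  "of_psums = hom_of_rings.ev (\<lambda>c. c \<cdot> 1) (\<lambda>i. power_sum (Suc i))"

definition psumX :: "nat \<Rightarrow> nat \<Rightarrow> 'a::comm_ring_1 mpoly" where
  "psumX N i = (\<Sum>j=1..N. X j ^ Suc i)"

lemma hom_of_psums: "hom_of_rings of_psums"
  unfolding of_psums_def by (rule hom_of_rings.hom_ev[OF hom_scale_1])

lemma of_psums_Const: "of_psums (Const c) = c \<cdot> 1"
  by (simp add: of_psums_def hom_of_rings.ev_Const[OF hom_scale_1])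

lemma of_psums_scale: "of_psums (Const c * f) = c \<cdot> of_psums f"
  using scale_eq_mult[of c "of_psums f"] by (simp add: hom_of_rings.hom_mult[OF hom_of_psums] of_psums_Const)

lemma proj_of_psums: "proj N (of_psums f) = subst (psumX N) f"
proof -
  have 1: "(\<lambda>c. proj N (c \<cdot> (1 :: F symf))) = Const" by (simp add: proj_scale fun_eq_iff)
  have 2: "(\<lambda>i. proj N (power_sum (Suc i))) = psumX N"
    by (rule ext) (simp only: psumX_def, rule proj_power_sum, simp)
  show ?thesis
    unfolding of_psums_def hom_comp_ev[OF hom_scale_1 hom_proj] 1 2 subst_eq_ev ..
qed

subsection \<open>Partitions and monomials\<close>

definition mono :: "nat multiset \<Rightarrow> (nat \<Rightarrow>\<^sub>0 nat)" where
  "mono M = (\<Sum>n\<in>#M. Poly_Mapping.single (n - 1) 1)"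

lemma mono_empty [simp]: "mono {#} = 0"
  and mono_add_mset: "mono (add_mset n M) = Poly_Mapping.single (n - 1) 1 + mono M"
  by (simp_all add: mono_def)

lemma lookup_mono: "0 \<notin># M \<Longrightarrow> lookup (mono M) i = count M (Suc i)"
  by (induction M) (auto simp: mono_add_mset lookup_add lookup_single when_def)

lemma wt_mono: "0 \<notin># M \<Longrightarrow> wt (mono M) = sum_mset M"
  by (induction M) (auto simp: mono_add_mset wt_add)

lemma pwr_mono: "pwr a (mono M) = (\<Prod>n\<in>#M. a (n - 1))"
  by (induction M) (auto simp: mono_add_mset pwr_add)

lemma mono_inj: "0 \<notin># M \<Longrightarrow> 0 \<notin># M' \<Longrightarrow> mono M = mono M' \<Longrightarrow> M = M'"
  by (rule multiset_eqI) (metis lookup_mono not0_implies_Suc not_in_iff)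

lemma mono_surj: "\<exists>M. 0 \<notin># M \<and> mono M = m"
proof -
  let ?M = "\<Sum>i\<in>keys m. replicate_mset (lookup m i) (Suc i)"
  have c: "count ?M n = (case n of 0 \<Rightarrow> 0 | Suc i \<Rightarrow> lookup m i)" for n
  proof (cases n)
    case (Suc i)
    have "count ?M n = (\<Sum>j\<in>keys m. if j = i then lookup m j else 0)"
      by (auto simp: count_sum Suc intro!: sum.cong)
    then show ?thesis by (simp add: Suc in_keys_iff)
  qed (simp add: count_sum)
  have "0 \<notin># ?M" by (simp add: c flip: count_eq_zero_iff)
  moreover from this have "mono ?M = m"
    by (intro poly_mapping_eqI) (simp add: lookup_mono c)
  ultimately show ?thesis by blast
qed

lemma partition_eqI:
  assumes "is_partition \<mu>" "is_partition \<nu>" "mset \<mu> = mset \<nu>"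
  shows "\<mu> = \<nu>"
proof -
  have "sorted (rev \<mu>)" "sorted (rev \<nu>)"
    using assms by (simp_all add: is_partition_def sorted_wrt_rev)
  then have "rev \<mu> = rev \<nu>"
    using assms(3) by (metis mset_rev sorted_sort_id sorted_list_of_multiset_mset)
  then show ?thesis by simp
qed

lemma partition_ex:
  assumes "0 \<notin># M" shows "\<exists>\<mu>. is_partition \<mu> \<and> mset \<mu> = M"
proof (intro exI conjI)
  show "is_partition (rev (sorted_list_of_multiset M))"
    using assms by (simp add: is_partition_def sorted_wrt_rev)
qed simp

definition pmono :: "nat list \<Rightarrow> (nat \<Rightarrow>\<^sub>0 nat)" where
  "pmono \<mu> = mono (mset \<mu>)"

lemma pmono_bij: "bij_betw pmono {\<mu>. is_partition \<mu>} UNIV"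
  unfolding bij_betw_def inj_on_def
proof (safe)
  fix \<mu> \<nu> assume "is_partition \<mu>" "is_partition \<nu>" "pmono \<mu> = pmono \<nu>"
  then show "\<mu> = \<nu>"
    by (intro partition_eqI mono_inj) (auto simp: pmono_def is_partition_def)
next
  fix m :: "nat \<Rightarrow>\<^sub>0 nat"
  obtain M where "0 \<notin># M" "mono M = m" using mono_surj by blast
  moreover then obtain \<mu> where "is_partition \<mu>" "mset \<mu> = M" using partition_ex by blast
  ultimately show "m \<in> pmono ` Collect is_partition" by (auto simp: pmono_def)
qed simp

lemma wt_pmono: "is_partition \<mu> \<Longrightarrow> wt (pmono \<mu>) = sum_list \<mu>"
  by (simp add: pmono_def wt_mono is_partition_def sum_mset_sum_list)

lemma of_psums_pmono:
  assumes "0 \<notin> set \<mu>" shows "of_psums (Poly_Mapping.single (pmono \<mu>) 1) = power_sum_list \<mu>"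
proof -
  have "of_psums (Poly_Mapping.single (pmono \<mu>) 1) = (\<Prod>n\<in>#mset \<mu>. power_sum (Suc (n - 1)))"
    using scale_eq_mult[of 1 "1 :: F symf"]
    by (simp add: of_psums_def hom_of_rings.ev_single[OF hom_scale_1] hom_of_rings.hom_1[OF hom_scale_1] pmono_def pwr_mono)
  also have "\<dots> = (\<Prod>n\<in>#mset \<mu>. power_sum n)"
    using assms by (intro arg_cong[of _ _ prod_mset] image_mset_cong) (metis Suc_pred' bot_nat_0.not_eq_extremum set_mset_mset diff_Suc_1 not0_implies_Suc)
  also have "\<dots> = power_sum_list \<mu>"
    by (simp add: power_sum_list_def flip: prod_mset_prod_list)
  finally show ?thesis .
qed

subsection \<open>Coefficients of products of power sums\<close>

definition vals :: "(nat \<Rightarrow>\<^sub>0 nat) \<Rightarrow> nat multiset" where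
  "vals m = image_mset (lookup m) (mset_set (keys m))"

lemma size_vals [simp]: "size (vals m) = card (keys m)"
  by (simp add: vals_def)

lemma vals_no_0: "0 \<notin># vals m"
  by (auto simp: vals_def in_keys_iff)

lemma lookup_single_mult:
  "lookup (Poly_Mapping.single e 1 * g) m = (if dvm e m then lookup g (m - e) else 0)"
  for g :: "'a::comm_ring_1 mpoly"
proof (induction g rule: mpoly_linear_induct)
  case (single k c)
  show ?case
    using dvm_diff[of e m] dvm_add[of e k] by (auto simp: mult_single lookup_single when_def simp del: dvm_add)
qed (simp_all add: distrib_left lookup_add)

lemma dvm_single: "dvm (Poly_Mapping.single j n) m \<longleftrightarrow> n \<le> lookup m j"
  by (auto simp: dvm_def lookup_single when_def)

lemma lookup_X_power_mult:
  "lookup (X j ^ n * g) m = (if n \<le> lookup m j then lookup g (m - Poly_Mapping.single j n) else 0)"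
  for g :: "'a::comm_ring_1 mpoly"
  by (simp add: X_power lookup_single_mult dvm_single)

text \<open>When a monomial has at least as many variables as there are factors, each factor must
  supply a variable of its own, so the exponents are exactly the parts. Stating the coefficient as a
  natural number excludes cancellation in the induction.\<close>

lemma coeff_power_sums:
  assumes "0 \<notin> set \<mu>" "keys m \<subseteq> {1..N}" "length \<mu> \<le> card (keys m)"
  shows "\<exists>k. lookup (\<Prod>n\<leftarrow>\<mu>. \<Sum>i=1..N. X i ^ n :: F mpoly) m = of_nat k \<and> (k > 0 \<longleftrightarrow> vals m = mset \<mu>)"
  using assms
proof (induction \<mu> arbitrary: m)
  case Nil
  show ?case
    by (rule exI[of _ "if m = 0 then 1 else 0"])
       (auto simp: lookup_one when_def vals_def mset_set_empty_iff)
next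
  case (Cons n \<mu>)
  let ?g = "\<Prod>n\<leftarrow>\<mu>. \<Sum>i=1..N. X i ^ n :: F mpoly"
  let ?e = "\<lambda>j. Poly_Mapping.single j n"
  have n: "n > 0" using Cons.prems by auto
  have "\<exists>k. (if n \<le> lookup m j then lookup ?g (m - ?e j) else 0) = of_nat k \<and> (k > 0 \<longleftrightarrow> lookup m j = n \<and> vals m = mset (n # \<mu>))" for j
  proof (cases "n \<le> lookup m j")
    case True
    then have j: "j \<in> keys m" using n by (simp add: in_keys_iff)
    have l: "lookup (m - ?e j) i = (if i = j then lookup m j - n else lookup m i)" for i
      by (auto simp: lookup_minus lookup_single when_def)
    show ?thesis
    proof (cases "lookup m j = n")
      case eq: True
      have K: "keys (m - ?e j) = keys m - {j}" by (rule set_eqI) (simp add: in_keys_iff l eq)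
      have "vals (m - ?e j) = image_mset (lookup m) (mset_set (keys m - {j}))"
        unfolding vals_def K by (rule image_mset_cong) (auto simp: l)
      also have "\<dots> = vals m - {#n#}"
        using j eq by (simp add: vals_def mset_set_Diff image_mset_Diff)
      finally have v: "vals (m - ?e j) = vals m - {#n#}" .
      have "n \<in># vals m" using j eq by (auto simp: vals_def)
      then have "vals (m - ?e j) = mset \<mu> \<longleftrightarrow> vals m = mset (n # \<mu>)"
        unfolding v by (metis add_mset_remove_trivial insert_DiffM mset.simps(2))
      moreover have "\<exists>k. lookup ?g (m - ?e j) = of_nat k \<and> (k > 0 \<longleftrightarrow> vals (m - ?e j) = mset \<mu>)"
        using Cons.prems j by (intro Cons.IH) (auto simp: K)
      ultimately show ?thesis using eq by simp
    next
      case neq: False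
      have K: "keys (m - ?e j) = keys m" using j True neq by (auto simp: in_keys_iff l split: if_splits)
      have "\<exists>k. lookup ?g (m - ?e j) = of_nat k \<and> (k > 0 \<longleftrightarrow> vals (m - ?e j) = mset \<mu>)"
        using Cons.prems j by (intro Cons.IH) (auto simp: K)
      moreover have "vals (m - ?e j) \<noteq> mset \<mu>"
        using Cons.prems(3) by (metis K size_mset size_vals length_Cons not_less_eq_eq order_refl)
      ultimately show ?thesis using neq True by auto
    qed
  next
    case False
    then show ?thesis by (intro exI[of _ 0]) auto
  qed
  then obtain k where k: "\<And>j. (if n \<le> lookup m j then lookup ?g (m - ?e j) else 0) = of_nat (k j)"
      "\<And>j. k j > 0 \<longleftrightarrow> lookup m j = n \<and> vals m = mset (n # \<mu>)"
    by metis
  have "lookup (\<Prod>n\<leftarrow>n # \<mu>. \<Sum>i=1..N. X i ^ n :: F mpoly) m = (\<Sum>j=1..N. if n \<le> lookup m j then lookup ?g (m - ?e j) else 0)"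
    by (simp only: list.map prod_list.Cons sum_distrib_right lookup_sum lookup_X_power_mult)
  also have "\<dots> = of_nat (\<Sum>j=1..N. k j)" by (simp add: k(1))
  finally have "lookup (\<Prod>n\<leftarrow>n # \<mu>. \<Sum>i=1..N. X i ^ n :: F mpoly) m = of_nat (\<Sum>j=1..N. k j)" .
  moreover have "(\<Sum>j=1..N. k j) > 0 \<longleftrightarrow> vals m = mset (n # \<mu>)"
  proof
    assume "(\<Sum>j=1..N. k j) > 0"
    then have "(\<Sum>j=1..N. k j) \<noteq> 0" by (rule gr_implies_not0)
    then obtain j where "k j \<noteq> 0" by (rule sum.not_neutral_contains_not_neutral)
    then have "k j > 0" by (rule neq0_conv[THEN iffD1])
    then show "vals m = mset (n # \<mu>)" unfolding k(2) by (rule conjunct2)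
  next
    assume v: "vals m = mset (n # \<mu>)"
    then have "n \<in># vals m" by simp
    then obtain j where j: "j \<in> keys m" "lookup m j = n" by (auto simp: vals_def)
    then have "k j > 0" using v k(2) by blast
    moreover have "j \<in> {1..N}" using j Cons.prems(2) by blast
    ultimately show "(\<Sum>j=1..N. k j) > 0" by (intro sum_pos2[of _ j]) simp_all
  qed
  ultimately show ?case by (intro exI[of _ "\<Sum>j=1..N. k j"] conjI)
qed

definition expo :: "nat list \<Rightarrow> (nat \<Rightarrow>\<^sub>0 nat)" where
  "expo \<mu> = (\<Sum>j<length \<mu>. Poly_Mapping.single (Suc j) (\<mu> ! j))"

lemma lookup_expo: "lookup (expo \<mu>) i = part \<mu> i"
proof -
  have "lookup (expo \<mu>) i = (\<Sum>j<length \<mu>. if Suc j = i then \<mu> ! j else 0)"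
    by (simp add: expo_def lookup_sum lookup_single when_def)
  also have "\<dots> = part \<mu> i"
    by (cases i) (auto simp: part_def)
  finally show ?thesis .
qed

lemma keys_expo: "0 \<notin> set \<mu> \<Longrightarrow> keys (expo \<mu>) = {1..length \<mu>}"
  by (auto simp: in_keys_iff lookup_expo part_def in_set_conv_nth split: if_splits)

lemma vals_expo: "0 \<notin> set \<mu> \<Longrightarrow> vals (expo \<mu>) = mset \<mu>"
proof -
  assume "0 \<notin> set \<mu>"
  then have "vals (expo \<mu>) = image_mset (part \<mu>) (mset_set {1..length \<mu>})"
    by (simp add: vals_def keys_expo lookup_expo[abs_def])
  also have "\<dots> = mset (map (part \<mu>) [1..<Suc (length \<mu>)])"
    unfolding mset_map mset_upt atLeastLessThanSuc_atLeastAtMost ..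
  also have "map (part \<mu>) [1..<Suc (length \<mu>)] = \<mu>"
    by (rule nth_equalityI) (auto simp: part_def nth_upt simp del: upt_Suc)
  finally show ?thesis .
qed

lemma subst_psumX_pmono:
  assumes "0 \<notin> set \<mu>"
  shows "subst (psumX N) (Poly_Mapping.single (pmono \<mu>) (c :: F)) = Const c * (\<Prod>n\<leftarrow>\<mu>. \<Sum>i=1..N. X i ^ n)"
proof -
  have "pwr (psumX N) (pmono \<mu>) = (\<Prod>n\<in>#mset \<mu>. \<Sum>j=1..N. X j ^ Suc (n - 1) :: F mpoly)"
    by (simp add: pmono_def pwr_mono psumX_def)
  also have "\<dots> = (\<Prod>n\<in>#mset \<mu>. \<Sum>j=1..N. X j ^ n)"
    using assms by (intro arg_cong[of _ _ prod_mset] image_mset_cong) (metis set_mset_mset diff_Suc_1 not0_implies_Suc)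
  also have "\<dots> = (\<Prod>n\<leftarrow>\<mu>. \<Sum>i=1..N. X i ^ n)"
    by (simp flip: prod_mset_prod_list)
  finally show ?thesis
    by (simp only: subst_eq_ev hom_of_rings.ev_single[OF hom_Const])
qed

text \<open>Algebraic independence of the power sums. Among the monomials of \<open>f\<close> one
  whose partition is longest is chosen; with as many variables as that length,
  \<open>coeff_power_sums\<close> shows that it alone contributes to the coefficient at its own
  exponent vector.\<close>

lemma psums_inj:
  assumes "\<And>N. subst (psumX N) f = (0 :: F mpoly)"
  shows "f = 0"
proof (rule ccontr)
  assume "f \<noteq> 0"
  define \<pi> where "\<pi> m = (SOME \<mu>. is_partition \<mu> \<and> pmono \<mu> = m)" for m
  have \<pi>: "is_partition (\<pi> m) \<and> pmono (\<pi> m) = m" for m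
  proof -
    have "m \<in> pmono ` {\<mu>. is_partition \<mu>}" using pmono_bij by (simp add: bij_betw_def)
    then have "\<exists>\<mu>. is_partition \<mu> \<and> pmono \<mu> = m" by blast
    then show ?thesis unfolding \<pi>_def by (rule someI_ex)
  qed
  have no0: "0 \<notin> set (\<pi> m)" for m using \<pi>[of m] by (simp add: is_partition_def)
  have "finite ((\<lambda>m. length (\<pi> m)) ` keys f)" "(\<lambda>m. length (\<pi> m)) ` keys f \<noteq> {}"
    using \<open>f \<noteq> 0\<close> by simp_all
  then have "Max ((\<lambda>m. length (\<pi> m)) ` keys f) \<in> (\<lambda>m. length (\<pi> m)) ` keys f"
    by (rule Max_in)
  then obtain n where "n \<in> keys f" "length (\<pi> n) = Max ((\<lambda>m. length (\<pi> m)) ` keys f)" by auto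
  then have n: "n \<in> keys f" "\<And>m. m \<in> keys f \<Longrightarrow> length (\<pi> m) \<le> length (\<pi> n)" by simp_all
  let ?N = "length (\<pi> n)" and ?e = "expo (\<pi> n)"
  have "lookup (subst (psumX ?N) f) ?e = (\<Sum>m\<in>keys f. lookup f m * lookup (\<Prod>n\<leftarrow>\<pi> m. \<Sum>i=1..?N. X i ^ n :: F mpoly) ?e)"
  proof -
    have "subst (psumX ?N) f = (\<Sum>m\<in>keys f. subst (psumX ?N) (Poly_Mapping.single (pmono (\<pi> m)) (lookup f m)))"
      by (subst mpoly_sum_single) (simp add: subst_sum \<pi>)
    then show ?thesis
      by (simp add: subst_psumX_pmono no0 lookup_sum lookup_Const_mult)
  qed
  also have "\<dots> = (\<Sum>m\<in>{n}. lookup f m * lookup (\<Prod>n\<leftarrow>\<pi> m. \<Sum>i=1..?N. X i ^ n :: F mpoly) ?e)"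
  proof (rule sum.mono_neutral_right)
    show "\<forall>m\<in>keys f - {n}. lookup f m * lookup (\<Prod>n\<leftarrow>\<pi> m. \<Sum>i=1..?N. X i ^ n :: F mpoly) ?e = 0"
    proof
      fix m assume m: "m \<in> keys f - {n}"
      then obtain k where k: "lookup (\<Prod>n\<leftarrow>\<pi> m. \<Sum>i=1..?N. X i ^ n :: F mpoly) ?e = of_nat k" "k > 0 \<longleftrightarrow> vals ?e = mset (\<pi> m)"
        using coeff_power_sums[OF no0[of m], of ?e ?N] n(2)[of m] by (auto simp: keys_expo no0)
      have "vals ?e \<noteq> mset (\<pi> m)"
      proof
        assume "vals ?e = mset (\<pi> m)"
        then have "pmono (\<pi> n) = pmono (\<pi> m)" by (simp add: vals_expo no0 pmono_def)
        then show False using m \<pi> by auto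
      qed
      then show "lookup f m * lookup (\<Prod>n\<leftarrow>\<pi> m. \<Sum>i=1..?N. X i ^ n :: F mpoly) ?e = 0"
        using k by simp
    qed
  qed (use n in auto)
  also have "\<dots> \<noteq> 0"
    using coeff_power_sums[OF no0[of n], of ?e ?N] n(1)
    by (auto simp: keys_expo no0 vals_expo in_keys_iff)
  finally show False using assms by simp
qed

lemma of_psums_inj: "of_psums f = of_psums g \<Longrightarrow> f = g"
proof -
  assume "of_psums f = of_psums g"
  then have "subst (psumX N) (f - g) = 0" for N
    by (simp add: hom_of_rings.hom_diff[OF hom_subst] flip: proj_of_psums)
  then have "f - g = 0" by (rule psums_inj)
  then show "f = g" by simp
qed

subsection \<open>Symmetric functions are polynomials in the power sums\<close>

lemma pwr_X_perm:
  assumes "bij w"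
  shows "pwr (\<lambda>i. X (w i)) n = (Poly_Mapping.single (Poly_Mapping.map_key (inv w) n) 1 :: 'a::comm_semiring_1 mpoly)"
proof -
  have inj: "inj (inv w)" using assms by (simp add: bij_imp_bij_inv bij_is_inj)
  have "keys (Poly_Mapping.map_key (inv w) n) = w ` keys n"
    using assms inj by (simp add: keys_map_key bij_vimage_eq_inv_image[of "inv w"] bij_imp_bij_inv inv_inv_eq)
  then have "pwr X (Poly_Mapping.map_key (inv w) n) = (\<Prod>i\<in>w ` keys n. X i ^ lookup n (inv w i) :: 'a mpoly)"
    using inj by (simp add: pwr_def map_key.rep_eq)
  also have "\<dots> = (\<Prod>i\<in>keys n. X (w i) ^ lookup n i)"
    using assms by (subst prod.reindex) (auto simp: bij_is_inj inj_on_subset[of w UNIV] intro!: prod.cong)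
  finally show ?thesis unfolding pwr_X by (simp only: pwr_def)
qed

lemma lookup_subst_perm:
  fixes f :: "'a::comm_ring_1 mpoly"
  assumes "bij w"
  shows "lookup (subst (\<lambda>i. X (w i)) f) m = lookup f (Poly_Mapping.map_key w m)"
proof (induction f rule: mpoly_linear_induct)
  case (single n c)
  have inj: "inj w" "inj (inv w)" using assms by (simp_all add: bij_imp_bij_inv bij_is_inj)
  have "Poly_Mapping.map_key (inv w) n = m \<longleftrightarrow> n = Poly_Mapping.map_key w m"
  proof
    assume m: "Poly_Mapping.map_key (inv w) n = m"
    show "n = Poly_Mapping.map_key w m"
      using inj by (intro poly_mapping_eqI) (simp add: map_key.rep_eq flip: m)
  next
    assume n: "n = Poly_Mapping.map_key w m"
    show "Poly_Mapping.map_key (inv w) n = m"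
      using inj assms by (intro poly_mapping_eqI) (simp add: map_key.rep_eq n bij_is_surj surj_f_inv_f)
  qed
  then show ?case
    by (simp add: subst_single mono_eval_eq_pwr pwr_X_perm[OF assms] Const_times_single lookup_single when_def)
qed (simp_all add: subst_add lookup_add)

lemma lookup_restr:
  fixes f :: "'a::comm_ring_1 mpoly"
  assumes "N \<notin> keys m"
  shows "lookup (restr N f) m = lookup f m"
proof (induction f rule: mpoly_linear_induct)
  case (single n c)
  have "pwr (\<lambda>i. if i = N then 0 else X i) n = (if N \<in> keys n then 0 else Poly_Mapping.single n (1::'a))"
  proof (cases "N \<in> keys n")
    case True
    then show ?thesis
      by (auto simp: pwr_def in_keys_iff zero_power intro!: prod_zero bexI[of _ N])
  next
    case False
    then have "pwr (\<lambda>i. if i = N then 0 else X i) n = (pwr X n :: 'a mpoly)"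
      by (auto simp: pwr_def intro!: prod.cong)
    then show ?thesis using False by (simp add: pwr_X)
  qed
  then show ?case using assms
    by (auto simp: restr_def subst_single mono_eval_eq_pwr Const_times_single lookup_single when_def)
qed (simp_all add: restr_def subst_add lookup_add)

lemma lookup_proj_stable:
  assumes "keys m \<subseteq> {1..N}" "N \<le> N'"
  shows "lookup (proj N' f) m = lookup (proj N f) m"
  using assms(2)
proof (induction N' rule: dec_induct)
  case (step n)
  have "Suc n \<notin> keys m" using assms(1) step(1) by auto
  then show ?case using step proj_symf(2)[of n f] lookup_restr[of "Suc n" m "proj (Suc n) f"] by simp
qed simp

text \<open>Padded with zeros to length N, two exponent vectors with the same nonzero values differ
  by a permutation of the variables; stability then reduces N to the number of parts.\<close>

lemma lookup_proj_vals:
  assumes "0 \<notin> set \<mu>" "keys m \<subseteq> {1..N}" "vals m = mset \<mu>"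
  shows "lookup (proj N f) m = lookup (proj (length \<mu>) f) (expo \<mu>)"
proof -
  have pad: "image_mset (lookup k) (mset_set {1..N}) = vals k + replicate_mset (N - card (keys k)) 0"
    if "keys k \<subseteq> {1..N}" for k
  proof -
    have "mset_set {1..N} = mset_set (keys k) + mset_set ({1..N} - keys k)"
      using that by (metis Diff_disjoint Diff_partition finite_atLeastAtMost finite_keys finite_Diff mset_set_Union)
    moreover have "image_mset (lookup k) (mset_set ({1..N} - keys k)) = image_mset (\<lambda>_. 0) (mset_set ({1..N} - keys k))"
      by (rule image_mset_cong) (auto simp: in_keys_iff)
    ultimately show ?thesis
      using that by (simp add: vals_def image_mset_const_eq card_Diff_subset)
  qed
  have len: "card (keys m) = length \<mu>" by (metis assms(3) size_mset size_vals)
  have le: "length \<mu> \<le> N" using card_mono[OF finite_atLeastAtMost assms(2)] len by simp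
  have "image_mset (lookup m) (mset_set {1..N}) = image_mset (lookup (expo \<mu>)) (mset_set {1..N})"
    using pad[OF assms(2)] pad[of "expo \<mu>"] le by (simp add: vals_expo keys_expo assms len)
  then obtain w where w: "w permutes {1..N}" "\<forall>x\<in>{1..N}. lookup (expo \<mu>) x = lookup m (w x)"
    using image_mset_eq_implies_permutes[of "{1..N}" "lookup (expo \<mu>)" "lookup m"] by auto
  have "Poly_Mapping.map_key w m = expo \<mu>"
  proof (rule poly_mapping_eqI)
    fix i
    have "lookup m (w i) = lookup (expo \<mu>) i"
    proof (cases "i \<in> {1..N}")
      case False
      then have "w i = i" "i \<notin> keys m" "i \<notin> keys (expo \<mu>)"
        using w(1) assms(2) le by (auto simp: permutes_def keys_expo[OF assms(1)])
      then show ?thesis by (simp add: in_keys_iff)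
    qed (use w in auto)
    then show "lookup (Poly_Mapping.map_key w m) i = lookup (expo \<mu>) i"
      using permutes_inj[OF w(1)] by (simp add: map_key.rep_eq)
  qed
  moreover have "subst (\<lambda>i. X (w i)) (proj N f) = proj N f"
    using proj_symf(1)[of N f] w(1) by (auto simp: sym_polys_def)
  ultimately have "lookup (proj N f) m = lookup (proj N f) (expo \<mu>)"
    using lookup_subst_perm[OF permutes_bij[OF w(1)], of "proj N f" m] by simp
  also have "\<dots> = lookup (proj (length \<mu>) f) (expo \<mu>)"
    using le by (intro lookup_proj_stable) (simp_all add: keys_expo assms)
  finally show ?thesis .
qed

lemma sum_mset_vals: "sum_mset (vals m) = mono_deg m"
  by (simp add: vals_def mono_deg_def sum_unfold_sum_mset)

lemma finite_partitions_le: "finite {\<mu>. is_partition \<mu> \<and> sum_list \<mu> \<le> d}"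
proof (rule finite_imageD)
  show "inj_on pmono {\<mu>. is_partition \<mu> \<and> sum_list \<mu> \<le> d}"
    using pmono_bij by (auto simp: bij_betw_def inj_on_def)
  show "finite (pmono ` {\<mu>. is_partition \<mu> \<and> sum_list \<mu> \<le> d})"
    by (rule finite_subset[OF _ finite_exps[of d]]) (auto simp: exps_def wt_pmono)
qed

text \<open>Subtracting products of \<open>L + 1\<close> power sums cancels the coefficients of all
  monomials in exactly \<open>L + 1\<close> variables and affects only monomials in fewer variables besides.\<close>

lemma of_psums_surj_aux:
  assumes "\<And>N m. m \<in> keys (proj N f) \<Longrightarrow> card (keys m) \<le> L"
  shows "\<exists>g. f = of_psums g"
  using assms
proof (induction L arbitrary: f)
  case 0
  have k: "m = 0" if "m \<in> keys (proj N f)" for m N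
    using 0[OF that] by simp
  have "f = of_psums (Const (lookup (proj 0 f) 0))"
  proof (rule symf_eqI[of 0], rule poly_mapping_eqI)
    fix N m
    have "lookup (proj N f) 0 = lookup (proj 0 f) 0" by (rule lookup_proj_stable) simp_all
    then show "lookup (proj N f) m = lookup (proj N (of_psums (Const (lookup (proj 0 f) 0)))) m"
      using k[of m N] by (auto simp: proj_of_psums in_keys_iff) (auto simp: Const_def lookup_single when_def)
  qed
  then show ?case by blast
next
  case (Suc L)
  obtain d where d: "\<And>N. deg_le d (proj N f)"
    using proj_fun[of f] by (auto simp: proj_def)
  define S where "S = {\<mu>. is_partition \<mu> \<and> sum_list \<mu> \<le> d \<and> length \<mu> = Suc L}"
  have "finite S" unfolding S_def by (rule finite_subset[OF _ finite_partitions_le[of d]]) auto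
  define pl where "pl \<mu> = power_sum_list \<mu>" for \<mu>
  define a where "a \<mu> = lookup (proj (Suc L) f) (expo \<mu>) / lookup (proj (Suc L) (pl \<mu>)) (expo \<mu>)" for \<mu>
  have pl_proj: "proj N (pl \<mu>) = (\<Prod>n\<leftarrow>\<mu>. \<Sum>i=1..N. X i ^ n)" if "\<mu> \<in> S" for N \<mu>
    using subst_psumX_pmono[of \<mu> N 1] that proj_of_psums[of N "Poly_Mapping.single (pmono \<mu>) 1"]
    by (simp add: pl_def of_psums_pmono S_def is_partition_def)
  have coeff0: "lookup (proj N (pl \<mu>)) m = 0"
    if "\<mu> \<in> S" "keys m \<subseteq> {1..N}" "card (keys m) \<ge> Suc L" "vals m \<noteq> mset \<mu>" for N \<mu> m
    using coeff_power_sums[of \<mu> m N] that pl_proj[OF that(1)] by (auto simp: S_def is_partition_def)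
  have nz: "lookup (proj (Suc L) (pl \<mu>)) (expo \<mu>) \<noteq> 0" if "\<mu> \<in> S" for \<mu>
    using coeff_power_sums[of \<mu> "expo \<mu>" "Suc L"] that pl_proj[OF that]
    by (auto simp: S_def is_partition_def keys_expo vals_expo)
  define g where "g = f - (\<Sum>\<mu>\<in>S. a \<mu> \<cdot> pl \<mu>)"
  have lg: "lookup (proj N g) m = lookup (proj N f) m - (\<Sum>\<mu>\<in>S. a \<mu> * lookup (proj N (pl \<mu>)) m)" for N m
    by (simp add: g_def proj_diff proj_sum proj_scale lookup_minus lookup_sum lookup_Const_mult)
  have "card (keys m) \<le> L" if m: "m \<in> keys (proj N g)" for N m
  proof (rule ccontr)
    assume c: "\<not> card (keys m) \<le> L"
    have mN: "keys m \<subseteq> {1..N}" using proj_symf(1)[of N g] m by (auto simp: sym_polys_def)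
    obtain \<mu> where \<mu>: "is_partition \<mu>" "mset \<mu> = vals m" using partition_ex[OF vals_no_0] by blast
    have no0: "0 \<notin> set \<mu>" using \<mu> by (simp add: is_partition_def)
    have "lookup (proj N g) m = 0"
    proof (cases "\<mu> \<in> S")
      case True
      have "(\<Sum>\<nu>\<in>S. a \<nu> * lookup (proj N (pl \<nu>)) m) = (\<Sum>\<nu>\<in>{\<mu>}. a \<nu> * lookup (proj N (pl \<nu>)) m)"
      proof (rule sum.mono_neutral_right)
        show "\<forall>\<nu>\<in>S - {\<mu>}. a \<nu> * lookup (proj N (pl \<nu>)) m = 0"
        proof
          fix \<nu> assume \<nu>: "\<nu> \<in> S - {\<mu>}"
          then have "vals m \<noteq> mset \<nu>" using \<mu> partition_eqI[of \<mu> \<nu>] by (auto simp: S_def)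
          then show "a \<nu> * lookup (proj N (pl \<nu>)) m = 0" using \<nu> c coeff0[of \<nu> m N] mN by simp
        qed
      qed (use True \<open>finite S\<close> in auto)
      moreover have "length \<mu> = Suc L" using True by (simp add: S_def)
      moreover have "lookup (proj N h) m = lookup (proj (length \<mu>) h) (expo \<mu>)" for h :: "F symf"
        using \<mu> no0 mN by (intro lookup_proj_vals) simp_all
      ultimately show ?thesis using nz[OF True] by (simp add: lg a_def)
    next
      case False
      have "lookup (proj N f) m = 0"
      proof (rule ccontr)
        assume "lookup (proj N f) m \<noteq> 0"
        then have mf: "m \<in> keys (proj N f)" by (simp add: in_keys_iff)
        have "sum_list \<mu> = mono_deg m" using \<mu> by (metis sum_mset_sum_list sum_mset_vals)
        also have "\<dots> \<le> d" using d[of N] mf by (auto simp: deg_le_def)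
        finally have "sum_list \<mu> \<le> d" .
        moreover have "length \<mu> = Suc L"
          using Suc.prems[OF mf] c \<mu> by (metis le_SucE size_mset size_vals)
        ultimately show False using False \<mu> by (simp add: S_def)
      qed
      moreover have "(\<Sum>\<nu>\<in>S. a \<nu> * lookup (proj N (pl \<nu>)) m) = 0"
      proof (rule sum.neutral[OF ballI])
        fix \<nu> assume that: "\<nu> \<in> S"
        have "vals m \<noteq> mset \<nu>" using that False \<mu> partition_eqI[of \<mu> \<nu>] by (auto simp: S_def)
        then show "a \<nu> * lookup (proj N (pl \<nu>)) m = 0" using that c coeff0[of \<nu> m N] mN by simp
      qed
      ultimately show ?thesis by (simp add: lg)
    qed
    with m show False by (simp add: in_keys_iff)
  qed
  then obtain h where "g = of_psums h" using Suc.IH by blast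
  then have "f = of_psums (h + (\<Sum>\<mu>\<in>S. Const (a \<mu>) * Poly_Mapping.single (pmono \<mu>) 1))"
  proof -
    have "(\<Sum>\<mu>\<in>S. a \<mu> \<cdot> pl \<mu>) = (\<Sum>\<mu>\<in>S. a \<mu> \<cdot> of_psums (Poly_Mapping.single (pmono \<mu>) 1))"
      by (intro sum.cong refl arg_cong2[of _ _ _ _ scale]) (auto simp: of_psums_pmono S_def is_partition_def pl_def)
    with \<open>g = of_psums h\<close> show ?thesis
      by (simp add: hom_of_rings.hom_add[OF hom_of_psums] hom_of_rings.hom_sum[OF hom_of_psums]
          of_psums_scale g_def algebra_simps)
  qed
  then show ?case by blast
qed

text \<open>The uniform degree bound in the inverse limit also bounds the number of variables in any
  monomial, which gives the induction its starting point.\<close>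

lemma of_psums_surj: "\<exists>g. f = of_psums g"
proof -
  obtain d where d: "\<And>N. deg_le d (proj N f)"
    using proj_fun[of f] by (auto simp: proj_def)
  have "card (keys m) \<le> d" if "m \<in> keys (proj N f)" for N m
  proof -
    have "card (keys m) = (\<Sum>i\<in>keys m. 1)" by simp
    also have "\<dots> \<le> mono_deg m" unfolding mono_deg_def by (intro sum_mono) (auto simp: in_keys_iff)
    also have "\<dots> \<le> d" using d[of N] that by (auto simp: deg_le_def)
    finally show ?thesis .
  qed
  then show ?thesis by (rule of_psums_surj_aux)
qed

section \<open>Orthogonality of the Hall-Littlewood functions\<close>

definition to_fract :: "'a::idom \<Rightarrow> 'a fract" where
  "to_fract p = Fract p 1"

lemma hom_to_fract: "hom_of_rings to_fract"
  by unfold_locales (simp_all add: to_fract_def One_fract_def)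

lemma to_fract_inj [simp]: "to_fract p = to_fract r \<longleftrightarrow> p = r"
  by (simp add: to_fract_def eq_fract)

lemma Fract_eq_divide: "r \<noteq> 0 \<Longrightarrow> Fract p r = to_fract p / to_fract r"
  by (simp add: to_fract_def)

lemma to_fract_eq_0 [simp]: "to_fract p = 0 \<longleftrightarrow> p = 0"
  by (simp add: to_fract_def Zero_fract_def eq_fract)

abbreviation X_fract :: "nat \<Rightarrow> 'a::field mpoly fract" where
  "X_fract i \<equiv> to_fract (X i)"

lemma X_inj [simp]: "X i = (X j :: 'a::field mpoly) \<longleftrightarrow> i = j"
proof
  assume "X i = (X j :: 'a mpoly)"
  then have "lookup (X i :: 'a mpoly) (Poly_Mapping.single j 1) = lookup (X j :: 'a mpoly) (Poly_Mapping.single j 1)"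
    by simp
  then have "Poly_Mapping.single i (1::nat) = Poly_Mapping.single j 1"
    by (simp add: X_def lookup_single when_def split: if_splits)
  then have "lookup (Poly_Mapping.single i (1::nat)) j = 1" by simp
  then show "i = j" by (simp add: lookup_single when_def split: if_splits)
qed simp

lemma X_nonzero [simp]: "(X i :: 'a::field mpoly) \<noteq> 0"
  by (simp add: X_def) (metis lookup_single_eq lookup_zero zero_neq_one)

definition Const_fract :: "'a::field \<Rightarrow> 'a mpoly fract" where
  "Const_fract c = to_fract (Const c)"

lemma hom_Const_fract: "hom_of_rings (Const_fract :: 'a::field \<Rightarrow> _)"
  unfolding Const_fract_def by (rule hom_of_rings_comp[OF hom_Const hom_to_fract])

interpretation FX: F_field_hom "Const_fract :: F \<Rightarrow> F mpoly fract"
  unfolding F_field_hom_def F_hom_def by (rule hom_Const_fract)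

lemma to_fract_subst_psumX:
  "to_fract (subst (psumX N) f) = FX.ev (FX.psums X_fract {1..N}) f"
proof -
  have "(\<lambda>i. to_fract (psumX N i)) = FX.psums (X_fract :: nat \<Rightarrow> F mpoly fract) {1..N}"
    by (simp add: fun_eq_iff psumX_def FX.psums_def hom_of_rings.hom_sum[OF hom_to_fract]
        hom_of_rings.hom_power[OF hom_to_fract] hom_of_rings.hom_mult[OF hom_to_fract])
  then show ?thesis
    unfolding subst_eq_ev hom_comp_ev[OF hom_Const hom_to_fract] by (simp add: Const_fract_def[abs_def])
qed

text \<open>The indeterminates in the fraction field are distinct nonzero points, so branching
  applies to them; over all N they still separate polynomials in the power sums.\<close>

lemma FX_ev_inj:
  assumes "\<And>N. FX.ev (FX.psums X_fract {1..N}) f = FX.ev (FX.psums X_fract {1..N}) g"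
  shows "f = g"
proof -
  have "subst (psumX N) (f - g) = 0" for N
    using assms[of N] unfolding to_fract_subst_psumX[symmetric]
    by (simp add: hom_of_rings.hom_diff[OF hom_subst])
  then have "f - g = 0" by (rule psums_inj)
  then show ?thesis by simp
qed

subsection \<open>Leading coefficients in one variable\<close>

text \<open>\<open>f = c z\<^sup>s + lower powers of z\<close>, where \<open>z\<close> is \<^const>\<open>fls_X_inv\<close>.\<close>

definition lead :: "'a::field fls \<Rightarrow> nat \<Rightarrow> 'a \<Rightarrow> bool" where
  "lead f s c \<longleftrightarrow> (\<exists>G. f = fps_to_fls G * fls_X_inv ^ s \<and> fps_nth G 0 = c)"

lemma lead_add: "lead f s c \<Longrightarrow> lead g s d \<Longrightarrow> lead (f + g) s (c + d)"
  unfolding lead_def by (metis distrib_right fps_add_nth fps_to_fls_plus)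

lemma lead_mult:
  assumes "lead f s c" "lead g r d"
  shows "lead (f * g) (s + r) (c * d)"
proof -
  obtain F G where "f = fps_to_fls F * fls_X_inv ^ s" "fps_nth F 0 = c"
      "g = fps_to_fls G * fls_X_inv ^ r" "fps_nth G 0 = d"
    using assms unfolding lead_def by blast
  then show ?thesis
    unfolding lead_def by (intro exI[of _ "F * G"]) (simp add: fls_times_fps_to_fls power_add mult_ac)
qed

lemma lead_const: "lead (fls_const c) 0 c"
  unfolding lead_def by (intro exI[of _ "fps_const c"]) simp

lemma lead_1: "lead 1 0 1"
  using lead_const[of 1] by simp

lemma lead_X_inv: "lead fls_X_inv 1 1"
  unfolding lead_def by (intro exI[of _ 1]) simp

lemma lead_power: "lead f s c \<Longrightarrow> lead (f ^ n) (n * s) (c ^ n)"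
proof (induction n)
  case (Suc n)
  then show ?case using lead_mult[of f s c "f ^ n" "n * s" "c ^ n"] by simp
qed (simp add: lead_1)

lemma lead_lower:
  assumes "lead f s c" "s < r"
  shows "lead f r 0"
proof -
  obtain G where G: "f = fps_to_fls G * fls_X_inv ^ s" using assms unfolding lead_def by blast
  obtain k where r: "r = s + Suc k" using assms(2) less_iff_Suc_add by auto
  have X: "fls_X ^ n * fls_X_inv ^ n = (1 :: 'a fls)" for n
    by (simp add: fls_X_inv_times_conv_shift(2) flip: power_mult_distrib)
  have "fls_X ^ Suc k * (fls_X_inv :: 'a fls) ^ r = (fls_X ^ Suc k * fls_X_inv ^ Suc k) * fls_X_inv ^ s"
    unfolding r power_add by (simp only: mult_ac)
  then have "fls_X_inv ^ s = fls_X ^ Suc k * (fls_X_inv :: 'a fls) ^ r"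
    unfolding X by simp
  then have "f = fps_to_fls (G * fps_X ^ Suc k) * fls_X_inv ^ r"
    by (simp add: G fls_times_fps_to_fls fps_to_fls_power mult_ac)
  then show ?thesis unfolding lead_def by (intro exI[of _ "G * fps_X ^ Suc k"]) simp
qed

lemma lead_const': "s > 0 \<Longrightarrow> lead (fls_const c) s 0"
  by (rule lead_lower[OF lead_const])

lemma lead_scale: "lead f s c \<Longrightarrow> lead (fls_const d * f) s (d * c)"
  using lead_mult[OF lead_const[of d]] by fastforce

lemma lead_diff: "lead f s c \<Longrightarrow> lead g s d \<Longrightarrow> lead (f - g) s (c - d)"
  using lead_add[of f s c "fls_const (-1) * g" "- d"] lead_scale[of g s d "-1"] by simp

lemma lead_0: "lead 0 s 0"
  unfolding lead_def by (intro exI[of _ 0]) simp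

lemma lead_sum: "(\<And>i. i \<in> A \<Longrightarrow> lead (f i) s (c i)) \<Longrightarrow> lead (sum f A) s (sum c A)"
  by (induction A rule: infinite_finite_induct) (simp_all add: lead_0 lead_add)

lemma lead_prod: "(\<And>i. i \<in> A \<Longrightarrow> lead (f i) 0 (c i)) \<Longrightarrow> lead (prod f A) 0 (prod c A)"
proof (induction A rule: infinite_finite_induct)
  case (insert i A)
  then show ?case using lead_mult[of "f i" 0 "c i" "prod f A" 0 "prod c A"] by simp
qed (simp_all add: lead_1)

lemma lead_divide:
  assumes "lead f s c" "lead g s d" "d \<noteq> 0"
  shows "lead (f / g) 0 (c / d)"
proof -
  obtain F G where FG: "f = fps_to_fls F * fls_X_inv ^ s" "fps_nth F 0 = c"
      "g = fps_to_fls G * fls_X_inv ^ s" "fps_nth G 0 = d"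
    using assms unfolding lead_def by blast
  have "fps_to_fls (inverse G) * fps_to_fls G = 1"
    using assms(3) FG(4) by (simp flip: fls_times_fps_to_fls add: inverse_mult_eq_1)
  then have "fps_to_fls F = fps_to_fls (F * inverse G) * fps_to_fls G"
    by (simp add: fls_times_fps_to_fls mult.assoc)
  moreover have "fps_to_fls G \<noteq> 0" using FG(4) assms(3) by auto
  moreover have "fls_X_inv ^ s \<noteq> (0 :: 'a fls)" by simp
  ultimately have "f / g = fps_to_fls (F * inverse G)"
    by (simp add: FG(1,3))
  then show ?thesis
    unfolding lead_def using FG by (intro exI[of _ "F * inverse G"]) (simp add: divide_inverse)
qed

lemma lead_nth:
  assumes "lead f s c"
  shows "fls_nth f (- int s) = c" "s < j \<Longrightarrow> fls_nth f (- int j) = 0"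
  using assms by (auto simp: lead_def mult.commute[of _ "fls_X_inv ^ s"] fls_X_inv_power_times_conv_shift)

subsection \<open>The top coefficient of a Hall-Littlewood function\<close>

text \<open>One additional variable \<open>z\<close>, with index 0, is sent to infinity.\<close>

definition pt_inf :: "nat \<Rightarrow> F mpoly fract fls" where
  "pt_inf i = (if i = 0 then fls_X_inv else fls_const (X_fract i))"

interpretation FL: F_field_hom "\<lambda>c. fls_const (Const_fract c) :: F mpoly fract fls"
  unfolding F_field_hom_def F_hom_def
  by unfold_locales (simp_all add: FX.hom_add FX.hom_mult fls_plus_const flip: fls_const_mult_const)

lemma hom_fls_const: "hom_of_rings (fls_const :: 'a::comm_ring_1 \<Rightarrow> _)"
  by unfold_locales (simp_all add: fls_plus_const flip: fls_const_mult_const)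

lemma FL_ev_const:
  assumes "0 \<notin> I"
  shows "FL.ev (FL.psums pt_inf I) f = fls_const (FX.ev (FX.psums X_fract I) f)"
proof -
  have "(\<lambda>i. fls_const (FX.psums X_fract I i)) = FL.psums pt_inf I"
    using assms by (force simp: fun_eq_iff FX.psums_def FL.psums_def pt_inf_def
        hom_of_rings.hom_sum[OF hom_fls_const] hom_of_rings.hom_power[OF hom_fls_const]
        hom_of_rings.hom_mult[OF hom_fls_const] intro!: sum.cong)
  then show ?thesis
    unfolding hom_comp_ev[OF hom_Const_fract hom_fls_const] by simp
qed

lemma pt_inf_inj: "inj_on pt_inf I"
proof (rule inj_onI)
  fix i j assume eq: "pt_inf i = pt_inf j"
  have "fls_nth (fls_X_inv :: F mpoly fract fls) (-1) = 1" by simp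
  then have "fls_X_inv \<noteq> fls_const c" for c :: "F mpoly fract"
    by (metis fls_const_nth zero_neq_neg_one zero_neq_one)
  moreover have "fls_const c = fls_const d \<longleftrightarrow> c = d" for c d :: "F mpoly fract"
    by (metis fls_const_nth)
  ultimately show "i = j" using eq
    by (auto simp: pt_inf_def split: if_splits dest: sym)
qed

lemma pt_inf_nonzero: "pt_inf i \<noteq> 0"
  by (simp add: pt_inf_def)

lemma FL_cross_const:
  assumes "0 \<notin> I" "i \<noteq> 0"
  shows "FL.cross pt_inf {i} I = fls_const (FX.cross X_fract {i} I)"
proof -
  have d: "fls_const (x / y) = fls_const x / fls_const y" for x y :: "F mpoly fract"
    by (metis fls_const_divide_const)
  have "(pt_inf i - FL.tt * pt_inf j) / (pt_inf i - pt_inf j) =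
     fls_const ((X_fract i - FX.tt * X_fract j) / (X_fract i - X_fract j))" if "j \<in> I" for j
  proof -
    have "j \<noteq> 0" using assms that by (cases j) auto
    then show ?thesis using assms by (simp add: pt_inf_def d fls_minus_const)
  qed
  then show ?thesis
    by (simp add: FL.cross_def FX.cross_def hom_of_rings.hom_prod[OF hom_fls_const])
qed

lemma part_count_0: "is_partition (s' # \<nu>) \<Longrightarrow> s' < s \<Longrightarrow> count_list (s' # \<nu>) s = 0"
  by (auto simp: is_partition_def count_list_0_iff)

lemma is_partition_Cons: "is_partition (s # \<nu>) \<Longrightarrow> is_partition \<nu> \<and> s \<ge> 1"
  by (cases s) (auto simp: is_partition_def)

text \<open>Branching over the points together with z. Removing z leaves z^s and a cross factor
  tending to 1; removing x_i leaves the factor (x_i - t z)/(x_i - z), which tends to t.\<close>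

lemma lead_HLM_step:
  assumes s: "s \<ge> 1" and I: "finite I" "0 \<notin> I"
    and e: "\<And>i. i \<in> I \<Longrightarrow> lead (FL.ev (FL.psums pt_inf (insert 0 (I - {i}))) (HLM \<nu>)) s (e i)"
  shows "lead (FL.ev (FL.psums pt_inf (insert 0 I)) (HLM (s # \<nu>))) s
    ((1 - FX.tt) * (FX.ev (FX.psums X_fract I) (HLM \<nu>) +
      FX.tt * (\<Sum>i\<in>I. X_fract i ^ s * FX.cross X_fract {i} (I - {i}) * e i)))"
proof -
  have tt: "lead FL.tt 0 FX.tt" by (rule lead_const)
  have tX: "lead (FL.tt * fls_X_inv) 1 FX.tt" using lead_mult[OF tt lead_X_inv] by simp
  have pt: "pt_inf j = fls_const (X_fract j)" "j \<noteq> 0" if "j \<in> I" for j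
    using I that by (auto simp: pt_inf_def intro: gr0I)
  have cross0: "lead (FL.cross pt_inf {0} I) 0 1"
  proof -
    have "lead ((pt_inf 0 - FL.tt * pt_inf j) / (pt_inf 0 - pt_inf j)) 0 1" if "j \<in> I" for j
    proof -
      have "lead (pt_inf 0 - FL.tt * pt_inf j) 1 (1 - 0)" "lead (pt_inf 0 - pt_inf j) 1 (1 - 0)"
        unfolding pt(1)[OF that] fls_const_mult_const
        using lead_diff[OF lead_X_inv lead_const'[of 1]] by (simp_all add: pt_inf_def)
      from lead_divide[OF this] show ?thesis by simp
    qed
    then have "lead (\<Prod>j\<in>I. (pt_inf 0 - FL.tt * pt_inf j) / (pt_inf 0 - pt_inf j)) 0 (\<Prod>j\<in>I. 1)"
      by (rule lead_prod)
    then show ?thesis by (simp add: FL.cross_def)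
  qed
  have crossi: "lead (FL.cross pt_inf {i} (insert 0 I - {i})) 0 (FX.tt * FX.cross X_fract {i} (I - {i}))"
    if i: "i \<in> I" for i
  proof -
    have "lead (pt_inf i - FL.tt * pt_inf 0) 1 (0 - FX.tt)" "lead (pt_inf i - pt_inf 0) 1 (0 - 1)"
      unfolding pt(1)[OF i]
      using lead_diff[OF lead_const' tX] lead_diff[OF lead_const' lead_X_inv] by (simp_all add: pt_inf_def)
    from lead_divide[OF this] have "lead ((pt_inf i - FL.tt * pt_inf 0) / (pt_inf i - pt_inf 0)) 0 FX.tt" by simp
    from lead_mult[OF this lead_const] show ?thesis
      using FL.cross_insert[OF I(1,2) i, of pt_inf] FL_cross_const[of "I - {i}" i] I pt(2)[OF i] by simp
  qed
  let ?f = "\<lambda>i. pt_inf i ^ s * FL.cross pt_inf {i} (insert 0 I - {i}) * FL.ev (FL.psums pt_inf (insert 0 I - {i})) (HLM \<nu>)"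
  have f0: "lead (?f 0) s (FX.ev (FX.psums X_fract I) (HLM \<nu>))"
  proof -
    have "lead (pt_inf 0 ^ s) s 1" using lead_power[OF lead_X_inv, of s] by (simp add: pt_inf_def)
    from lead_mult[OF lead_mult[OF this cross0] lead_const]
    have "lead (pt_inf 0 ^ s * FL.cross pt_inf {0} I * fls_const (FX.ev (FX.psums X_fract I) (HLM \<nu>))) s (FX.ev (FX.psums X_fract I) (HLM \<nu>))"
      by simp
    moreover have "insert 0 I - {0} = I" using I by auto
    ultimately show ?thesis by (simp add: FL_ev_const I)
  qed
  have fi: "lead (?f i) s (FX.tt * (X_fract i ^ s * FX.cross X_fract {i} (I - {i}) * e i))" if i: "i \<in> I" for i
  proof -
    have eq: "insert 0 I - {i} = insert 0 (I - {i})" using pt(2)[OF i] by auto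
    have "lead (pt_inf i ^ s) 0 (X_fract i ^ s)"
      using lead_power[OF lead_const[of "X_fract i"], of s] by (simp add: pt(1)[OF i])
    from lead_mult[OF lead_mult[OF this crossi[OF i]] e[OF i]] show ?thesis
      by (simp add: eq mult_ac)
  qed
  have "lead ((1 - FL.tt) * (?f 0 + (\<Sum>i\<in>I. ?f i))) s ((1 - FX.tt) * (FX.ev (FX.psums X_fract I) (HLM \<nu>) +
      (\<Sum>i\<in>I. FX.tt * (X_fract i ^ s * FX.cross X_fract {i} (I - {i}) * e i))))"
    using lead_mult[OF lead_diff[OF lead_1 tt] lead_add[OF f0 lead_sum[OF fi]]] by simp
  moreover have "FL.ev (FL.psums pt_inf (insert 0 I)) (HLM (s # \<nu>)) = (1 - FL.tt) * (?f 0 + (\<Sum>i\<in>I. ?f i))"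
    using I s by (subst FL.ev_HLM[OF _ pt_inf_inj]) (simp_all add: pt_inf_nonzero)
  ultimately show ?thesis by (simp only: sum_distrib_left)
qed

text \<open>If the next part is also s, with multiplicity k in the tail, the remaining sum is itself
  an instance of branching, and (1 - t) + t(1 - t^k) = 1 - t^(k+1). If it is smaller, that sum has
  lower order in z and only 1 - t remains.\<close>

lemma lead_HLM:
  assumes "is_partition (s # \<nu>)" "finite I" "0 \<notin> I"
  shows "lead (FL.ev (FL.psums pt_inf (insert 0 I)) (HLM (s # \<nu>))) s
    (Const_fract (1 - t_par ^ count_list (s # \<nu>) s) * FX.ev (FX.psums X_fract I) (HLM \<nu>))"
  using assms
proof (induction \<nu> arbitrary: s I)
  case Nil
  then have s: "s \<ge> 1" using is_partition_Cons by blast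
  have "lead (FL.ev (FL.psums pt_inf (insert 0 (I - {i}))) (HLM [])) s 0" for i
    using lead_lower[OF lead_1, of s] s by simp
  from lead_HLM_step[OF s Nil.prems(2,3) this] show ?case
    by (simp add: FX.hom_diff)
next
  case (Cons s' \<nu>)
  have \<nu>': "is_partition (s' # \<nu>)" and s: "s \<ge> 1" and s': "s' \<ge> 1" and le: "s' \<le> s"
    using Cons.prems(1) is_partition_Cons by (auto simp: is_partition_def)
  let ?k = "count_list (s' # \<nu>) s'"
  define e where "e i = Const_fract (1 - t_par ^ ?k) * FX.ev (FX.psums X_fract (I - {i})) (HLM \<nu>)" for i
  have IH: "lead (FL.ev (FL.psums pt_inf (insert 0 (I - {i}))) (HLM (s' # \<nu>))) s' (e i)" for i
    unfolding e_def using Cons.prems by (intro Cons.IH \<nu>') auto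
  show ?case
  proof (cases "s' = s")
    case True
    have br: "(1 - FX.tt) * (\<Sum>i\<in>I. X_fract i ^ s * FX.cross X_fract {i} (I - {i}) * e i) =
        Const_fract (1 - t_par ^ ?k) * FX.ev (FX.psums X_fract I) (HLM (s' # \<nu>))"
      using Cons.prems s' unfolding True
      by (subst FX.ev_HLM) (auto simp: e_def True inj_on_def sum_distrib_left mult_ac)
    have *: "(1 - FX.tt) * (h + FX.tt * (\<Sum>i\<in>I. X_fract i ^ s * FX.cross X_fract {i} (I - {i}) * e i)) =
        (1 - FX.tt) * h + FX.tt * (Const_fract (1 - t_par ^ ?k) * FX.ev (FX.psums X_fract I) (HLM (s' # \<nu>)))" for h
      unfolding br[symmetric] by (simp only: distrib_left mult.left_commute)
    from lead_HLM_step[OF s Cons.prems(2,3) IH[unfolded True]]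
    show ?thesis unfolding *[unfolded True]
      by (simp add: True FX.hom_diff FX.hom_power FX.hom_mult algebra_simps)
  next
    case False
    then have lt: "s' < s" using le by simp
    from lead_HLM_step[OF s Cons.prems(2,3) lead_lower[OF IH lt]]
    show ?thesis using part_count_0[OF \<nu>' lt] by (simp add: FX.hom_diff)
  qed
qed

text \<open>By \<open>ev_add_point\<close>, the adjoint of q_j extracts the coefficient of z^j after
  a variable z has been added. The degree and the top coefficient in z are known from
  \<open>lead_HLM\<close>.\<close>

lemma star_qs_HLM:
  assumes "is_partition (s # \<nu>)"
  shows "s < j \<Longrightarrow> star w0 (qs j) (HLM (s # \<nu>)) = 0"
    and "star w0 (qs s) (HLM (s # \<nu>)) = Const (1 - t_par ^ count_list (s # \<nu>) s) * HLM \<nu>"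
proof -
  let ?d = "sum_list (s # \<nu>)"
  have bd: "bounded_wt ?d (HLM (s # \<nu>))" by (rule homog_imp_bounded[OF homog_HLM])
  have nth: "fls_nth (FL.ev (FL.psums pt_inf (insert 0 {1..N})) (HLM (s # \<nu>))) (- int j) =
      FX.ev (FX.psums X_fract {1..N}) (star w0 (qs j) (HLM (s # \<nu>)))" for j N
  proof -
    let ?c = "\<lambda>r. FX.ev (FX.psums X_fract {1..N}) (star w0 (qs r) (HLM (s # \<nu>)))"
    have "FL.ev (FL.psums pt_inf (insert 0 {1..N})) (HLM (s # \<nu>)) = (\<Sum>r\<le>?d. fls_X_inv ^ r * fls_const (?c r))"
    proof (subst FL.ev_add_point[OF bd])
      have c: "FL.ev (FL.psums pt_inf {1..N}) g = fls_const (FX.ev (FX.psums X_fract {1..N}) g)" for g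
        by (rule FL_ev_const) simp
      show "(\<Sum>r\<le>?d. pt_inf 0 ^ r * FL.ev (FL.psums pt_inf {1..N}) (star w0 (qs r) (HLM (s # \<nu>)))) =
          (\<Sum>r\<le>?d. fls_X_inv ^ r * fls_const (?c r))"
        unfolding c by (simp only: pt_inf_def simp_thms if_True)
    qed simp_all
    moreover have "fls_nth (fls_X_inv ^ r * fls_const (?c r)) (- int j) = (if r = j then ?c j else 0)" for r
      by (simp add: fls_X_inv_power_times_conv_shift)
    ultimately have "fls_nth (FL.ev (FL.psums pt_inf (insert 0 {1..N})) (HLM (s # \<nu>))) (- int j) =
        (if j \<le> ?d then ?c j else 0)"
      by (simp add: fls_nth_sum)
    moreover have "?c j = 0" if "\<not> j \<le> ?d"
      using star_homog_zero[OF homog_qs bd, of j w0] that by simp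
    ultimately show ?thesis by auto
  qed
  have l: "lead (FL.ev (FL.psums pt_inf (insert 0 {1..N})) (HLM (s # \<nu>))) s
    (Const_fract (1 - t_par ^ count_list (s # \<nu>) s) * FX.ev (FX.psums X_fract {1..N}) (HLM \<nu>))" for N
    by (rule lead_HLM[OF assms]) simp_all
  show "star w0 (qs j) (HLM (s # \<nu>)) = 0" if "s < j"
  proof (rule FX_ev_inj)
    fix N
    show "FX.ev (FX.psums X_fract {1..N}) (star w0 (qs j) (HLM (s # \<nu>))) = FX.ev (FX.psums X_fract {1..N}) 0"
      unfolding nth[symmetric] FX.ev_0 by (rule lead_nth(2)[OF l that])
  qed
  show "star w0 (qs s) (HLM (s # \<nu>)) = Const (1 - t_par ^ count_list (s # \<nu>) s) * HLM \<nu>"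
  proof (rule FX_ev_inj)
    fix N
    show "FX.ev (FX.psums X_fract {1..N}) (star w0 (qs s) (HLM (s # \<nu>))) =
        FX.ev (FX.psums X_fract {1..N}) (Const (1 - t_par ^ count_list (s # \<nu>) s) * HLM \<nu>)"
      unfolding nth[symmetric] FX.ev_mult FX.ev_Const by (rule lead_nth(1)[OF l])
  qed
qed

lemma HL_b_Cons:
  "HL_b (s # \<nu>) = (1 - t_par ^ count_list (s # \<nu>) s) * HL_b \<nu>"
proof -
  define c where "c \<mu> i = (\<Prod>j=1..count_list \<mu> i. 1 - t_par ^ j)" for \<mu> and i :: nat
  have b: "HL_b \<mu> = (\<Prod>i\<in>A. c \<mu> i)" if "finite A" "set \<mu> \<subseteq> A" for A \<mu>
    unfolding HL_b_def c_def using that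
    by (intro prod.mono_neutral_left) (auto simp: count_list_0_iff)
  let ?A = "insert s (set \<nu>)"
  have "c (s # \<nu>) i = (if i = s then 1 - t_par ^ count_list (s # \<nu>) s else 1) * c \<nu> i" for i
    by (simp add: c_def prod.cl_ivl_Suc)
  then have "HL_b (s # \<nu>) = (\<Prod>i\<in>?A. if i = s then 1 - t_par ^ count_list (s # \<nu>) s else 1) * (\<Prod>i\<in>?A. c \<nu> i)"
    unfolding prod.distrib[symmetric] by (subst b[of ?A]) (auto intro: prod.cong)
  also have "(\<Prod>i\<in>?A. c \<nu> i) = HL_b \<nu>" by (rule b[symmetric]) auto
  finally show ?thesis by simp
qed

lemma HL_b_nonzero: "HL_b \<mu> \<noteq> 0"
  using t_par_power by (auto simp: HL_b_def)

lemma HL_b_Nil [simp]: "HL_b [] = 1"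
  by (simp add: HL_b_def)

text \<open>Moved across the form, q_(r+m) annihilates \<open>HLM (s # \<nu>)\<close> as soon as r +
  m > s. Because s \<le> r, only m = 0 with r = s can survive.\<close>

lemma form_HLM_Cons:
  assumes "is_partition (s # \<nu>)" "s \<le> r"
  shows "form w0 (HLM (r # \<mu>)) (HLM (s # \<nu>)) =
    (if r = s then (1 - t_par ^ count_list (s # \<nu>) s) * form w0 (HLM \<mu>) (HLM \<nu>) else 0)"
proof -
  let ?g = "HLM (s # \<nu>)"
  have "form w0 (HLM (r # \<mu>)) ?g = (\<Sum>m\<le>sum_list \<mu>. form w0 (star (\<lambda>i. - w0 i) (qs m) (HLM \<mu>)) (star w0 (qs (r + m)) ?g))"
    by (simp add: form_sum_left form_star w0_nonzero)
  also have "\<dots> = (\<Sum>m\<in>{0}. form w0 (star (\<lambda>i. - w0 i) (qs m) (HLM \<mu>)) (star w0 (qs (r + m)) ?g))"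
    using assms by (intro sum.mono_neutral_right) (auto simp del: HLM.simps simp: star_qs_HLM(1)[OF assms(1)])
  also have "\<dots> = form w0 (HLM \<mu>) (star w0 (qs r) ?g)"
    by (simp add: star_1 w0_nonzero del: HLM.simps)
  also have "\<dots> = (if r = s then (1 - t_par ^ count_list (s # \<nu>) s) * form w0 (HLM \<mu>) (HLM \<nu>) else 0)"
    using assms star_qs_HLM[OF assms(1)] by (auto simp del: HLM.simps simp: form_scale_right)
  finally show ?thesis .
qed

lemma HLM_orthogonal:
  assumes "is_partition \<mu>" "is_partition \<nu>"
  shows "form w0 (HLM \<mu>) (HLM \<nu>) = (if \<mu> = \<nu> then HL_b \<mu> else 0)"
  using assms
proof (induction \<mu> arbitrary: \<nu>)
  case Nil
  show ?case
  proof (cases \<nu>)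
    case Nil
    then show ?thesis by (simp add: form_def lookup_one flip: one_poly_mapping_def)
  next
    case (Cons s \<nu>')
    then have "s \<ge> 1" using Nil.prems is_partition_Cons by blast
    then show ?thesis
      using form_homog_neq[OF homog_HLM homog_HLM, of "[]" \<nu> w0] by (simp add: Cons del: HLM.simps)
  qed
next
  case (Cons r \<mu>)
  show ?case
  proof (cases \<nu>)
    case Nil
    have "r \<ge> 1" using Cons.prems is_partition_Cons by blast
    then show ?thesis
      using form_homog_neq[OF homog_HLM homog_HLM, of "r # \<mu>" "[]" w0] by (simp add: Nil del: HLM.simps)
  next
    case \<nu>: (Cons s \<nu>')
    have p: "is_partition \<mu>" "is_partition \<nu>'" using Cons.prems \<nu> is_partition_Cons by blast+
    show ?thesis
    proof (cases "s \<le> r")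
      case True
      then show ?thesis
        using form_HLM_Cons[of s \<nu>' r \<mu>] Cons.prems Cons.IH[OF p] by (auto simp: \<nu> HL_b_Cons simp del: HLM.simps)
    next
      case False
      then show ?thesis
        using form_HLM_Cons[of r \<mu> s \<nu>'] Cons.prems by (subst form_sym) (auto simp: \<nu> simp del: HLM.simps)
    qed
  qed
qed

section \<open>Cauchy identity\<close>

definition parts_le :: "nat \<Rightarrow> nat list set" where
  "parts_le d = {\<mu>. is_partition \<mu> \<and> sum_list \<mu> \<le> d}"

lemma finite_parts_le [simp]: "finite (parts_le d)"
  unfolding parts_le_def by (rule finite_partitions_le)

lemma card_parts_le: "card (parts_le d) = card (exps d)"
proof -
  have "pmono ` parts_le d = exps d"
  proof (safe)
    fix \<mu> assume "\<mu> \<in> parts_le d"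
    then show "pmono \<mu> \<in> exps d" by (simp add: parts_le_def exps_def wt_pmono)
  next
    fix m assume "m \<in> exps d"
    moreover have "m \<in> pmono ` {\<mu>. is_partition \<mu>}" using pmono_bij by (simp add: bij_betw_def)
    ultimately show "m \<in> pmono ` parts_le d" by (auto simp: parts_le_def exps_def wt_pmono)
  qed
  moreover have "inj_on pmono (parts_le d)"
    using pmono_bij by (auto simp: bij_betw_def inj_on_def parts_le_def)
  ultimately show ?thesis by (metis card_image)
qed

interpretation mp: vector_space "\<lambda>c f. Const c * (f :: F mpoly)"
  by unfold_locales (simp_all add: distrib_left distrib_right Const_add Const_mult mult.assoc)

text \<open>Orthogonal vectors of nonzero norm are independent, and by \<open>card_parts_le\<close>
  there are as many of them as monomials of weight at most \<open>d\<close>. So they span, and the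
  coefficients follow by pairing.\<close>

lemma HLM_expand:
  assumes "bounded_wt d f"
  shows "f = (\<Sum>\<mu>\<in>parts_le d. Const (form w0 (HLM \<mu>) f / HL_b \<mu>) * HLM \<mu>)"
proof -
  let ?A = "(\<lambda>m. Poly_Mapping.single m (1::F)) ` exps d" and ?B = "HLM ` parts_le d"
  have sp: "g \<in> mp.span ?A" if "bounded_wt d g" for g
  proof -
    have "(\<Sum>m\<in>keys g. Const (lookup g m) * Poly_Mapping.single m 1) \<in> mp.span ?A"
      using that by (intro mp.span_sum mp.span_scale mp.span_base) (auto simp: bounded_wt_def)
    then show ?thesis by (simp add: Const_times_single flip: mpoly_sum_single)
  qed
  have orth: "form w0 (HLM \<mu>) (HLM \<nu>) = (if \<mu> = \<nu> then HL_b \<mu> else 0)" if "\<mu> \<in> parts_le d" "\<nu> \<in> parts_le d" for \<mu> \<nu>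
    using that by (intro HLM_orthogonal) (auto simp: parts_le_def)
  have inj: "inj_on HLM (parts_le d)"
    by (rule inj_onI) (metis orth HL_b_nonzero)
  have sum: "form w0 (HLM \<mu>) (\<Sum>v\<in>?B. Const (u v) * v) = u (HLM \<mu>) * HL_b \<mu>" if \<mu>: "\<mu> \<in> parts_le d" for u \<mu>
  proof -
    have "form w0 (HLM \<mu>) (\<Sum>v\<in>?B. Const (u v) * v) = (\<Sum>\<nu>\<in>parts_le d. u (HLM \<nu>) * (if \<mu> = \<nu> then HL_b \<mu> else 0))"
      by (simp add: sum.reindex[OF inj] form_sum_right form_scale_right orth[OF \<mu>])
    also have "\<dots> = (\<Sum>\<nu>\<in>parts_le d. if \<mu> = \<nu> then u (HLM \<mu>) * HL_b \<mu> else 0)"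
      by (intro sum.cong) auto
    finally show ?thesis using \<mu> by simp
  qed
  have indep: "mp.independent ?B"
  proof (rule mp.independent_if_scalars_zero)
    fix u v assume "(\<Sum>v\<in>?B. Const (u v) * v) = 0" "v \<in> ?B"
    then obtain \<mu> where "\<mu> \<in> parts_le d" "v = HLM \<mu>" by blast
    then show "u v = 0" using sum[of \<mu> u] \<open>(\<Sum>v\<in>?B. Const (u v) * v) = 0\<close> HL_b_nonzero[of \<mu>] by simp
  qed simp
  have BA: "?B \<subseteq> mp.span ?A"
  proof safe
    fix \<mu> assume "\<mu> \<in> parts_le d"
    then show "HLM \<mu> \<in> mp.span ?A"
      by (intro sp bounded_wt_mono[OF homog_imp_bounded[OF homog_HLM]]) (simp add: parts_le_def)
  qed
  have "inj_on (\<lambda>m. Poly_Mapping.single m (1::F)) (exps d)"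
    by (rule inj_onI) (metis lookup_single_eq lookup_single_not_eq zero_neq_one)
  then have "card ?A = card ?B" by (simp add: card_image inj card_parts_le)
  have "f \<in> mp.span ?B"
  proof (rule ccontr)
    assume f: "f \<notin> mp.span ?B"
    then have "mp.independent (insert f ?B)" using indep by (rule mp.independent_insertI)
    moreover have "insert f ?B \<subseteq> mp.span ?A" using BA sp[OF assms] by blast
    ultimately have "card (insert f ?B) \<le> card ?A"
      using mp.independent_span_bound[of ?A "insert f ?B"] by simp
    moreover have "f \<notin> ?B" using f mp.span_base by blast
    ultimately show False using \<open>card ?A = card ?B\<close> by simp
  qed
  then obtain u where u: "f = (\<Sum>v\<in>?B. Const (u v) * v)"
    by (auto simp: mp.span_finite)
  also have "\<dots> = (\<Sum>\<mu>\<in>parts_le d. Const (u (HLM \<mu>)) * HLM \<mu>)"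
    by (simp add: sum.reindex[OF inj])
  also have "\<dots> = (\<Sum>\<mu>\<in>parts_le d. Const (form w0 (HLM \<mu>) f / HL_b \<mu>) * HLM \<mu>)"
    using sum[of _ u] by (intro sum.cong refl) (simp add: HL_b_nonzero flip: u)
  finally show ?thesis .
qed

text \<open>Taylor's formula, rewritten from the monomial basis to the Hall-Littlewood basis.\<close>

lemma (in F_hom) cauchy:
  assumes "bounded_wt d f" "\<And>i. c i \<noteq> 0"
  shows "ev (\<lambda>i. a i + \<iota> (c i) * b i) f =
    (\<Sum>\<mu>\<in>parts_le d. \<iota> (1 / HL_b \<mu>) * ev b (HLM \<mu>) * ev a (star (\<lambda>i. c i * w0 i) (HLM \<mu>) f))"
proof -
  let ?s = "\<lambda>h. ev a (star (\<lambda>i. c i * w0 i) h f)"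
  have single: "?s (Poly_Mapping.single m 1) = (\<Sum>\<mu>\<in>parts_le d. \<iota> (lookup (HLM \<mu>) m * nrm w0 m / HL_b \<mu>) * ?s (HLM \<mu>))"
    if "m \<in> exps d" for m
  proof -
    have "form w0 (HLM \<mu>) (Poly_Mapping.single m 1) = lookup (HLM \<mu>) m * nrm w0 m" for \<mu>
      by (subst form_sym) (simp add: form_single_left)
    then have "Poly_Mapping.single m 1 = (\<Sum>\<mu>\<in>parts_le d. Const (lookup (HLM \<mu>) m * nrm w0 m / HL_b \<mu>) * HLM \<mu>)"
      using HLM_expand[of d "Poly_Mapping.single m 1"] that by (simp add: bounded_wt_def)
    then show ?thesis by (simp add: star_sum_left star_scale_left ev_sum ev_mult)
  qed
  have "ev (\<lambda>i. a i + \<iota> (c i) * b i) f = (\<Sum>m\<in>exps d. \<iota> (1 / nrm w0 m) * pwr b m * ?s (Poly_Mapping.single m 1))"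
    by (rule taylor[OF assms(1) w0_nonzero assms(2)])
  also have "\<dots> = (\<Sum>m\<in>exps d. \<Sum>\<mu>\<in>parts_le d. \<iota> (1 / HL_b \<mu>) * (\<iota> (lookup (HLM \<mu>) m) * pwr b m) * ?s (HLM \<mu>))"
  proof (rule sum.cong[OF refl])
    fix m assume m: "m \<in> exps d"
    have "\<iota> (1 / nrm w0 m) * \<iota> (x * nrm w0 m / y) = \<iota> (1 / y) * \<iota> x" for x y
      using nrm_nonzero[of w0 m, OF w0_nonzero] by (simp flip: hom_mult add: field_simps)
    note AC = this
    show "\<iota> (1 / nrm w0 m) * pwr b m * ?s (Poly_Mapping.single m 1) =
        (\<Sum>\<mu>\<in>parts_le d. \<iota> (1 / HL_b \<mu>) * (\<iota> (lookup (HLM \<mu>) m) * pwr b m) * ?s (HLM \<mu>))"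
      unfolding single[OF m] sum_distrib_left
    proof (intro sum.cong refl)
      fix \<mu>
      let ?C = "\<iota> (lookup (HLM \<mu>) m * nrm w0 m / HL_b \<mu>)"
      have "\<iota> (1 / nrm w0 m) * pwr b m * (?C * ?s (HLM \<mu>)) = (\<iota> (1 / nrm w0 m) * ?C) * (pwr b m * ?s (HLM \<mu>))"
        by (simp only: mult_ac)
      also have "\<dots> = \<iota> (1 / HL_b \<mu>) * (\<iota> (lookup (HLM \<mu>) m) * pwr b m) * ?s (HLM \<mu>)"
        unfolding AC by (simp only: mult_ac)
      finally show "\<iota> (1 / nrm w0 m) * pwr b m * (?C * ?s (HLM \<mu>)) =
          \<iota> (1 / HL_b \<mu>) * (\<iota> (lookup (HLM \<mu>) m) * pwr b m) * ?s (HLM \<mu>)" .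
    qed
  qed
  also have "\<dots> = (\<Sum>\<mu>\<in>parts_le d. \<iota> (1 / HL_b \<mu>) * (\<Sum>m\<in>exps d. \<iota> (lookup (HLM \<mu>) m) * pwr b m) * ?s (HLM \<mu>))"
    by (subst sum.swap) (simp add: sum_distrib_left sum_distrib_right)
  also have "\<dots> = (\<Sum>\<mu>\<in>parts_le d. \<iota> (1 / HL_b \<mu>) * ev b (HLM \<mu>) * ?s (HLM \<mu>))"
  proof (rule sum.cong[OF refl])
    fix \<mu> assume "\<mu> \<in> parts_le d"
    then have "bounded_wt d (HLM \<mu>)"
      by (intro bounded_wt_mono[OF homog_imp_bounded[OF homog_HLM]]) (simp add: parts_le_def)
    then have "ev b (HLM \<mu>) = (\<Sum>m\<in>exps d. \<iota> (lookup (HLM \<mu>) m) * pwr b m)"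
      by (intro ev_superset) (simp_all add: bounded_wt_def)
    then show "\<iota> (1 / HL_b \<mu>) * (\<Sum>m\<in>exps d. \<iota> (lookup (HLM \<mu>) m) * pwr b m) * ?s (HLM \<mu>) =
        \<iota> (1 / HL_b \<mu>) * ev b (HLM \<mu>) * ?s (HLM \<mu>)" by simp
  qed
  finally show ?thesis .
qed

section \<open>The Macdonald form and the adjoint operators\<close>

definition cq :: "nat \<Rightarrow> F" where "cq i = 1 - q_par ^ Suc i"

abbreviation wq :: "nat \<Rightarrow> F" where "wq \<equiv> \<lambda>i. cq i * w0 i"

lemma cq_nonzero: "cq i \<noteq> 0"
  using q_par_power[of "Suc i"] by (simp add: cq_def del: power_Suc)

lemma wq_nonzero: "wq i \<noteq> 0"
  by (simp add: cq_nonzero w0_nonzero)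

lemma vector_space_mult: "vector_space ((*) :: 'a::field \<Rightarrow> 'a \<Rightarrow> 'a)"
  by unfold_locales (simp_all add: algebra_simps)

lemma prod_part: "(\<Prod>i=1..length \<mu>. g (part \<mu> i)) = (\<Prod>n\<leftarrow>\<mu>. g n)"
proof -
  have "(\<Prod>i=1..length \<mu>. g (part \<mu> i)) = (\<Prod>i<length \<mu>. g (part \<mu> (Suc i)))"
    by (rule prod.reindex_bij_witness[of _ Suc "\<lambda>i. i - 1"]) auto
  also have "\<dots> = (\<Prod>i<length \<mu>. map g \<mu> ! i)"
    by (intro prod.cong) (auto simp: part_def)
  also have "\<dots> = (\<Prod>n\<leftarrow>\<mu>. g n)"
    by (simp add: prod.list_conv_set_nth atLeast0LessThan)
  finally show ?thesis .
qed

lemma nrm_pmono: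
  assumes "0 \<notin> set \<mu>"
  shows "nrm wq (pmono \<mu>) = of_nat (z_number \<mu>) *
    (\<Prod>i=1..length \<mu>. (1 - q_par ^ part \<mu> i) / (1 - t_par ^ part \<mu> i))"
proof -
  let ?g = "\<lambda>n. (1 - q_par ^ n) / (1 - t_par ^ n)"
  have lk: "lookup (pmono \<mu>) i = count_list \<mu> (Suc i)" for i
    using assms by (simp add: pmono_def lookup_mono count_mset)
  have keys: "keys (pmono \<mu>) = (\<lambda>n. n - 1) ` set \<mu>"
  proof (rule set_eqI)
    fix i
    have "i \<in> keys (pmono \<mu>) \<longleftrightarrow> Suc i \<in> set \<mu>"
      by (simp add: in_keys_iff lk count_list_0_iff)
    also have "\<dots> \<longleftrightarrow> i \<in> (\<lambda>n. n - 1) ` set \<mu>"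
    proof
      assume "Suc i \<in> set \<mu>"
      then show "i \<in> (\<lambda>n. n - 1) ` set \<mu>" by (rule rev_image_eqI) simp
    next
      assume "i \<in> (\<lambda>n. n - 1) ` set \<mu>"
      then obtain n where n: "n \<in> set \<mu>" "i = n - 1" by blast
      moreover have "n \<noteq> 0" using n assms by metis
      ultimately show "Suc i \<in> set \<mu>" by simp
    qed
    finally show "i \<in> keys (pmono \<mu>) \<longleftrightarrow> i \<in> (\<lambda>n. n - 1) ` set \<mu>" .
  qed
  have inj: "inj_on (\<lambda>n. n - 1) (set \<mu>)"
  proof (rule inj_onI)
    fix m n assume "m \<in> set \<mu>" "n \<in> set \<mu>" "m - 1 = n - 1"
    moreover from this have "m \<noteq> 0" "n \<noteq> 0" using assms by metis+
    ultimately show "m = n" by simp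
  qed
  have "nrm wq (pmono \<mu>) = (\<Prod>n\<in>set \<mu>. fact (count_list \<mu> n) * (of_nat n * ?g n) ^ count_list \<mu> n)"
  proof -
    have "nrm wq (pmono \<mu>) = (\<Prod>n\<in>set \<mu>. fact (count_list \<mu> (Suc (n - 1))) * wq (n - 1) ^ count_list \<mu> (Suc (n - 1)))"
      by (simp only: nrm_def keys prod.reindex[OF inj] o_def lk)
    also have "\<dots> = (\<Prod>n\<in>set \<mu>. fact (count_list \<mu> n) * (of_nat n * ?g n) ^ count_list \<mu> n)"
    proof (rule prod.cong[OF refl])
      fix n assume "n \<in> set \<mu>"
      then have n: "Suc (n - 1) = n" using assms by (metis Suc_pred' gr0I)
      have "wq (n - 1) = of_nat (Suc (n - 1)) * ?g (Suc (n - 1))"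
        by (simp add: cq_def w0_def)
      then show "fact (count_list \<mu> (Suc (n - 1))) * wq (n - 1) ^ count_list \<mu> (Suc (n - 1)) =
          fact (count_list \<mu> n) * (of_nat n * ?g n) ^ count_list \<mu> n"
        unfolding n by simp
    qed
    finally show ?thesis .
  qed
  also have "\<dots> = (\<Prod>n\<in>set \<mu>. of_nat (n ^ count_list \<mu> n * fact (count_list \<mu> n)) * ?g n ^ count_list \<mu> n)"
    by (intro prod.cong refl) (simp only: power_mult_distrib of_nat_mult of_nat_power of_nat_fact mult_ac)
  also have "\<dots> = of_nat (z_number \<mu>) * (\<Prod>n\<in>set \<mu>. ?g n ^ count_list \<mu> n)"
    by (simp add: prod.distrib z_number_def)
  also have "(\<Prod>n\<in>set \<mu>. ?g n ^ count_list \<mu> n) = (\<Prod>n\<leftarrow>\<mu>. ?g n)"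
    using image_prod_mset_multiplicity[of ?g "mset \<mu>"] by (simp add: count_mset flip: prod_mset_prod_list)
  also have "\<dots> = (\<Prod>i=1..length \<mu>. ?g (part \<mu> i))"
    by (rule prod_part[symmetric])
  finally show ?thesis .
qed

definition to_psums :: "F symf \<Rightarrow> F mpoly" where
  "to_psums f = (SOME g. f = of_psums g)"

lemma of_to_psums [simp]: "of_psums (to_psums f) = f"
  unfolding to_psums_def using someI_ex[OF of_psums_surj[of f]] by simp

lemma to_of_psums [simp]: "to_psums (of_psums g) = g"
  by (rule of_psums_inj) simp

lemma of_psums_add: "of_psums (f + g) = of_psums f + of_psums g"
  and of_psums_mult: "of_psums (f * g) = of_psums f * of_psums g"
  and of_psums_0 [simp]: "of_psums 0 = 0"
  and of_psums_1 [simp]: "of_psums 1 = 1"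
  using hom_of_psums by (simp_all add: hom_of_rings.hom_add hom_of_rings.hom_mult
      hom_of_rings.hom_0 hom_of_rings.hom_1)

lemma to_psums_add: "to_psums (f + g) = to_psums f + to_psums g"
  by (rule of_psums_inj) (simp add: of_psums_add)

lemma to_psums_scale: "to_psums (c \<cdot> f) = Const c * to_psums f"
  by (rule of_psums_inj) (simp add: of_psums_scale)

lemma power_sum_list_eq: "is_partition \<mu> \<Longrightarrow> power_sum_list \<mu> = of_psums (Poly_Mapping.single (pmono \<mu>) 1)"
  by (simp add: of_psums_pmono is_partition_def)

lemma pmono_inj: "is_partition \<mu> \<Longrightarrow> is_partition \<nu> \<Longrightarrow> pmono \<mu> = pmono \<nu> \<longleftrightarrow> \<mu> = \<nu>"
  using pmono_bij by (auto simp: bij_betw_def inj_on_def)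

lemma is_macdonald_form_form: "is_macdonald_form (\<lambda>f g. form wq (to_psums f) (to_psums g))"
  unfolding is_macdonald_form_def
proof (intro conjI allI impI)
  fix f :: "F symf"
  show "Vector_Spaces.linear scale (*) (\<lambda>g. form wq (to_psums f) (to_psums g))"
    "Vector_Spaces.linear scale (*) (\<lambda>g. form wq (to_psums g) (to_psums f))"
    by (simp_all add: Vector_Spaces.linear_iff vector_space_scale vector_space_mult to_psums_add
        to_psums_scale form_add_left form_add_right form_scale_left form_scale_right)
next
  fix \<mu> \<nu> assume "is_partition \<mu>" "is_partition \<nu>"
  then show "form wq (to_psums (power_sum_list \<mu>)) (to_psums (power_sum_list \<nu>)) =
      (if \<mu> = \<nu> then of_nat (z_number \<mu>) * (\<Prod>i=1..length \<mu>. (1 - q_par ^ part \<mu> i) / (1 - t_par ^ part \<mu> i)) else 0)"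
    using nrm_pmono[of \<mu>] pmono_inj[of \<mu> \<nu>]
    by (auto simp: power_sum_list_eq form_single_left lookup_single when_def is_partition_def)
qed

text \<open>The defining description of \<open>macdonald_form\<close> requires uniqueness. Products
  of power sums span, so two bilinear forms agreeing on them coincide.\<close>

lemma macdonald_form_unique:
  assumes "is_macdonald_form B" "is_macdonald_form B'"
  shows "B = B'"
proof -
  have lin: "B f (g + g') = B f g + B f g'" "B (g + g') f = B g f + B g' f"
    "B f (c \<cdot> g) = c * B f g" "B (c \<cdot> g) f = c * B g f"
    if "is_macdonald_form B" for B and f g g' f' :: "F symf" and c
    using that by (simp_all add: is_macdonald_form_def Vector_Spaces.linear_iff)
  have zero: "B f 0 = 0" "B 0 f = 0" if "is_macdonald_form B" for B and f :: "F symf"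
    using lin(1)[OF that, of f 0 0] lin(2)[OF that, of 0 0 f] by simp_all
  have basis: "Poly_Mapping.single m c = Const c * Poly_Mapping.single (pmono \<mu>) 1"
    if "pmono \<mu> = m" for m \<mu> and c :: F using that by (simp add: Const_times_single)
  have ex: "\<exists>\<mu>. is_partition \<mu> \<and> pmono \<mu> = m" for m
  proof -
    have "m \<in> pmono ` {\<mu>. is_partition \<mu>}" using pmono_bij by (simp add: bij_betw_def)
    then show ?thesis by blast
  qed
  have "B (of_psums f) (of_psums g) = B' (of_psums f) (of_psums g)" for f g
  proof (induction f rule: mpoly_linear_induct)
    case (single m c)
    obtain \<mu> where \<mu>: "is_partition \<mu>" "pmono \<mu> = m" using ex by blast
    show ?case
    proof (induction g rule: mpoly_linear_induct)
      case (single n d)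
      obtain \<nu> where \<nu>: "is_partition \<nu>" "pmono \<nu> = n" using ex by blast
      have "B (power_sum_list \<mu>) (power_sum_list \<nu>) = B' (power_sum_list \<mu>) (power_sum_list \<nu>)"
        using assms \<mu> \<nu> by (simp add: is_macdonald_form_def)
      then show ?case
        unfolding basis[OF \<mu>(2)] basis[OF \<nu>(2)] of_psums_scale power_sum_list_eq[OF \<mu>(1), symmetric]
          power_sum_list_eq[OF \<nu>(1), symmetric]
        by (simp add: lin assms)
    qed (simp_all add: of_psums_add lin zero assms)
  qed (simp_all add: of_psums_add lin zero assms)
  from this[of "to_psums f" "to_psums g" for f g] show ?thesis by (simp add: fun_eq_iff)
qed

lemma macdonald_form_eq: "macdonald_form = (\<lambda>f g. form wq (to_psums f) (to_psums g))"
  unfolding macdonald_form_def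
  by (intro the_equality macdonald_form_unique is_macdonald_form_form)

text \<open>\<open>form_star\<close> gives existence; nondegeneracy of the form, whose weights are
  nonzero, gives uniqueness.\<close>

lemma adj_eq: "adj (of_psums f) = (\<lambda>h. of_psums (star wq f (to_psums h)))"
  unfolding adj_def
proof (rule the_equality)
  show "\<forall>g h. macdonald_form (of_psums f * g) h = macdonald_form g (of_psums (star wq f (to_psums h)))"
  proof (intro allI)
    fix g h
    have "of_psums f * g = of_psums (f * to_psums g)" by (simp add: of_psums_mult)
    then show "macdonald_form (of_psums f * g) h = macdonald_form g (of_psums (star wq f (to_psums h)))"
      by (simp add: macdonald_form_eq form_star[of wq, OF wq_nonzero])
  qed
next
  fix S assume S: "\<forall>g h. macdonald_form (of_psums f * g) h = macdonald_form g (S h)"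
  show "S = (\<lambda>h. of_psums (star wq f (to_psums h)))"
  proof
    fix h
    have "to_psums (S h) = star wq f (to_psums h)"
    proof (rule form_nondegenerate[of wq, OF wq_nonzero])
      fix g
      have "form wq g (to_psums (S h)) = macdonald_form (of_psums g) (S h)"
        by (simp add: macdonald_form_eq)
      also have "\<dots> = macdonald_form (of_psums (f * g)) h"
        using S by (simp add: of_psums_mult)
      also have "\<dots> = form wq g (star wq f (to_psums h))"
        by (simp add: macdonald_form_eq form_star[of wq, OF wq_nonzero])
      finally show "form wq g (to_psums (S h)) = form wq g (star wq f (to_psums h))" .
    qed
    then show "S h = of_psums (star wq f (to_psums h))" by (metis of_to_psums)
  qed
qed

section \<open>Hall-Littlewood functions as symmetrized products\<close>

lemma the_poly_to_fract: "the_poly (to_fract p) = p"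
  unfolding the_poly_def by (rule the_equality) (simp_all add: to_fract_def eq_fract)

context F_field_hom
begin

text \<open>One term of the symmetrization. The permutation is written as the list of its values, so
  that deleting the first entry matches the removal of a point in the branching rule.\<close>

fun sprod :: "(nat \<Rightarrow> 'b) \<Rightarrow> nat list \<Rightarrow> (nat \<Rightarrow> nat) \<Rightarrow> 'b" where
  "sprod a [] \<alpha> = 1"
| "sprod a (x # xs) \<alpha> = a x ^ \<alpha> 0 * cross a {x} (set xs) * sprod a xs (\<lambda>i. \<alpha> (Suc i))"

lemma sprod_eq:
  assumes "distinct xs"
  shows "sprod a xs \<alpha> = (\<Prod>i<length xs. a (xs ! i) ^ \<alpha> i) *
    (\<Prod>i<length xs. \<Prod>j=Suc i..<length xs. (a (xs ! i) - tt * a (xs ! j)) / (a (xs ! i) - a (xs ! j)))"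
  using assms
proof (induction xs arbitrary: \<alpha>)
  case (Cons x xs)
  let ?r = "\<lambda>x y. (a x - tt * a y) / (a x - a y)"
  have "cross a {x} (set xs) = (\<Prod>j<length xs. ?r x (xs ! j))"
    using prod.reindex_bij_betw[OF bij_betw_nth[of xs "{..<length xs}" "set xs"], of "?r x"] Cons.prems
    by (simp add: cross_def)
  also have "\<dots> = (\<Prod>j=Suc 0..<Suc (length xs). ?r x ((x # xs) ! j))"
    unfolding prod.shift_bounds_Suc_ivl by (simp add: atLeast0LessThan)
  finally have "cross a {x} (set xs) = (\<Prod>j=Suc 0..<Suc (length xs). ?r x ((x # xs) ! j))" .
  moreover have "(\<Prod>j=Suc (Suc i)..<Suc (length xs). ?r (xs ! i) ((x # xs) ! j)) = (\<Prod>j=Suc i..<length xs. ?r (xs ! i) (xs ! j))" for i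
    unfolding prod.shift_bounds_Suc_ivl by simp
  ultimately show ?case
    using Cons by (simp add: prod.lessThan_Suc_shift del: prod.op_ivl_Suc prod.lessThan_Suc)
qed simp

definition symsum :: "(nat \<Rightarrow> 'b) \<Rightarrow> nat set \<Rightarrow> (nat \<Rightarrow> nat) \<Rightarrow> 'b" where
  "symsum a I \<alpha> = (\<Sum>xs\<in>permutations_of_set I. sprod a xs \<alpha>)"

lemma symsum_empty [simp]: "symsum a {} \<alpha> = 1"
  by (simp add: symsum_def)

lemma symsum_rec:
  assumes "finite I" "I \<noteq> {}"
  shows "symsum a I \<alpha> = (\<Sum>i\<in>I. a i ^ \<alpha> 0 * cross a {i} (I - {i}) * symsum a (I - {i}) (\<lambda>i. \<alpha> (Suc i)))"
proof -
  have "symsum a I \<alpha> = (\<Sum>i\<in>I. \<Sum>xs\<in>(#) i ` permutations_of_set (I - {i}). sprod a xs \<alpha>)"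
    unfolding symsum_def permutations_of_set_nonempty[OF assms(2)]
    by (rule sum.UNION_disjoint) (use assms in auto)
  also have "\<dots> = (\<Sum>i\<in>I. \<Sum>xs\<in>permutations_of_set (I - {i}). sprod a (i # xs) \<alpha>)"
    by (simp add: sum.reindex)
  also have "\<dots> = (\<Sum>i\<in>I. a i ^ \<alpha> 0 * cross a {i} (I - {i}) * symsum a (I - {i}) (\<lambda>i. \<alpha> (Suc i)))"
    by (simp add: symsum_def sum_distrib_left permutations_of_setD cong: sum.cong)
  finally show ?thesis .
qed

lemma hom_nonzero: "x \<noteq> 0 \<Longrightarrow> \<iota> x \<noteq> 0"
  using hom_mult[of x "inverse x"] by auto

lemma hom_inverse: "\<iota> (inverse x) = inverse (\<iota> x)"
proof (cases "x = 0")
  case False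
  then have "\<iota> x * \<iota> (inverse x) = 1" by (simp flip: hom_mult)
  then show ?thesis by (simp add: inverse_unique)
qed simp

lemma hom_divide: "\<iota> (x / y) = \<iota> x / \<iota> y"
  by (simp add: divide_inverse hom_mult hom_inverse)

lemma tt_neq_1: "1 - tt \<noteq> 0"
  using hom_nonzero[of "1 - t_par"] t_par_power[of 1] by (simp add: hom_diff)

text \<open>Sorting by the first variable, \<open>lagrange_sum\<close> contributes one factor (1 -
  t^n)/(1 - t) for each size n of the set.\<close>

lemma symsum_0:
  assumes "finite I" "inj_on a I" "\<And>i. i \<in> I \<Longrightarrow> a i \<noteq> 0"
  shows "symsum a I (\<lambda>_. 0) = (\<Prod>j=1..card I. (1 - tt ^ j) / (1 - tt))"
  using assms
proof (induction "card I" arbitrary: I)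
  case 0
  then show ?case by simp
next
  case (Suc n)
  then have I: "I \<noteq> {}" by auto
  have IH: "symsum a (I - {i}) (\<lambda>_. 0) = (\<Prod>j=1..n. (1 - tt ^ j) / (1 - tt))" if "i \<in> I" for i
  proof -
    have n: "n = card (I - {i})" using Suc.hyps(2) Suc.prems(1) that by simp
    show ?thesis using Suc.hyps(1)[OF n] Suc.prems by (simp add: inj_on_diff flip: n)
  qed
  have "symsum a I (\<lambda>_. 0) = (\<Sum>i\<in>I. cross a {i} (I - {i})) * (\<Prod>j=1..n. (1 - tt ^ j) / (1 - tt))"
    by (simp add: symsum_rec[OF Suc.prems(1) I] IH sum_distrib_right)
  also have "(\<Sum>i\<in>I. cross a {i} (I - {i})) = (1 - tt ^ Suc n) / (1 - tt)"
    using lagrange_sum[OF Suc.prems] tt_neq_1 Suc.hyps(2) by (simp add: field_simps)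
  finally show ?case by (simp flip: Suc.hyps(2) add: prod.cl_ivl_Suc)
qed

text \<open>Both sides obey the same recursion, the left by splitting off the first variable and the
  right by branching. Once the parts are used up, the other variables have exponent 0 and
  \<open>symsum_0\<close> supplies the remaining product.\<close>

lemma symsum_HLM:
  assumes "is_partition \<mu>" "finite I" "inj_on a I" "\<And>i. i \<in> I \<Longrightarrow> a i \<noteq> 0" "length \<mu> \<le> card I"
  shows "(1 - tt) ^ length \<mu> * symsum a I (\<lambda>i. part \<mu> (Suc i)) =
    ev (psums a I) (HLM \<mu>) * (\<Prod>j=1..card I - length \<mu>. (1 - tt ^ j) / (1 - tt))"
  using assms
proof (induction \<mu> arbitrary: I)
  case Nil
  then show ?case using symsum_0[of I a] by (simp add: part_def)
next
  case (Cons r \<mu>)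
  have I: "I \<noteq> {}" using Cons.prems(5) by auto
  have r: "r \<ge> 1" "is_partition \<mu>" using Cons.prems(1) is_partition_Cons by blast+
  have pt: "part (r # \<mu>) (Suc 0) = r" "part (r # \<mu>) (Suc (Suc i)) = part \<mu> (Suc i)" for i
    by (auto simp: part_def)
  let ?V = "\<Prod>j=1..card I - length (r # \<mu>). (1 - tt ^ j) / (1 - tt)"
  have IH: "(1 - tt) ^ length \<mu> * symsum a (I - {i}) (\<lambda>i. part \<mu> (Suc i)) = ev (psums a (I - {i})) (HLM \<mu>) * ?V"
    if "i \<in> I" for i
  proof -
    have "card (I - {i}) = card I - 1" using that Cons.prems(2) by simp
    moreover have "card I > 0" using I Cons.prems(2) by (simp add: card_gt_0_iff)
    ultimately show ?thesis
      using Cons.IH[of "I - {i}"] Cons.prems that r by (simp add: inj_on_diff)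
  qed
  have "(1 - tt) ^ length (r # \<mu>) * symsum a I (\<lambda>i. part (r # \<mu>) (Suc i)) =
     (1 - tt) * (\<Sum>i\<in>I. a i ^ r * cross a {i} (I - {i}) * ((1 - tt) ^ length \<mu> * symsum a (I - {i}) (\<lambda>i. part \<mu> (Suc i))))"
    unfolding symsum_rec[OF Cons.prems(2) I] pt by (simp add: sum_distrib_left mult_ac)
  also have "\<dots> = (1 - tt) * (\<Sum>i\<in>I. a i ^ r * cross a {i} (I - {i}) * (ev (psums a (I - {i})) (HLM \<mu>) * ?V))"
    by (simp only: IH cong: sum.cong)
  also have "\<dots> = ev (psums a I) (HLM (r # \<mu>)) * ?V"
    using Cons.prems r by (subst ev_HLM) (simp_all add: sum_distrib_left sum_distrib_right mult_ac)
  finally show ?case .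
qed

end

text \<open>Links the sum over permutations in the definition of \<open>HL_poly\<close> with the
  recursion on lists.\<close>

lemma sum_permutes_lists:
  "(\<Sum>w | w permutes {1..N}. g (map w [1..<Suc N])) = (\<Sum>xs\<in>permutations_of_set {1..N}. g xs)"
proof (rule sum.reindex_bij_betw)
  let ?P = "{w. w permutes {1..N}}" and ?f = "\<lambda>w. map w [1..<Suc N]"
  have inj: "inj_on ?f ?P"
  proof (rule inj_onI)
    fix v w assume "v \<in> ?P" "w \<in> ?P" and eq: "?f v = ?f w"
    show "v = w"
    proof
      fix i
      show "v i = w i"
      proof (cases "i \<in> {1..N}")
        case True
        then have "i \<in> set [1..<Suc N]" by auto
        then show ?thesis using eq by (simp only: map_eq_conv)
      next
        case False
        then show ?thesis using \<open>v \<in> ?P\<close> \<open>w \<in> ?P\<close> by (simp add: permutes_def)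
      qed
    qed
  qed
  moreover have "?f ` ?P \<subseteq> permutations_of_set {1..N}"
  proof safe
    fix w assume w: "w permutes {1..N}"
    have "set (?f w) = w ` {1..N}" by (simp only: set_map set_upt atLeastLessThanSuc_atLeastAtMost)
    moreover have "distinct (?f w)" using permutes_inj[OF w] by (simp only: distinct_map) (simp add: inj_on_subset)
    ultimately show "?f w \<in> permutations_of_set {1..N}"
      using permutes_image[OF w] by (intro permutations_of_setI) simp_all
  qed
  moreover have "card ?P = card (permutations_of_set {1..N})"
    by (simp add: card_permutations[of _ N])
  ultimately show "bij_betw ?f ?P (permutations_of_set {1..N})"
    unfolding bij_betw_def by (metis card_image card_subset_eq finite_permutations_of_set)
qed

text \<open>The normalization v splits into the factor \<open>V\<close> of the N - \<ell>(\<mu>)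
  zero parts, which \<open>symsum_HLM\<close> also produces, and b_\<mu> / (1 - t)^\<ell>(\<mu>)
  from the nonzero parts; what is left is 1/b_\<mu>. Since the sum of fractions is thereby the image
  of a polynomial, \<open>the_poly\<close> returns it.\<close>

lemma HL_poly_eq:
  assumes "is_partition \<mu>" "length \<mu> \<le> N"
  shows "HL_poly N \<mu> = proj N (of_psums (Const (1 / HL_b \<mu>) * HLM \<mu>))"
proof -
  define V where "V = (\<Prod>j=1..N - length \<mu>. (1 - t_par ^ j) / (1 - t_par))"
  define S where "S = (\<Sum>w | w permutes {1..N}.
        (\<Prod>i=1..N. Fract (X (w i) ^ part \<mu> i) 1) *
        (\<Prod>i=1..N. \<Prod>j=i+1..N. Fract (X (w i) - Const t_par * X (w j)) (X (w i) - X (w j) :: F mpoly)))"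
  have t1: "1 - t_par \<noteq> 0" using t_par_power[of 1] by simp
  have trm: "(\<Prod>i=1..N. Fract (X (w i) ^ part \<mu> i) 1) *
        (\<Prod>i=1..N. \<Prod>j=i+1..N. Fract (X (w i) - Const t_par * X (w j)) (X (w i) - X (w j) :: F mpoly)) =
        FX.sprod X_fract (map w [1..<Suc N]) (\<lambda>i. part \<mu> (Suc i))" if w: "w permutes {1..N}" for w
  proof -
    let ?xs = "map w [1..<Suc N]"
    have dist: "distinct ?xs" using permutes_inj[OF w] by (simp only: distinct_map) (simp add: inj_on_subset)
    have nth: "?xs ! i = w (Suc i)" if "i < N" for i using that by (simp add: nth_upt del: upt_Suc)
    have "Fract (X (w i) - Const t_par * X (w j)) (X (w i) - X (w j) :: F mpoly) =
        (X_fract (w i) - FX.tt * X_fract (w j)) / (X_fract (w i) - X_fract (w j))" if "i \<noteq> j" for i j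
    proof -
      have "w i \<noteq> w j" using that permutes_inj[OF w] by (auto dest: injD)
      then show ?thesis
        by (subst Fract_eq_divide)
           (simp_all add: hom_of_rings.hom_diff[OF hom_to_fract] hom_of_rings.hom_mult[OF hom_to_fract] Const_fract_def)
    qed
    then have "(\<Prod>i=1..N. \<Prod>j=i+1..N. Fract (X (w i) - Const t_par * X (w j)) (X (w i) - X (w j) :: F mpoly)) =
        (\<Prod>i=1..N. \<Prod>j=i+1..N. (X_fract (w i) - FX.tt * X_fract (w j)) / (X_fract (w i) - X_fract (w j)))"
      by (intro prod.cong refl) auto
    also have "\<dots> = (\<Prod>i<N. \<Prod>j=Suc i+1..N. (X_fract (w (Suc i)) - FX.tt * X_fract (w j)) / (X_fract (w (Suc i)) - X_fract (w j)))"
      by (rule prod.reindex_bij_witness[of _ Suc "\<lambda>i. i - 1"]) auto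
    also have "\<dots> = (\<Prod>i<N. \<Prod>j=Suc i..<N. (X_fract (w (Suc i)) - FX.tt * X_fract (w (Suc j))) / (X_fract (w (Suc i)) - X_fract (w (Suc j))))"
      by (rule prod.cong[OF refl], rule prod.reindex_bij_witness[of _ Suc "\<lambda>i. i - 1"]) auto
    moreover have "(\<Prod>i=1..N. Fract (X (w i) ^ part \<mu> i :: F mpoly) 1) = (\<Prod>i<N. X_fract (w (Suc i)) ^ part \<mu> (Suc i))"
    proof -
      have "Fract (X (w i) ^ k :: F mpoly) 1 = X_fract (w i) ^ k" for i k
        using hom_of_rings.hom_power[OF hom_to_fract, of "X (w i)" k] by (simp add: to_fract_def)
      then show ?thesis
        by (simp only:) (rule prod.reindex_bij_witness[of _ Suc "\<lambda>i. i - 1"], auto)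
    qed
    ultimately show ?thesis
      unfolding FX.sprod_eq[OF dist] by (simp add: nth del: upt_Suc)
  qed
  have "S = FX.symsum X_fract {1..N} (\<lambda>i. part \<mu> (Suc i))"
    unfolding S_def FX.symsum_def sum_permutes_lists[symmetric] by (intro sum.cong refl trm) simp
  then have "(1 - FX.tt) ^ length \<mu> * S = FX.ev (FX.psums X_fract {1..N}) (HLM \<mu>) * (\<Prod>j=1..N - length \<mu>. (1 - FX.tt ^ j) / (1 - FX.tt))"
    using FX.symsum_HLM[OF assms(1), of "{1..N}" X_fract] assms(2) by (simp add: inj_on_def)
  also have "(\<Prod>j=1..N - length \<mu>. (1 - FX.tt ^ j) / (1 - FX.tt)) = Const_fract V"
    by (simp add: V_def FX.hom_prod FX.hom_divide FX.hom_diff FX.hom_power)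
  finally have "S = FX.ev (FX.psums X_fract {1..N}) (HLM \<mu>) * Const_fract (V / (1 - t_par) ^ length \<mu>)"
    using FX.tt_neq_1 by (simp add: FX.hom_divide FX.hom_power FX.hom_diff field_simps)
  also have "\<dots> = to_fract (subst (psumX N) (HLM \<mu>) * Const (V / (1 - t_par) ^ length \<mu>))"
    by (simp add: hom_of_rings.hom_mult[OF hom_to_fract] Const_fract_def to_fract_subst_psumX)
  finally have S: "the_poly S = subst (psumX N) (HLM \<mu>) * Const (V / (1 - t_par) ^ length \<mu>)"
    by (simp add: the_poly_to_fract)
  have v: "HL_v N \<mu> = V * HL_b \<mu> / (1 - t_par) ^ length \<mu>"
  proof -
    have 0: "0 \<notin> set \<mu>" using assms(1) by (simp add: is_partition_def)
    have "HL_v N \<mu> = V * (\<Prod>i\<in>set \<mu>. \<Prod>j=1..count_list \<mu> i. (1 - t_par ^ j) / (1 - t_par))"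
    proof -
      have "(\<Prod>i\<in>set \<mu>. \<Prod>j=1..(if i = 0 then N - length \<mu> else count_list \<mu> i). (1 - t_par ^ j) / (1 - t_par)) =
          (\<Prod>i\<in>set \<mu>. \<Prod>j=1..count_list \<mu> i. (1 - t_par ^ j) / (1 - t_par))"
        using 0 by (intro prod.cong) auto
      then show ?thesis using 0 by (simp add: HL_v_def V_def Let_def)
    qed
    also have "(\<Prod>i\<in>set \<mu>. \<Prod>j=1..count_list \<mu> i. (1 - t_par ^ j) / (1 - t_par)) = HL_b \<mu> / (1 - t_par) ^ length \<mu>"
      by (simp add: HL_b_def prod_dividef power_sum[symmetric] sum_count_set)
    finally show ?thesis by simp
  qed
  have "V \<noteq> 0" using t_par_power t1 by (auto simp: V_def)
  then have "inverse (HL_v N \<mu>) * (V / (1 - t_par) ^ length \<mu>) = 1 / HL_b \<mu>"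
    using t1 HL_b_nonzero[of \<mu>] by (simp add: v field_simps)
  then have "Const (1 / HL_b \<mu>) = Const (inverse (HL_v N \<mu>)) * Const (V / (1 - t_par) ^ length \<mu>)"
    by (simp only: Const_mult[symmetric])
  then have "Const (inverse (HL_v N \<mu>)) * (subst (psumX N) (HLM \<mu>) * Const (V / (1 - t_par) ^ length \<mu>)) =
      Const (1 / HL_b \<mu>) * subst (psumX N) (HLM \<mu>)"
    by (simp only: mult_ac)
  then show ?thesis
    by (simp only: HL_poly_def S_def[symmetric] S proj_of_psums subst_mult subst_Const)
qed

lemma HL_P_eq: "is_partition \<mu> \<Longrightarrow> HL_P \<mu> = of_psums (Const (1 / HL_b \<mu>) * HLM \<mu>)"
  unfolding HL_P_def by (rule symf_limI) (simp add: HL_poly_eq)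

lemma HL_Q_eq: "is_partition \<mu> \<Longrightarrow> HL_Q \<mu> = of_psums (HLM \<mu>)"
  unfolding HL_Q_def by (simp add: HL_P_eq HL_b_nonzero Const_times_single
      flip: of_psums_scale Const_mult mult.assoc)

section \<open>The Vandermonde determinant\<close>

text \<open>The determinant with columns \<open>c j\<close>, kept as a signed sum over permutations
  of {1..N} because D_N(u) is given in this form.\<close>

definition alt_sum :: "nat \<Rightarrow> (nat \<Rightarrow> nat \<Rightarrow> 'b::comm_ring_1) \<Rightarrow> 'b" where
  "alt_sum N c = (\<Sum>\<sigma> | \<sigma> permutes {1..N}. of_int (sign \<sigma>) * (\<Prod>i=1..N. c (\<sigma> i) i))"

lemma prod_column:
  fixes f :: "nat \<Rightarrow> 'b::comm_ring_1"
  assumes "\<sigma> permutes {1..N}" "j \<in> {1..N}"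
  shows "(\<Prod>i=1..N. (if \<sigma> i = j then f i else c (\<sigma> i) i)) = f (inv \<sigma> j) * (\<Prod>i\<in>{1..N} - {inv \<sigma> j}. c (\<sigma> i) i)"
proof -
  have j: "inv \<sigma> j \<in> {1..N}" "\<sigma> (inv \<sigma> j) = j"
    using assms by (simp_all only: permutes_in_image[OF permutes_inv[OF assms(1)]] permutes_inverses)
  have "(\<Prod>i=1..N. (if \<sigma> i = j then f i else c (\<sigma> i) i)) =
     (if \<sigma> (inv \<sigma> j) = j then f (inv \<sigma> j) else c (\<sigma> (inv \<sigma> j)) (inv \<sigma> j)) * (\<Prod>i\<in>{1..N} - {inv \<sigma> j}. (if \<sigma> i = j then f i else c (\<sigma> i) i))"
    by (rule prod.remove[OF finite_atLeastAtMost j(1)])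
  also have "(\<Prod>i\<in>{1..N} - {inv \<sigma> j}. (if \<sigma> i = j then f i else c (\<sigma> i) i)) = (\<Prod>i\<in>{1..N} - {inv \<sigma> j}. c (\<sigma> i) i)"
    by (intro prod.cong refl) (auto simp: permutes_inverses[OF assms(1)])
  finally show ?thesis using j by simp
qed

lemma alt_sum_column:
  assumes "j \<in> {1..N}"
  shows "alt_sum N (c(j := f)) = (\<Sum>\<sigma> | \<sigma> permutes {1..N}. of_int (sign \<sigma>) * (f (inv \<sigma> j) * (\<Prod>i\<in>{1..N} - {inv \<sigma> j}. c (\<sigma> i) i)))"
  unfolding alt_sum_def
proof (intro sum.cong refl arg_cong2[of _ _ _ _ "(*)"])
  fix \<sigma> assume "\<sigma> \<in> {\<sigma>. \<sigma> permutes {1..N}}"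
  then have "\<sigma> permutes {1..N}" by simp
  from prod_column[OF this assms, of f c]
  show "(\<Prod>i=1..N. (c(j := f)) (\<sigma> i) i) = f (inv \<sigma> j) * (\<Prod>i\<in>{1..N} - {inv \<sigma> j}. c (\<sigma> i) i)"
    by (simp add: if_distrib[of "\<lambda>g. g _"] fun_upd_def cong: if_cong)
qed

lemma alt_sum_column_add:
  assumes "j \<in> {1..N}"
  shows "alt_sum N (c(j := \<lambda>i. f i + g i)) = alt_sum N (c(j := f)) + alt_sum N (c(j := g))"
  by (simp add: alt_sum_column[OF assms] distrib_left distrib_right sum.distrib)

lemma alt_sum_column_scale:
  assumes "j \<in> {1..N}"
  shows "alt_sum N (c(j := \<lambda>i. x * f i)) = x * alt_sum N (c(j := f))"
  by (simp add: alt_sum_column[OF assms] sum_distrib_left mult_ac)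

text \<open>Exchanging the two columns shows that the sum is its own negative, hence the hypothesis
  on 2.\<close>

lemma alt_sum_equal_columns:
  assumes "j \<in> {1..N}" "k \<in> {1..N}" "j \<noteq> k" "c j = c k" "(2 :: 'b::idom) \<noteq> 0"
  shows "alt_sum N c = (0 :: 'b)"
proof -
  let ?t = "Transposition.transpose j k"
  have t: "?t permutes {1..N}" using assms by (intro permutes_swap_id)
  have "alt_sum N c = (\<Sum>\<sigma> | \<sigma> permutes {1..N}. of_int (sign (?t \<circ> \<sigma>)) * (\<Prod>i=1..N. c ((?t \<circ> \<sigma>) i) i))"
    unfolding alt_sum_def by (rule setum_permutations_compose_left[OF t])
  also have "\<dots> = (\<Sum>\<sigma> | \<sigma> permutes {1..N}. - (of_int (sign \<sigma>) * (\<Prod>i=1..N. c (\<sigma> i) i)))"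
  proof (rule sum.cong[OF refl])
    fix \<sigma> assume "\<sigma> \<in> {\<sigma>. \<sigma> permutes {1..N}}"
    then have "permutation \<sigma>" by (auto intro: permutes_imp_permutation[of "{1..N}"])
    then have "sign (?t \<circ> \<sigma>) = - sign \<sigma>"
      using assms by (simp add: sign_compose permutation_swap_id sign_swap_id)
    moreover have "c (?t x) = c x" for x
      using assms(4) by (auto simp: Transposition.transpose_def)
    ultimately show "of_int (sign (?t \<circ> \<sigma>)) * (\<Prod>i=1..N. c ((?t \<circ> \<sigma>) i) i) = - (of_int (sign \<sigma>) * (\<Prod>i=1..N. c (\<sigma> i) i))"
      by simp
  qed
  also have "\<dots> = - alt_sum N c"
    by (simp add: alt_sum_def sum_negf)
  finally have "alt_sum N c + alt_sum N c = 0" by (rule eq_neg_iff_add_eq_0[THEN iffD1])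
  then have "2 * alt_sum N c = 0" by (simp only: mult_2)
  then show ?thesis using assms(5) by simp
qed

lemma alt_sum_column_op:
  assumes "j \<in> {1..N}" "K \<subseteq> {1..N} - {j}" "(2 :: 'b::idom) \<noteq> 0"
  shows "alt_sum N (c(j := \<lambda>i. c j i + (\<Sum>k\<in>K. x k * c k i))) = (alt_sum N c :: 'b)"
proof -
  have "finite K" using assms(2) finite_subset by blast
  then show ?thesis using assms(2)
  proof (induction K)
    case (insert k K)
    define F where "F i = c j i + (\<Sum>k\<in>K. x k * c k i)" for i
    have "alt_sum N (c(j := \<lambda>i. c j i + (\<Sum>k\<in>insert k K. x k * c k i))) = alt_sum N (c(j := \<lambda>i. F i + x k * c k i))"
      using insert.hyps by (simp add: F_def add_ac)
    also have "\<dots> = alt_sum N (c(j := F)) + x k * alt_sum N (c(j := c k))"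
      by (simp only: alt_sum_column_add[OF assms(1)] alt_sum_column_scale[OF assms(1)])
    also have "alt_sum N (c(j := F)) = alt_sum N c"
      unfolding F_def[abs_def] by (rule insert.IH) (use insert.prems in auto)
    also have "alt_sum N (c(j := c k)) = 0"
      using insert.prems assms by (intro alt_sum_equal_columns[of j N k]) auto
    finally show ?case by simp
  qed simp
qed

text \<open>Column operations replace \<open>y\<^sup>N\<^sup>-\<^sup>j\<close> by \<open>\<Prod>\<^sub>k\<^sub>>\<^sub>j (y - y\<^sub>k)\<close>, which makes the matrix triangular.\<close>

lemma vandermonde_det:
  fixes y :: "nat \<Rightarrow> 'b::idom"
  assumes "(2 :: 'b) \<noteq> 0"
  shows "(\<Sum>\<sigma> | \<sigma> permutes {1..N}. of_int (sign \<sigma>) * (\<Prod>i=1..N. y i ^ (N - \<sigma> i))) = (\<Prod>i=1..N. \<Prod>j=i+1..N. y i - y j)"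
proof -
  define M where "M j i = y i ^ (N - j)" for j i
  define p where "p j = (\<Prod>k=j+1..N. [:- y k, 1:])" for j
  define P where "P j i = poly (p j) (y i)" for j i
  have p: "degree (p j) = N - j" "coeff (p j) (N - j) = 1" for j
  proof -
    show "degree (p j) = N - j" by (simp add: p_def degree_prod_sum_eq)
    moreover have "lead_coeff (p j) = 1" by (simp add: p_def lead_coeff_prod)
    ultimately show "coeff (p j) (N - j) = 1" by simp
  qed
  have step: "P j i = M j i + (\<Sum>k=j+1..N. coeff (p j) (N - k) * M k i)" if "j \<in> {1..N}" for i j
  proof -
    have "P j i = (\<Sum>l\<le>N - j. coeff (p j) l * y i ^ l)"
      by (simp add: P_def poly_altdef p)
    also have "\<dots> = (\<Sum>k=j..N. coeff (p j) (N - k) * y i ^ (N - k))"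
      by (rule sum.reindex_bij_witness[of _ "\<lambda>k. N - k" "\<lambda>l. N - l"]) (use that in auto)
    also have "{j..N} = insert j {j+1..N}" using that by auto
    finally show ?thesis by (simp add: p M_def)
  qed
  \<comment> \<open>Columns are replaced from the left: the correction of column j involves only
    columns k > j, which still contain plain powers.\<close>
  have "alt_sum N (\<lambda>j. if j \<le> n then P j else M j) = alt_sum N M" if "n \<le> N" for n
    using that
  proof (induction n)
    case 0
    show ?case
      unfolding alt_sum_def
    proof (intro sum.cong refl arg_cong2[of _ _ _ _ "(*)"] prod.cong)
      fix \<sigma> i assume "\<sigma> \<in> {\<sigma>. \<sigma> permutes {1..N}}" "i \<in> {1..N}"
      then have "\<sigma> i \<in> {1..N}" by (simp only: mem_Collect_eq permutes_in_image)
      then show "(if \<sigma> i \<le> 0 then P (\<sigma> i) else M (\<sigma> i)) i = M (\<sigma> i) i" by simp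
    qed
  next
    case (Suc n)
    define c where "c j = (if j \<le> n then P j else M j)" for j
    have j: "Suc n \<in> {1..N}" using Suc.prems by simp
    have "P (Suc n) i = c (Suc n) i + (\<Sum>k=Suc n+1..N. coeff (p (Suc n)) (N - k) * c k i)" for i
      unfolding step[OF j] by (simp add: c_def)
    then have "(\<lambda>j. if j \<le> Suc n then P j else M j) =
        c(Suc n := \<lambda>i. c (Suc n) i + (\<Sum>k=Suc n+1..N. coeff (p (Suc n)) (N - k) * c k i))"
      by (intro ext) (simp add: c_def le_Suc_eq)
    moreover have "alt_sum N (c(Suc n := \<lambda>i. c (Suc n) i + (\<Sum>k=Suc n+1..N. coeff (p (Suc n)) (N - k) * c k i))) = alt_sum N c"
      by (rule alt_sum_column_op[OF j _ assms]) auto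
    moreover have "alt_sum N c = alt_sum N M"
      unfolding c_def using Suc by simp
    ultimately show ?case by (simp only:)
  qed
  then have "alt_sum N M = alt_sum N (\<lambda>j. if j \<le> N then P j else M j)" by simp
  also have "\<dots> = (\<Sum>\<sigma>\<in>{id}. of_int (sign \<sigma>) * (\<Prod>i=1..N. P (\<sigma> i) i))"
  proof -
    have "alt_sum N (\<lambda>j. if j \<le> N then P j else M j) = alt_sum N P"
      unfolding alt_sum_def
    proof (intro sum.cong refl arg_cong2[of _ _ _ _ "(*)"] prod.cong)
      fix \<sigma> i assume "\<sigma> \<in> {\<sigma>. \<sigma> permutes {1..N}}" "i \<in> {1..N}"
      then have "\<sigma> i \<in> {1..N}" by (simp only: mem_Collect_eq permutes_in_image)
      then show "(if \<sigma> i \<le> N then P (\<sigma> i) else M (\<sigma> i)) i = P (\<sigma> i) i" by simp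
    qed
    also have "\<dots> = (\<Sum>\<sigma>\<in>{id}. of_int (sign \<sigma>) * (\<Prod>i=1..N. P (\<sigma> i) i))"
      unfolding alt_sum_def
    proof (rule sum.mono_neutral_right)
      show "finite {\<sigma>. \<sigma> permutes {1..N}}" by (simp add: finite_permutations)
      show "{id} \<subseteq> {\<sigma>. \<sigma> permutes {1..N}}" by (simp add: permutes_id)
      show "\<forall>\<sigma>\<in>{\<sigma>. \<sigma> permutes {1..N}} - {id}. of_int (sign \<sigma>) * (\<Prod>i=1..N. P (\<sigma> i) i) = 0"
      proof
        fix \<sigma> assume \<sigma>: "\<sigma> \<in> {\<sigma>. \<sigma> permutes {1..N}} - {id}"
        then have perm: "\<sigma> permutes {1..N}" and "\<sigma> \<noteq> id" by auto
        then obtain i where i: "i \<in> {1..N}" "\<not> \<sigma> i \<ge> i"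
          using permutes_natset_ge[OF perm] by blast
        \<comment> \<open>Since \<open>\<sigma> i < i\<close>, the index i itself is among the roots
          of the polynomial in column \<open>\<sigma> i\<close>.\<close>
        have "P (\<sigma> i) i = 0"
          unfolding P_def p_def poly_prod by (rule prod_zero) (use i in \<open>auto intro!: bexI[of _ i]\<close>)
        then have "(\<Prod>i=1..N. P (\<sigma> i) i) = 0"
          using i(1) by (intro prod_zero bexI[of _ i]) simp_all
        then show "of_int (sign \<sigma>) * (\<Prod>i=1..N. P (\<sigma> i) i) = 0" by simp
      qed
    qed
    finally show ?thesis .
  qed
  also have "\<dots> = (\<Prod>i=1..N. \<Prod>j=i+1..N. y i - y j)"
    by (simp add: P_def p_def poly_prod)
  finally show ?thesis by (simp add: alt_sum_def M_def)
qed

section \<open>Symmetrized eigenvalue identities\<close>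

lemma prod_triangle_swap:
  fixes N :: nat and f :: "nat \<Rightarrow> nat \<Rightarrow> 'b::comm_monoid_mult"
  shows
  "(\<Prod>i=1..N. \<Prod>j=i+1..N. f i j) = (\<Prod>j=1..N. \<Prod>i=1..<j. f i j)"
proof -
  have "(\<Prod>i=1..N. \<Prod>j=i+1..N. f i j) = (\<Prod>(i, j)\<in>Sigma {1..N} (\<lambda>i. {i+1..N}). f i j)"
    by (rule prod.Sigma) auto
  also have "\<dots> = (\<Prod>(j, i)\<in>Sigma {1..N} (\<lambda>j. {1..<j}). f i j)"
    by (rule prod.reindex_bij_witness[of _ "\<lambda>(j, i). (i, j)" "\<lambda>(i, j). (j, i)"]) auto
  also have "\<dots> = (\<Prod>j=1..N. \<Prod>i=1..<j. f i j)"
    by (rule prod.Sigma[symmetric]) auto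
  finally show ?thesis .
qed

context F_field_hom
begin

lemma tt_nonzero: "tt \<noteq> 0"
  by (rule hom_nonzero) simp

lemma two_nonzero: "(2 :: 'b) \<noteq> 0"
  using hom_nonzero[of 2] hom_of_nat[of 2] by simp

abbreviation tv :: 'b where "tv \<equiv> inverse tt"

text \<open>The coefficient (-u)^s t^(s(s-1)/2 - s(N-1)) belonging to the sets I with s points
  outside, see \<open>ecoef_eq\<close>. The product form makes its change under N -> N + 1
  visible.\<close>

definition ecoef :: "nat \<Rightarrow> 'b \<Rightarrow> nat \<Rightarrow> 'b" where
  "ecoef N u s = (\<Prod>j<s. - u * tv ^ (N - 1 - j))"

lemma cross_insert_left:
  "finite I \<Longrightarrow> i \<notin> I \<Longrightarrow> cross a (insert i I) J = cross a {i} J * cross a I J"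
  by (simp add: cross_def)

lemma cross_insert_right:
  "finite J \<Longrightarrow> j \<notin> J \<Longrightarrow> cross a I (insert j J) = cross a I {j} * cross a I J"
  unfolding cross_def prod.distrib[symmetric] by (rule prod.cong[OF refl]) simp

lemma cross_union_right:
  "finite J \<Longrightarrow> finite K \<Longrightarrow> J \<inter> K = {} \<Longrightarrow> cross a {i} (J \<union> K) = cross a {i} J * cross a {i} K"
  by (simp add: cross_def prod.union_disjoint)

text \<open>The points of J are multiplied by t. A pair inside I is unchanged, a pair inside J gains
  t, and a mixed pair gains its cross factor in either order of the indices, the two signs
  cancelling. The exponent of t is the number of pairs inside J.\<close>

lemma prod_differences:
  assumes "I \<inter> J = {}" "I \<union> J = {1..N}" "inj_on a {1..N}"
  shows "(\<Prod>j=1..N. \<Prod>i=1..<j. (if i \<in> I then a i else tt * a i) - (if j \<in> I then a j else tt * a j)) =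
     (\<Prod>j=1..N. \<Prod>i=1..<j. a i - a j) * cross a I J * tt ^ (\<Sum>k<card J. k)"
  using assms
proof (induction N arbitrary: I J)
  case 0
  then show ?case by (simp add: cross_def)
next
  case (Suc N)
  let ?n = "Suc N"
  let ?y = "\<lambda>I i. if i \<in> I then a i else tt * a i"
  let ?d = "\<lambda>i. a i - a ?n"
  define I' J' where "I' = I - {?n}" and "J' = J - {?n}"
  have IJ': "I' \<inter> J' = {}" "I' \<union> J' = {1..N}"
  proof -
    show "I' \<inter> J' = {}" using Suc.prems(1) by (auto simp: I'_def J'_def)
    have "I' \<union> J' = (I \<union> J) - {?n}" by (auto simp: I'_def J'_def)
    also have "\<dots> = {1..N}" unfolding Suc.prems(2) by auto
    finally show "I' \<union> J' = {1..N}" .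
  qed
  then have fin: "finite I'" "finite J'" by (metis finite_Un finite_atLeastAtMost)+
  have notin: "?n \<notin> I'" "?n \<notin> J'" by (auto simp: I'_def J'_def)
  have nz: "a i - a ?n \<noteq> 0" "a ?n - a i \<noteq> 0" if "i \<in> {1..N}" for i
  proof -
    have "a i \<noteq> a ?n" using that Suc.prems(3) by (auto dest!: inj_onD)
    then show "a i - a ?n \<noteq> 0" "a ?n - a i \<noteq> 0" by auto
  qed
  have subI: "i \<in> {1..N}" if "i \<in> I'" for i using that IJ'(2) by blast
  have split: "(\<Prod>i\<in>{1..N}. g i) = (\<Prod>i\<in>I'. g i) * (\<Prod>i\<in>J'. g i)" for g :: "nat \<Rightarrow> 'b"
    unfolding IJ'(2)[symmetric] by (rule prod.union_disjoint) (use fin IJ' in auto)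
  have IH: "(\<Prod>j=1..N. \<Prod>i=1..<j. ?y I i - ?y I j) = (\<Prod>j=1..N. \<Prod>i=1..<j. a i - a j) * cross a I' J' * tt ^ (\<Sum>k<card J'. k)"
  proof -
    have "inj_on a {1..N}" using Suc.prems(3) by (rule inj_on_subset) auto
    moreover have "(\<Prod>j=1..N. \<Prod>i=1..<j. ?y I i - ?y I j) = (\<Prod>j=1..N. \<Prod>i=1..<j. ?y I' i - ?y I' j)"
      by (intro prod.cong refl) (auto simp: I'_def)
    ultimately show ?thesis using Suc.IH[OF IJ'] by (simp only:)
  qed
  have last: "{1..<?n} = {1..N}" by auto
  consider "?n \<in> I" | "?n \<in> J" using Suc.prems(2) by (auto simp: set_eq_iff)
  then have key: "(\<Prod>i=1..N. ?y I i - ?y I ?n) * (cross a I' J' * tt ^ (\<Sum>k<card J'. k)) =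
      (\<Prod>i=1..N. ?d i) * (cross a I J * tt ^ (\<Sum>k<card J. k))"
  proof cases
    case 1
    then have J: "J = J'" "I = insert ?n I'" using Suc.prems by (auto simp: I'_def J'_def)
    have "(\<Prod>i\<in>I'. ?y I i - ?y I ?n) = (\<Prod>i\<in>I'. ?d i)"
      using 1 by (intro prod.cong) (auto simp: I'_def)
    moreover have "(\<Prod>i\<in>J'. ?y I i - ?y I ?n) = (\<Prod>i\<in>J'. ?d i) * cross a {?n} J'"
      unfolding cross_def by (simp only: prod.insert finite.emptyI empty_iff not_False_eq_True prod.empty mult_1_right prod.distrib[symmetric])
        (intro prod.cong refl, use 1 Suc.prems(1) nz IJ' in \<open>auto simp: J'_def field_simps\<close>)
    ultimately show ?thesis
      unfolding split J using cross_insert_left[OF fin(1) notin(1)] by (simp add: mult_ac flip: J)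
  next
    case 2
    then have J: "J = insert ?n J'" "I = I'" using Suc.prems by (auto simp: I'_def J'_def)
    have nI: "?n \<notin> I" using 2 Suc.prems(1) by auto
    have "(\<Prod>i\<in>I'. ?y I i - ?y I ?n) = (\<Prod>i\<in>I'. ?d i) * cross a I' {?n}"
      unfolding cross_def by (simp only: prod.insert finite.emptyI empty_iff not_False_eq_True prod.empty mult_1_right prod.distrib[symmetric])
        (intro prod.cong refl, use nI nz(1) subI in \<open>force simp: J(2)\<close>)
    moreover have "(\<Prod>i\<in>J'. ?y I i - ?y I ?n) = (\<Prod>i\<in>J'. ?d i) * tt ^ card J'"
    proof -
      have "?y I i - ?y I ?n = ?d i * tt" if "i \<in> J'" for i
        using that nI IJ'(1) by (auto simp: J(2) algebra_simps)
      then show ?thesis by (simp add: prod.distrib)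
    qed
    moreover have "card J = Suc (card J')" using J(1) fin notin by simp
    ultimately show ?thesis
      unfolding split using cross_insert_right[OF fin(2) notin(2), of a I'] J by (simp add: mult_ac power_add)
  qed
  have peel: "(\<Prod>j=1..?n. g j) = (\<Prod>j=1..N. g j) * g ?n" for g :: "nat \<Rightarrow> 'b"
    by (simp add: prod.cl_ivl_Suc)
  have "(\<Prod>j=1..?n. \<Prod>i=1..<j. ?y I i - ?y I j) =
      (\<Prod>j=1..N. \<Prod>i=1..<j. a i - a j) * ((\<Prod>i=1..N. ?y I i - ?y I ?n) * (cross a I' J' * tt ^ (\<Sum>k<card J'. k)))"
    unfolding peel last IH by (simp only: mult_ac)
  then show ?case unfolding key peel last by (simp only: mult_ac)
qed

lemma ecoef_eq:
  assumes "s \<le> N"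
  shows "ecoef N u s = (- u * tv ^ (N - 1)) ^ s * tt ^ (\<Sum>k<s. k)"
  using assms
proof (induction s)
  case 0
  then show ?case by (simp add: ecoef_def)
next
  case (Suc s)
  have "tv ^ (N - 1) = tv ^ (N - 1 - s) * tv ^ s" using Suc.prems by (simp flip: power_add)
  moreover have "tv ^ s * tt ^ s = 1" using tt_nonzero by (simp flip: power_mult_distrib)
  ultimately have "tv ^ (N - 1 - s) = tv ^ (N - 1) * tt ^ s" by (simp add: mult.assoc)
  moreover have "ecoef N u (Suc s) = ecoef N u s * (- u * tv ^ (N - 1 - s))" by (simp add: ecoef_def)
  moreover have "(\<Sum>k<Suc s. k) = (\<Sum>k<s. k) + s" by simp
  ultimately show ?case using Suc by (simp only: power_add power_Suc mult_ac)
qed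

text \<open>The weight t^(1 - \<sigma>(i)) equals t^(1 - N) t^(N - \<sigma>(i)), and the last factor
  turns a_i^(N - \<sigma>(i)) into the same power of t a_i. So the twisted sum is a Vandermonde
  determinant at points multiplied by t outside I.\<close>

lemma vandermonde_twisted:
  assumes "I \<subseteq> {1..N}" "inj_on a {1..N}"
  shows "(\<Sum>\<sigma> | \<sigma> permutes {1..N}. of_int (sign \<sigma>) * ((\<Prod>i=1..N. a i ^ (N - \<sigma> i)) * (\<Prod>i\<in>{1..N} - I. - u * tv ^ (\<sigma> i - 1)))) =
    (\<Prod>i=1..N. \<Prod>j=i+1..N. a i - a j) * (ecoef N u (card ({1..N} - I)) * cross a I ({1..N} - I))"
proof -
  let ?J = "{1..N} - I"
  define y where "y i = (if i \<in> I then a i else tt * a i)" for i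
  define w where "w = - u * tv ^ (N - 1)"
  have card: "card ?J \<le> N" using card_mono[of "{1..N}" ?J] by simp
  have "(\<Prod>i=1..N. a i ^ (N - \<sigma> i)) * (\<Prod>i\<in>?J. - u * tv ^ (\<sigma> i - 1)) = (- u * tv ^ (N - 1)) ^ card ?J * (\<Prod>i=1..N. y i ^ (N - \<sigma> i))"
    if \<sigma>: "\<sigma> permutes {1..N}" for \<sigma>
  proof -
    have split: "(\<Prod>i=1..N. g i) = (\<Prod>i\<in>?J. g i) * (\<Prod>i\<in>I. g i)" for g :: "nat \<Rightarrow> 'b"
      by (rule prod.subset_diff[OF assms(1)]) simp
    have "a i ^ (N - \<sigma> i) * (- u * tv ^ (\<sigma> i - 1)) = (- u * tv ^ (N - 1)) * y i ^ (N - \<sigma> i)" if "i \<in> ?J" for i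
    proof -
      have "\<sigma> i \<in> {1..N}" using that permutes_in_image[OF \<sigma>, of i] by blast
      then have "N - 1 = (\<sigma> i - 1) + (N - \<sigma> i)" by auto
      then have "tv ^ (N - 1) = tv ^ (\<sigma> i - 1) * tv ^ (N - \<sigma> i)" by (simp only: power_add)
      moreover have "tv ^ (N - \<sigma> i) * tt ^ (N - \<sigma> i) = 1" using tt_nonzero by (simp flip: power_mult_distrib)
      ultimately have "tv ^ (\<sigma> i - 1) = tv ^ (N - 1) * tt ^ (N - \<sigma> i)" by (simp add: mult.assoc)
      then show ?thesis using that by (simp add: y_def power_mult_distrib)
    qed
    then have "(\<Prod>i\<in>?J. a i ^ (N - \<sigma> i) * (- u * tv ^ (\<sigma> i - 1))) = (\<Prod>i\<in>?J. w * y i ^ (N - \<sigma> i))"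
      unfolding w_def by (intro prod.cong refl)
    then have J: "(\<Prod>i\<in>?J. a i ^ (N - \<sigma> i)) * (\<Prod>i\<in>?J. - u * tv ^ (\<sigma> i - 1)) = w ^ card ?J * (\<Prod>i\<in>?J. y i ^ (N - \<sigma> i))"
      by (simp only: prod.distrib[symmetric]) (simp only: prod.distrib prod_constant)
    have I: "(\<Prod>i\<in>I. a i ^ (N - \<sigma> i)) = (\<Prod>i\<in>I. y i ^ (N - \<sigma> i))"
      by (simp add: y_def)
    have "(\<Prod>i=1..N. a i ^ (N - \<sigma> i)) * (\<Prod>i\<in>?J. - u * tv ^ (\<sigma> i - 1)) =
        ((\<Prod>i\<in>?J. a i ^ (N - \<sigma> i)) * (\<Prod>i\<in>?J. - u * tv ^ (\<sigma> i - 1))) * (\<Prod>i\<in>I. a i ^ (N - \<sigma> i))"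
      unfolding split by (simp only: mult_ac)
    then show ?thesis unfolding J I split w_def by (simp only: mult_ac)
  qed
  then have "(\<Sum>\<sigma> | \<sigma> permutes {1..N}. of_int (sign \<sigma>) * ((\<Prod>i=1..N. a i ^ (N - \<sigma> i)) * (\<Prod>i\<in>?J. - u * tv ^ (\<sigma> i - 1)))) =
     (- u * tv ^ (N - 1)) ^ card ?J * (\<Sum>\<sigma> | \<sigma> permutes {1..N}. of_int (sign \<sigma>) * (\<Prod>i=1..N. y i ^ (N - \<sigma> i)))"
    unfolding sum_distrib_left by (intro sum.cong refl) (simp add: mult_ac)
  also have "(\<Sum>\<sigma> | \<sigma> permutes {1..N}. of_int (sign \<sigma>) * (\<Prod>i=1..N. y i ^ (N - \<sigma> i))) = (\<Prod>j=1..N. \<Prod>i=1..<j. y i - y j)"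
    unfolding vandermonde_det[OF two_nonzero] by (rule prod_triangle_swap)
  also have "\<dots> = (\<Prod>j=1..N. \<Prod>i=1..<j. a i - a j) * cross a I ?J * tt ^ (\<Sum>k<card ?J. k)"
    unfolding y_def by (rule prod_differences) (use assms in auto)
  finally show ?thesis
    unfolding ecoef_eq[OF card] prod_triangle_swap by (simp only: mult_ac)
qed

lemma diff_prod_nonzero:
  fixes a :: "nat \<Rightarrow> 'b"
  assumes "inj_on a {1..N}"
  shows "(\<Prod>i=1..N. \<Prod>j=i+1..N. a i - a j) \<noteq> 0"
proof -
  have "a i - a j \<noteq> 0" if "i \<in> {1..N}" "j \<in> {i+1..N}" for i j
    using inj_onD[OF assms, of i j] that by auto
  then show ?thesis by simp
qed

text \<open>Summing over I inside the determinant gives the product of 1 - u t^(1 - \<sigma>(i))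
  over all i, which does not depend on \<sigma>. The Vandermonde determinant then cancels.\<close>

lemma sum_ecoef_cross_interval:
  assumes "inj_on a {1..N}"
  shows "(\<Sum>I\<in>Pow {1..N}. ecoef N u (card ({1..N} - I)) * cross a I ({1..N} - I)) = (\<Prod>j<N. 1 - u * tv ^ j)"
proof -
  let ?D = "\<Prod>i=1..N. \<Prod>j=i+1..N. a i - a j"
  have "?D * (\<Sum>I\<in>Pow {1..N}. ecoef N u (card ({1..N} - I)) * cross a I ({1..N} - I)) =
     (\<Sum>I\<in>Pow {1..N}. \<Sum>\<sigma> | \<sigma> permutes {1..N}. of_int (sign \<sigma>) * ((\<Prod>i=1..N. a i ^ (N - \<sigma> i)) * (\<Prod>i\<in>{1..N} - I. - u * tv ^ (\<sigma> i - 1))))"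
    unfolding sum_distrib_left by (intro sum.cong refl vandermonde_twisted[symmetric] assms) auto
  also have "\<dots> = (\<Sum>\<sigma> | \<sigma> permutes {1..N}. of_int (sign \<sigma>) * ((\<Prod>i=1..N. a i ^ (N - \<sigma> i)) * (\<Sum>I\<in>Pow {1..N}. \<Prod>i\<in>{1..N} - I. - u * tv ^ (\<sigma> i - 1))))"
    by (subst sum.swap) (simp only: sum_distrib_left)
  also have "\<dots> = (\<Sum>\<sigma> | \<sigma> permutes {1..N}. of_int (sign \<sigma>) * (\<Prod>i=1..N. a i ^ (N - \<sigma> i))) * (\<Prod>j<N. 1 - u * tv ^ j)"
    unfolding sum_distrib_right
  proof (rule sum.cong[OF refl])
    fix \<sigma> assume "\<sigma> \<in> {\<sigma>. \<sigma> permutes {1..N}}"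
    then have \<sigma>: "\<sigma> permutes {1..N}" by simp
    have "(\<Sum>I\<in>Pow {1..N}. \<Prod>i\<in>{1..N} - I. - u * tv ^ (\<sigma> i - 1)) = (\<Prod>i=1..N. 1 + - u * tv ^ (\<sigma> i - 1))"
      by (subst prod_add) simp_all
    also have "\<dots> = (\<Prod>i=1..N. 1 + - u * tv ^ (i - 1))"
      by (rule prod.reindex_bij_betw[OF permutes_imp_bij[OF \<sigma>]])
    also have "\<dots> = (\<Prod>j<N. 1 - u * tv ^ j)"
      by (rule prod.reindex_bij_witness[of _ Suc "\<lambda>i. i - 1"]) auto
    finally show "of_int (sign \<sigma>) * ((\<Prod>i=1..N. a i ^ (N - \<sigma> i)) * (\<Sum>I\<in>Pow {1..N}. \<Prod>i\<in>{1..N} - I. - u * tv ^ (\<sigma> i - 1))) =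
        of_int (sign \<sigma>) * (\<Prod>i=1..N. a i ^ (N - \<sigma> i)) * (\<Prod>j<N. 1 - u * tv ^ j)"
      by (simp only: mult.assoc)
  qed
  also have "\<dots> = ?D * (\<Prod>j<N. 1 - u * tv ^ j)"
    by (simp only: vandermonde_det[OF two_nonzero])
  finally show ?thesis using diff_prod_nonzero[OF assms] by (simp only: mult_cancel_left) blast
qed

text \<open>Arbitrary finite index sets are required because the eigenvalue induction removes
  points.\<close>

lemma sum_ecoef_cross:
  assumes "finite S" "inj_on a S"
  shows "(\<Sum>I\<in>Pow S. ecoef (card S) u (card (S - I)) * cross a I (S - I)) = (\<Prod>j<card S. 1 - u * tv ^ j)"
proof -
  let ?N = "card S"
  obtain h where h: "bij_betw h {1..?N} S"
    using assms(1) by (metis card_atLeastAtMost diff_Suc_1 finite_atLeastAtMost finite_same_card_bij)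
  have inj: "inj_on h {1..?N}" and im: "h ` {1..?N} = S" using h by (auto simp: bij_betw_def)
  have "(\<Sum>I\<in>Pow S. ecoef ?N u (card (S - I)) * cross a I (S - I)) =
     (\<Sum>I\<in>Pow {1..?N}. ecoef ?N u (card (S - h ` I)) * cross a (h ` I) (S - h ` I))"
    by (rule sum.reindex_bij_betw[symmetric]) (rule bij_betw_Pow[OF h])
  also have "\<dots> = (\<Sum>I\<in>Pow {1..?N}. ecoef ?N u (card ({1..?N} - I)) * cross (a \<circ> h) I ({1..?N} - I))"
  proof (rule sum.cong[OF refl])
    fix I assume "I \<in> Pow {1..?N}"
    then have I: "I \<subseteq> {1..?N}" by simp
    have eq: "S - h ` I = h ` ({1..?N} - I)" using inj_on_image_set_diff[OF inj, of "{1..?N}" I] I im by simp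
    have i1: "inj_on h I" and i2: "inj_on h ({1..?N} - I)" using inj I by (auto intro: inj_on_subset)
    show "ecoef ?N u (card (S - h ` I)) * cross a (h ` I) (S - h ` I) = ecoef ?N u (card ({1..?N} - I)) * cross (a \<circ> h) I ({1..?N} - I)"
      unfolding eq card_image[OF i2] cross_def prod.reindex[OF i1] prod.reindex[OF i2] o_def by (rule refl)
  qed
  also have "\<dots> = (\<Prod>j<?N. 1 - u * tv ^ j)"
    by (rule sum_ecoef_cross_interval) (use inj im assms(2) in \<open>simp add: comp_inj_on\<close>)
  finally show ?thesis .
qed

lemma sum_Pow_swap:
  assumes "finite S"
  shows "(\<Sum>I\<in>Pow S. \<Sum>i\<in>I. f I i) = (\<Sum>i\<in>S. \<Sum>I\<in>Pow (S - {i}). f (insert i I) i :: 'c::comm_monoid_add)"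
proof -
  have "(\<Sum>I\<in>Pow S. \<Sum>i\<in>I. f I i) = (\<Sum>(I, i)\<in>Sigma (Pow S) (\<lambda>I. I). f I i)"
    using assms by (intro sum.Sigma) (auto intro: finite_subset)
  also have "\<dots> = (\<Sum>(i, I)\<in>Sigma S (\<lambda>i. Pow (S - {i})). f (insert i I) i)"
    by (rule sum.reindex_bij_witness[of _ "\<lambda>(i, I). (insert i I, i)" "\<lambda>(I, i). (i, I - {i})"])
       (auto simp: insert_absorb)
  also have "\<dots> = (\<Sum>i\<in>S. \<Sum>I\<in>Pow (S - {i}). f (insert i I) i)"
    using assms by (intro sum.Sigma[symmetric]) auto
  finally show ?thesis .
qed

text \<open>One more point in I raises N but not s; the effect is the replacement of u by
  u/t.\<close>

lemma ecoef_shift: "s \<le> N \<Longrightarrow> ecoef (Suc N) u s = ecoef N (u * tv) s"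
proof -
  assume s: "s \<le> N"
  have "- u * tv ^ (Suc N - 1 - j) = - (u * tv) * tv ^ (N - 1 - j)" if "j < s" for j
  proof -
    have "Suc N - 1 - j = Suc (N - 1 - j)" using that s by auto
    then show ?thesis by simp
  qed
  then show ?thesis unfolding ecoef_def by (intro prod.cong refl) simp
qed

text \<open>The Hall-Littlewood functions are eigenvectors of Macdonald's operators at \<open>q = 0\<close>,
  which substitute 0 for the variables outside \<open>I\<close>.\<close>

lemma HLM_eigen:
  assumes "is_partition \<mu>" "finite S" "inj_on a S" "\<And>i. i \<in> S \<Longrightarrow> a i \<noteq> 0"
  shows "(\<Sum>I\<in>Pow S. ecoef (card S) u (card (S - I)) * cross a I (S - I) * ev (psums a I) (HLM \<mu>)) =
    (\<Prod>j=length \<mu>..<card S. 1 - u * tv ^ j) * ev (psums a S) (HLM \<mu>)"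
  using assms
proof (induction \<mu> arbitrary: S u)
  case Nil
  then show ?case using sum_ecoef_cross[of S a u] by (simp add: atLeast0LessThan)
next
  case (Cons r \<mu>)
  have r: "r \<ge> 1" "is_partition \<mu>" using Cons.prems(1) is_partition_Cons by blast+
  let ?e = "\<lambda>I. ecoef (card S) u (card (S - I))"
  have branch: "ev (psums a I) (HLM (r # \<mu>)) = (1 - tt) * (\<Sum>i\<in>I. a i ^ r * cross a {i} (I - {i}) * ev (psums a (I - {i})) (HLM \<mu>))"
    if "I \<subseteq> S" for I
    using that Cons.prems r by (intro ev_HLM) (auto intro: finite_subset inj_on_subset)
  \<comment> \<open>For fixed i, the cross factors of i against the rest of I and against the points
    outside I combine to the one against all of S - {i}, which no longer depends on I. What remains
    is the identity for S - {i} and \<mu>, with u/t in place of u; this shifts the eigenvalue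
    product by one index.\<close>
  have inner: "(\<Sum>I\<in>Pow (S - {i}). ?e (insert i I) * cross a (insert i I) (S - insert i I) * (cross a {i} (insert i I - {i}) * ev (psums a (insert i I - {i})) (HLM \<mu>))) =
      (\<Prod>j=length (r # \<mu>)..<card S. 1 - u * tv ^ j) * (cross a {i} (S - {i}) * ev (psums a (S - {i})) (HLM \<mu>))"
    if i: "i \<in> S" for i
  proof -
    let ?T = "S - {i}"
    have T: "finite ?T" "inj_on a ?T" "\<And>i. i \<in> ?T \<Longrightarrow> a i \<noteq> 0"
      using Cons.prems by (auto simp: inj_on_diff)
    have card: "card S = Suc (card ?T)" using i Cons.prems(2) by (metis card_Suc_Diff1)
    have "(\<Sum>I\<in>Pow ?T. ?e (insert i I) * cross a (insert i I) (S - insert i I) * (cross a {i} (insert i I - {i}) * ev (psums a (insert i I - {i})) (HLM \<mu>))) =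
        (\<Sum>I\<in>Pow ?T. cross a {i} ?T * (ecoef (card ?T) (u * tv) (card (?T - I)) * cross a I (?T - I) * ev (psums a I) (HLM \<mu>)))"
    proof (rule sum.cong[OF refl])
      fix I assume "I \<in> Pow ?T"
      then have I: "I \<subseteq> ?T" by simp
      then have iI: "i \<notin> I" and fI: "finite I" using T(1) by (auto intro: finite_subset)
      have d: "S - insert i I = ?T - I" "insert i I - {i} = I" using iI by auto
      have "cross a {i} ?T = cross a {i} I * cross a {i} (?T - I)"
        using cross_union_right[OF fI, of "?T - I" a i] T(1) I by (simp add: Un_absorb1)
      moreover have "cross a (insert i I) (?T - I) = cross a {i} (?T - I) * cross a I (?T - I)"
        by (rule cross_insert_left[OF fI iI])
      moreover have "?e (insert i I) = ecoef (card ?T) (u * tv) (card (?T - I))"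
        unfolding d card by (rule ecoef_shift) (use T(1) in \<open>auto intro: card_mono\<close>)
      ultimately show "?e (insert i I) * cross a (insert i I) (S - insert i I) * (cross a {i} (insert i I - {i}) * ev (psums a (insert i I - {i})) (HLM \<mu>)) =
          cross a {i} ?T * (ecoef (card ?T) (u * tv) (card (?T - I)) * cross a I (?T - I) * ev (psums a I) (HLM \<mu>))"
        unfolding d by (simp only: mult_ac)
    qed
    also have "\<dots> = cross a {i} ?T * ((\<Prod>j=length \<mu>..<card ?T. 1 - u * tv * tv ^ j) * ev (psums a ?T) (HLM \<mu>))"
      by (simp only: sum_distrib_left[symmetric] Cons.IH[OF r(2) T])
    also have "(\<Prod>j=length \<mu>..<card ?T. 1 - u * tv * tv ^ j) = (\<Prod>j=length (r # \<mu>)..<card S. 1 - u * tv ^ j)"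
      unfolding card list.size(4) add_Suc_right add_0_right prod.shift_bounds_Suc_ivl by (simp add: mult.assoc)
    finally show ?thesis by (simp only: mult_ac)
  qed
  have "(\<Sum>I\<in>Pow S. ?e I * cross a I (S - I) * ev (psums a I) (HLM (r # \<mu>))) =
      (\<Sum>I\<in>Pow S. \<Sum>i\<in>I. (1 - tt) * a i ^ r * (?e I * cross a I (S - I) * (cross a {i} (I - {i}) * ev (psums a (I - {i})) (HLM \<mu>))))"
    by (intro sum.cong refl) (simp add: branch sum_distrib_left mult_ac del: HLM.simps)
  also have "\<dots> = (\<Sum>i\<in>S. (1 - tt) * a i ^ r * (\<Sum>I\<in>Pow (S - {i}). ?e (insert i I) * cross a (insert i I) (S - insert i I) * (cross a {i} (insert i I - {i}) * ev (psums a (insert i I - {i})) (HLM \<mu>))))"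
    unfolding sum_Pow_swap[OF Cons.prems(2)] sum_distrib_left ..
  also have "\<dots> = (\<Sum>i\<in>S. (1 - tt) * a i ^ r * ((\<Prod>j=length (r # \<mu>)..<card S. 1 - u * tv ^ j) * (cross a {i} (S - {i}) * ev (psums a (S - {i})) (HLM \<mu>))))"
    by (intro sum.cong refl) (simp only: inner)
  also have "\<dots> = (\<Prod>j=length (r # \<mu>)..<card S. 1 - u * tv ^ j) * ev (psums a S) (HLM (r # \<mu>))"
    unfolding branch[OF order.refl] by (simp add: sum_distrib_left mult_ac)
  finally show ?case .
qed

text \<open>For \<open>a\<^sub>i = q x\<^sub>i\<close>, the evaluation on the left is \<open>f\<close> with the \<open>x\<^sub>i\<close>, \<open>i \<notin> I\<close>,
  multiplied by \<open>q\<close>.\<close>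

lemma macdonald_field:
  assumes "bounded_wt d f" "inj_on a {1..N}" "\<And>i. i \<in> {1..N} \<Longrightarrow> a i \<noteq> 0"
  shows "(\<Sum>\<sigma> | \<sigma> permutes {1..N}. of_int (sign \<sigma>) * ((\<Prod>i=1..N. a i ^ (N - \<sigma> i)) *
      (\<Sum>I\<in>Pow {1..N}. (\<Prod>i\<in>{1..N} - I. - u * tv ^ (\<sigma> i - 1)) *
        ev (\<lambda>k. psums a {1..N} k + \<iota> (cq k) * (\<iota> (1 / q_par) ^ Suc k * psums a I k)) f))) =
    (\<Prod>i=1..N. \<Prod>j=i+1..N. a i - a j) *
      (\<Sum>\<mu>\<in>parts_le d. \<iota> (1 / HL_b \<mu>) * \<iota> (1 / q_par) ^ sum_list \<mu> * (\<Prod>j=length \<mu>..<N. 1 - u * tv ^ j) *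
        ev (psums a {1..N}) (HLM \<mu> * star wq (HLM \<mu>) f))"
proof -
  let ?S = "{1..N}" and ?D = "\<Prod>i=1..N. \<Prod>j=i+1..N. a i - a j"
  define E where "E I = ev (\<lambda>k. psums a ?S k + \<iota> (cq k) * (\<iota> (1 / q_par) ^ Suc k * psums a I k)) f" for I
  define c where "c \<mu> = \<iota> (1 / HL_b \<mu>) * \<iota> (1 / q_par) ^ sum_list \<mu>" for \<mu>
  have E: "E I = (\<Sum>\<mu>\<in>parts_le d. c \<mu> * ev (psums a I) (HLM \<mu>) * ev (psums a ?S) (star wq (HLM \<mu>) f))" for I
    unfolding E_def cauchy[OF assms(1) cq_nonzero] ev_homog[OF homog_HLM] c_def by (simp only: mult.assoc)
  have "(\<Sum>\<sigma> | \<sigma> permutes ?S. of_int (sign \<sigma>) * ((\<Prod>i=1..N. a i ^ (N - \<sigma> i)) *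
      (\<Sum>I\<in>Pow ?S. (\<Prod>i\<in>?S - I. - u * tv ^ (\<sigma> i - 1)) * E I))) =
     (\<Sum>I\<in>Pow ?S. (\<Sum>\<sigma> | \<sigma> permutes ?S. of_int (sign \<sigma>) * ((\<Prod>i=1..N. a i ^ (N - \<sigma> i)) * (\<Prod>i\<in>?S - I. - u * tv ^ (\<sigma> i - 1)))) * E I)"
    unfolding sum_distrib_left sum_distrib_right by (subst sum.swap) (simp only: mult.assoc)
  also have "\<dots> = (\<Sum>I\<in>Pow ?S. ?D * (ecoef N u (card (?S - I)) * cross a I (?S - I)) * E I)"
    by (intro sum.cong refl) (simp only: vandermonde_twisted[OF _ assms(2)] Pow_iff)
  also have "\<dots> = ?D * (\<Sum>\<mu>\<in>parts_le d. c \<mu> * ev (psums a ?S) (star wq (HLM \<mu>) f) *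
      (\<Sum>I\<in>Pow ?S. ecoef N u (card (?S - I)) * cross a I (?S - I) * ev (psums a I) (HLM \<mu>)))"
    unfolding E sum_distrib_left by (subst sum.swap) (simp only: mult_ac)
  also have "\<dots> = ?D * (\<Sum>\<mu>\<in>parts_le d. c \<mu> * ev (psums a ?S) (star wq (HLM \<mu>) f) *
      ((\<Prod>j=length \<mu>..<N. 1 - u * tv ^ j) * ev (psums a ?S) (HLM \<mu>)))"
    using HLM_eigen[OF _ finite_atLeastAtMost assms(2,3)]
    by (intro arg_cong2[of _ _ _ _ "(*)"] sum.cong refl) (simp add: parts_le_def)
  finally show ?thesis unfolding E_def c_def ev_mult by (simp only: mult_ac)
qed

end

section \<open>Extension of scalars\<close>

lemma emb_eq: "emb c = to_fract [:c:]"
  by (simp add: emb_def to_fract_def)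

lemma hom_emb: "hom_of_rings emb"
proof
  fix x y :: F
  show "emb (x + y) = emb x + emb y" "emb (x * y) = emb x * emb y"
    by (simp_all add: emb_eq flip: hom_of_rings.hom_add[OF hom_to_fract] hom_of_rings.hom_mult[OF hom_to_fract])
  show "emb 1 = 1"
    by (simp only: emb_eq one_pCons[symmetric] hom_of_rings.hom_1[OF hom_to_fract])
qed

lemma emb_eq_0 [simp]: "emb c = 0 \<longleftrightarrow> c = 0"
  by (simp add: emb_def Zero_fract_def eq_fract)

lemma emb_inverse: "emb (inverse c) = inverse (emb c)"
proof (cases "c = 0")
  case True
  then show ?thesis by (simp add: hom_of_rings.hom_0[OF hom_emb])
next
  case False
  then have "emb c * emb (inverse c) = 1"
    by (simp add: hom_of_rings.hom_1[OF hom_emb] flip: hom_of_rings.hom_mult[OF hom_emb])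
  then show ?thesis by (simp add: inverse_unique)
qed

text \<open>Symmetric functions have coefficients in F, the operators in F(u). \<open>KM\<close> and
  \<open>KX\<close> embed F into polynomials over F(u) and into their fractions; \<open>KC\<close>
  is kept for constants that involve u.\<close>

interpretation KM: F_hom "\<lambda>c. Const (emb c) :: K mpoly"
  unfolding F_hom_def by (rule hom_of_rings_comp[OF hom_emb hom_Const])

interpretation KC: hom_of_rings "Const_fract :: K \<Rightarrow> K mpoly fract"
  by (rule hom_Const_fract)

interpretation KX: F_field_hom "\<lambda>c. Const_fract (emb c) :: K mpoly fract"
  unfolding F_field_hom_def F_hom_def by (rule hom_of_rings_comp[OF hom_emb hom_Const_fract])

lemma to_fract_KM_ev: "to_fract (KM.ev a f) = KX.ev (\<lambda>i. to_fract (a i)) f"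
  unfolding hom_comp_ev[OF KM.hom_of_rings_axioms hom_to_fract] by (simp add: Const_fract_def)

lemma subst_KM_ev: "subst s (KM.ev a f) = KM.ev (\<lambda>i. subst s (a i)) f"
  unfolding hom_comp_ev[OF KM.hom_of_rings_axioms hom_subst] by simp

lemma KM_ev_subst: "KM.ev X (subst s f) = KM.ev (\<lambda>i. KM.ev X (s i)) f"
  unfolding subst_eq_ev hom_comp_ev[OF hom_Const KM.hom_ev] by simp

lemma lookup_map_emb: "lookup (Poly_Mapping.map emb f) m = emb (lookup f m)"
  by (simp add: Poly_Mapping.map.rep_eq when_def hom_of_rings.hom_0[OF hom_emb])

lemma map_emb_eq: "Poly_Mapping.map emb f = KM.ev X f"
proof (induction f rule: mpoly_linear_induct)
  case zero
  show ?case by (rule poly_mapping_eqI) (simp add: lookup_map_emb hom_of_rings.hom_0[OF hom_emb])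
next
  case (add f g)
  show ?case unfolding KM.ev_add add[symmetric]
    by (rule poly_mapping_eqI) (simp add: lookup_map_emb lookup_add hom_of_rings.hom_add[OF hom_emb])
next
  case (single m c)
  show ?case
    by (rule poly_mapping_eqI)
       (simp add: lookup_map_emb KM.ev_single pwr_X Const_times_single lookup_single when_def hom_of_rings.hom_0[OF hom_emb])
qed

lemma keys_map_emb: "keys (KM.ev X f) = keys f"
  by (auto simp: in_keys_iff lookup_map_emb simp flip: map_emb_eq)

lemma proj_ext_scalars: "proj N (ext_scalars f) = KM.ev X (proj N f)"
proof -
  obtain d where d: "\<And>N. deg_le d (proj N f)"
    using proj_fun[of f] by (auto simp: proj_def)
  show ?thesis
    unfolding ext_scalars_def map_emb_eq
  proof (rule symf_ex)
    fix N
    have "subst (\<lambda>i. X (w i)) (KM.ev X (proj N f)) = KM.ev X (proj N f)" if "w permutes {1..N}" for w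
    proof -
      have "subst (\<lambda>i. X (w i)) (proj N f) = proj N f"
        using proj_symf(1)[of N f] that by (simp add: sym_polys_def)
      moreover have "KM.ev X (subst (\<lambda>i. X (w i)) (proj N f)) = KM.ev (\<lambda>i. X (w i)) (proj N f)"
        by (simp only: KM_ev_subst KM.ev_X)
      moreover have "subst (\<lambda>i. X (w i)) (KM.ev X (proj N f)) = KM.ev (\<lambda>i. X (w i)) (proj N f)"
        by (simp only: subst_KM_ev subst_X)
      ultimately show ?thesis by (simp only:)
    qed
    then show "KM.ev X (proj N f) \<in> sym_polys N"
      using proj_symf(1)[of N f] by (auto simp: sym_polys_def keys_map_emb)
    have "restr (Suc N) (KM.ev X (proj (Suc N) f)) = KM.ev (\<lambda>i. KM.ev X (if i = Suc N then 0 else X i)) (proj (Suc N) f)"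
      unfolding restr_def subst_KM_ev by (rule KM.ev_cong) simp
    also have "\<dots> = KM.ev X (restr (Suc N) (proj (Suc N) f))"
      unfolding restr_def KM_ev_subst ..
    finally show "restr (Suc N) (KM.ev X (proj (Suc N) f)) = KM.ev X (proj N f)"
      by (simp only: proj_symf)
    show "deg_le d (KM.ev X (proj N f))" using d[of N] by (simp add: deg_le_def keys_map_emb)
  qed
qed

lemma ext_scalars_add: "ext_scalars (f + g) = ext_scalars f + ext_scalars g"
  by (rule symf_eqI[of 0]) (simp add: proj_ext_scalars proj_add KM.ev_add)

lemma ext_scalars_0 [simp]: "ext_scalars 0 = 0"
  by (rule symf_eqI[of 0]) (simp add: proj_ext_scalars)

lemma ext_scalars_sum: "ext_scalars (sum f A) = (\<Sum>i\<in>A. ext_scalars (f i))"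
  by (induction A rule: infinite_finite_induct) (simp_all add: ext_scalars_add)

lemma ext_scalars_scale: "ext_scalars (c \<cdot> f) = emb c \<cdot> ext_scalars f"
  by (rule symf_eqI[of 0]) (simp add: proj_ext_scalars proj_scale KM.ev_mult)

lemma proj_ext_of_psums: "proj N (ext_scalars (of_psums f)) = KM.ev (psumX N) f"
  unfolding proj_ext_scalars proj_of_psums KM_ev_subst
  by (rule KM.ev_cong) (simp add: psumX_def KM.ev_sum KM.ev_mult KM.ev_power)

section \<open>The Macdonald operators on power sums\<close>

definition T_set :: "nat set \<Rightarrow> K mpoly \<Rightarrow> K mpoly" where
  "T_set J = subst (\<lambda>j. if j \<in> J then Const (emb q_par) * X j else X j)"

lemma hom_T_set: "hom_of_rings (T_set J)"
  unfolding T_set_def by (rule hom_subst)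

lemmas T_set_mult = hom_of_rings.hom_mult[OF hom_T_set]
  and T_set_sum = hom_of_rings.hom_sum[OF hom_T_set]
  and T_set_prod = hom_of_rings.hom_prod[OF hom_T_set]
  and T_set_power = hom_of_rings.hom_power[OF hom_T_set]
  and T_set_uminus = hom_of_rings.hom_uminus[OF hom_T_set]

lemma T_set_Const [simp]: "T_set J (Const c) = Const c"
  by (simp add: T_set_def)

lemma T_set_X: "T_set J (X j) = (if j \<in> J then Const (emb q_par) * X j else X j)"
  by (simp add: T_set_def)

lemma T_op_eq: "T_op i = T_set {i}"
  by (simp add: T_op_def T_set_def)

lemma subst_subst: "subst s (subst r f) = subst (\<lambda>i. subst s (r i)) f" for f :: "'a::comm_ring_1 mpoly"
  by (subst (2 3) subst_eq_ev) (simp add: hom_comp_ev[OF hom_Const hom_subst])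

lemma T_set_empty: "T_set {} f = f"
proof -
  have "T_set {} f = hom_of_rings.ev (\<lambda>c. Const c) (\<lambda>i. X i) f"
    by (simp add: T_set_def subst_eq_ev)
  also have "\<dots> = f" using ev_eq_hom[of "\<lambda>f. f" f] by (simp add: hom_of_rings_def)
  finally show ?thesis .
qed

lemma T_op_T_set: "i \<notin> J \<Longrightarrow> T_op i (T_set J f) = T_set (insert i J) f"
  unfolding T_op_eq T_set_def subst_subst
  by (rule arg_cong[where f = "\<lambda>s. subst s f"]) (auto simp: fun_eq_iff subst_mult)

definition D_coeff :: "(nat \<Rightarrow> nat) \<Rightarrow> nat \<Rightarrow> K" where
  "D_coeff \<sigma> i = u_par * emb t_par powi (1 - int (\<sigma> i))"

text \<open>The factors do not commute with multiplication in general, but T_x leaves the powers of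
  the other variables alone. With distinct indices all powers therefore move to the front, and the
  rest expands over the sets J of shifted variables.\<close>

lemma compose_D_factor:
  assumes "distinct xs"
  shows "foldr (\<circ>) (map (D_factor N \<sigma>) xs) id f =
    (\<Prod>i\<in>set xs. X i ^ (N - \<sigma> i)) * (\<Sum>J\<in>Pow (set xs). (\<Prod>i\<in>J. - Const (D_coeff \<sigma> i)) * T_set J f)"
  using assms
proof (induction xs)
  case Nil
  then show ?case by (simp add: T_set_empty)
next
  case (Cons x xs)
  let ?S = "set xs" and ?c = "\<lambda>i. - Const (D_coeff \<sigma> i)"
  let ?P = "\<Prod>i\<in>?S. X i ^ (N - \<sigma> i) :: K mpoly"
  let ?Q = "\<lambda>J. \<Prod>i\<in>J. ?c i"
  have x: "x \<notin> ?S" using Cons.prems by simp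
  have fin: "finite J" if "J \<in> Pow ?S" for J using that by (auto intro: finite_subset)
  have "T_op x ?P = ?P"
    unfolding T_op_eq T_set_prod T_set_power by (intro prod.cong refl) (use x in \<open>auto simp: T_set_X\<close>)
  then have "T_op x (?P * (\<Sum>J\<in>Pow ?S. ?Q J * T_set J f)) = ?P * (\<Sum>J\<in>Pow ?S. ?Q J * T_op x (T_set J f))"
    unfolding T_op_eq by (simp only: T_set_mult T_set_sum T_set_prod T_set_uminus T_set_Const)
  also have "(\<Sum>J\<in>Pow ?S. ?Q J * T_op x (T_set J f)) = (\<Sum>J\<in>Pow ?S. ?Q J * T_set (insert x J) f)"
    by (intro sum.cong refl) (subst T_op_T_set, use x in auto)
  finally have T: "T_op x (?P * (\<Sum>J\<in>Pow ?S. ?Q J * T_set J f)) = ?P * (\<Sum>J\<in>Pow ?S. ?Q J * T_set (insert x J) f)" .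
  have "(\<Sum>J\<in>Pow (insert x ?S). ?Q J * T_set J f) = (\<Sum>J\<in>Pow ?S. ?Q J * T_set J f) + (\<Sum>J\<in>insert x ` Pow ?S. ?Q J * T_set J f)"
    unfolding Pow_insert by (rule sum.union_disjoint) (use x in auto)
  also have "(\<Sum>J\<in>insert x ` Pow ?S. ?Q J * T_set J f) = (\<Sum>J\<in>Pow ?S. ?Q (insert x J) * T_set (insert x J) f)"
    by (subst sum.reindex) (use x in \<open>auto simp: inj_on_def\<close>)
  also have "\<dots> = ?c x * (\<Sum>J\<in>Pow ?S. ?Q J * T_set (insert x J) f)"
    unfolding sum_distrib_left
  proof (rule sum.cong[OF refl])
    fix J assume J: "J \<in> Pow ?S"
    then have "x \<notin> J" using x by blast
    then show "?Q (insert x J) * T_set (insert x J) f = ?c x * (?Q J * T_set (insert x J) f)"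
      unfolding prod.insert[OF fin[OF J] \<open>x \<notin> J\<close>] by (simp only: mult.assoc)
  qed
  finally have S: "(\<Sum>J\<in>Pow (insert x ?S). ?Q J * T_set J f) =
      (\<Sum>J\<in>Pow ?S. ?Q J * T_set J f) + ?c x * (\<Sum>J\<in>Pow ?S. ?Q J * T_set (insert x J) f)" .
  have P: "(\<Prod>i\<in>insert x ?S. X i ^ (N - \<sigma> i)) = X x ^ (N - \<sigma> x) * ?P"
    using x by simp
  have "foldr (\<circ>) (map (D_factor N \<sigma>) (x # xs)) id f = D_factor N \<sigma> x (?P * (\<Sum>J\<in>Pow ?S. ?Q J * T_set J f))"
  proof -
    have "distinct xs" using Cons.prems by simp
    then show ?thesis unfolding Cons.IH[OF \<open>distinct xs\<close>, symmetric] by simp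
  qed
  also have "\<dots> = X x ^ (N - \<sigma> x) * (?P * (\<Sum>J\<in>Pow ?S. ?Q J * T_set J f) + ?c x * (?P * (\<Sum>J\<in>Pow ?S. ?Q J * T_set (insert x J) f)))"
    unfolding D_factor_def T D_coeff_def[symmetric] by simp
  also have "\<dots> = X x ^ (N - \<sigma> x) * ?P * ((\<Sum>J\<in>Pow ?S. ?Q J * T_set J f) + ?c x * (\<Sum>J\<in>Pow ?S. ?Q J * T_set (insert x J) f))"
    by (simp only: distrib_left mult_ac)
  finally show ?case unfolding list.set S P .
qed

lemma upt_Suc_set: "set [1..<Suc N] = {1..N}"
  by (simp only: set_upt atLeastLessThanSuc_atLeastAtMost)

lemma compose_T_op: "compose_upto N T_op f = T_set {1..N} f"
proof -
  have "distinct xs \<Longrightarrow> foldr (\<circ>) (map T_op xs) id f = T_set (set xs) f" for xs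
    by (induction xs) (simp_all add: T_set_empty T_op_T_set)
  from this[of "[1..<Suc N]"] show ?thesis
    unfolding compose_upto_def upt_Suc_set using distinct_upt by blast
qed

text \<open>\<open>inv\<close> is the inverse of a function, so on an image it only requires
  injectivity; substituting x_i/q for x_i gives a left inverse.\<close>

lemma inv_compose_T_op: "inv (compose_upto N T_op) (T_set {1..N} f) = f"
proof -
  let ?r = "\<lambda>j. if j \<in> {1..N} then Const (emb (inverse q_par)) * X j else X j :: K mpoly"
  have "emb q_par * emb (inverse q_par) = 1"
    by (simp add: emb_inverse)
  then have c: "Const (emb q_par) * (Const (emb (inverse q_par)) * g) = g" "Const (emb (inverse q_par)) * (Const (emb q_par) * g) = g"
    for g :: "K mpoly"
    by (simp_all only: mult.assoc[symmetric] Const_mult[symmetric] mult.commute[of "emb (inverse q_par)"] Const_1 mult_1)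
  have "subst ?r (T_set {1..N} g) = subst (\<lambda>j. X j) g" for g
    unfolding T_set_def subst_subst
    by (rule arg_cong[where f = "\<lambda>s. subst s g"]) (auto simp: fun_eq_iff subst_mult c)
  then have "subst ?r (T_set {1..N} g) = g" for g
    using T_set_empty[of g] by (simp add: T_set_def)
  then have "inj (T_set {1..N})" by (rule inj_on_inverseI)
  moreover have "compose_upto N T_op = T_set {1..N}" by (rule ext) (rule compose_T_op)
  ultimately show ?thesis by (simp add: inv_f_f)
qed

abbreviation qX :: "nat \<Rightarrow> K mpoly fract" where
  "qX i \<equiv> Const_fract (emb q_par) * X_fract i"

text \<open>Multiplying the variables in J by q is the same as multiplying all of them by q and then
  dividing those outside J by q. Relative to the points q x_i, an undisturbed variable satisfies x^n
  = (q x)^n + (1 - q^n) x^n, and x^n is 1/q^n times (q x)^n.\<close>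

lemma to_fract_T_set:
  assumes "J \<subseteq> {1..N}"
  shows "to_fract (T_set J (KM.ev (psumX N) f)) =
    KX.ev (\<lambda>k. KX.psums qX {1..N} k + Const_fract (emb (cq k)) * (Const_fract (emb (1 / q_par)) ^ Suc k * KX.psums qX ({1..N} - J) k)) f"
  unfolding T_set_def subst_KM_ev to_fract_KM_ev
proof (rule KX.ev_cong)
  fix k
  let ?q = "Const_fract (emb q_par)" and ?Q = "Const_fract (emb (1 / q_par))"
  let ?S = "{1..N}"
  have Q: "?Q ^ Suc k * (?q ^ Suc k * z) = z" for z
  proof -
    have "?Q * ?q = 1" by (simp only: KX.hom_mult[symmetric]) simp
    then have "?Q ^ Suc k * ?q ^ Suc k = 1" by (simp only: power_mult_distrib[symmetric] power_one)
    then show ?thesis by (simp only: mult.assoc[symmetric] mult_1)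
  qed
  have cq: "Const_fract (emb (cq k)) = 1 - ?q ^ Suc k"
    by (simp only: cq_def KX.hom_diff KX.hom_1 KX.hom_power)
  have split: "(\<Sum>i\<in>?S. g i) = (\<Sum>i\<in>?S - J. g i) + (\<Sum>i\<in>J. g i)" for g :: "nat \<Rightarrow> K mpoly fract"
    by (rule sum.subset_diff[OF assms]) simp
  have "to_fract (subst (\<lambda>j. if j \<in> J then Const (emb q_par) * X j else X j) (psumX N k)) =
      (\<Sum>i\<in>?S. (if i \<in> J then qX i else X_fract i) ^ Suc k)"
    unfolding psumX_def subst_sum hom_of_rings.hom_power[OF hom_subst] subst_X
      hom_of_rings.hom_sum[OF hom_to_fract] hom_of_rings.hom_power[OF hom_to_fract]
    by (intro sum.cong refl) (simp add: hom_of_rings.hom_mult[OF hom_to_fract] Const_fract_def)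
  also have "\<dots> = (\<Sum>i\<in>?S - J. X_fract i ^ Suc k) + (\<Sum>i\<in>J. qX i ^ Suc k)"
    unfolding split by simp
  also have "(\<Sum>i\<in>?S - J. X_fract i ^ Suc k) = (\<Sum>i\<in>?S - J. qX i ^ Suc k) + (1 - ?q ^ Suc k) * (?Q ^ Suc k * (\<Sum>i\<in>?S - J. qX i ^ Suc k))"
    unfolding power_mult_distrib sum_distrib_left[symmetric] Q by (simp only: left_diff_distrib mult_1 add_diff_cancel_left') simp
  finally show "to_fract (subst (\<lambda>j. if j \<in> J then Const (emb q_par) * X j else X j) (psumX N k)) =
      KX.psums qX ?S k + Const_fract (emb (cq k)) * (?Q ^ Suc k * KX.psums qX (?S - J) k)"
    unfolding KX.psums_def split cq by (simp only: add_ac)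
qed

text \<open>The expected value of (T_1...T_N)^(-1) D_N(u). For partitions longer than N the product
  over j is empty, but \<open>HLM \<mu>\<close> then vanishes in N variables.\<close>

definition A_target :: "nat \<Rightarrow> nat \<Rightarrow> F mpoly \<Rightarrow> K mpoly" where
  "A_target d N f = (\<Sum>\<mu>\<in>parts_le d. Const (emb (1 / HL_b \<mu> * (1 / q_par) ^ sum_list \<mu>) *
     (\<Prod>j=length \<mu>..<N. 1 - u_par * inverse (emb t_par) ^ j)) * KM.ev (psumX N) (HLM \<mu> * star wq (HLM \<mu>) f))"

text \<open>\<open>macdonald_field\<close> is applied at the points q x_i. The resulting identity
  exhibits the numerator as the Vandermonde product times a polynomial, which is what
  \<open>the_poly\<close> has to return.\<close>

lemma macdonald_D_eq:
  assumes "bounded_wt d f"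
  shows "macdonald_D N (KM.ev (psumX N) f) = T_set {1..N} (A_target d N f)"
proof -
  let ?S = "{1..N}" and ?q = "Const_fract (emb q_par)" and ?u = "Const_fract u_par"
  let ?num = "\<Sum>\<sigma> | \<sigma> permutes ?S. of_int (sign \<sigma>) * compose_upto N (D_factor N \<sigma>) (KM.ev (psumX N) f)"
  let ?E = "\<lambda>I. KX.ev (\<lambda>k. KX.psums qX ?S k + Const_fract (emb (cq k)) * (Const_fract (emb (1 / q_par)) ^ Suc k * KX.psums qX I k)) f"
  \<comment> \<open>The degree of the Vandermonde product. Passing from x_i to q x_i multiplies both
    the monomials of the determinant and the denominator by q^C, so this power cancels.\<close>
  define C where "C = (\<Sum>i=1..N. N - i)"
  have q: "?q \<noteq> 0" by (rule KX.hom_nonzero) simp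
  have inj: "inj_on qX ?S" using q by (auto simp: inj_on_def)
  have nz: "qX i \<noteq> 0" for i using q by simp
  have of_int: "to_fract (of_int k) = of_int k" for k
    by (cases k) (simp_all add: hom_of_rings.hom_of_nat[OF hom_to_fract] hom_of_rings.hom_uminus[OF hom_to_fract]
        hom_of_rings.hom_diff[OF hom_to_fract] hom_of_rings.hom_1[OF hom_to_fract])
  have coeff: "to_fract (Const (D_coeff \<sigma> i)) = ?u * KX.tv ^ (\<sigma> i - 1)" if "\<sigma> permutes ?S" "i \<in> ?S" for \<sigma> i
  proof -
    have "\<sigma> i \<in> ?S" using that permutes_in_image by metis
    then have "1 - int (\<sigma> i) = - int (\<sigma> i - 1)" by auto
    then have "D_coeff \<sigma> i = u_par * emb (inverse t_par) ^ (\<sigma> i - 1)"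
      unfolding D_coeff_def emb_inverse by (simp only: power_int_minus power_int_of_nat power_inverse)
    then show ?thesis
      by (simp add: KC.hom_mult KC.hom_power KX.hom_inverse flip: Const_fract_def)
  qed
  have trm: "to_fract (compose_upto N (D_factor N \<sigma>) (KM.ev (psumX N) f)) =
      (\<Prod>i=1..N. X_fract i ^ (N - \<sigma> i)) * (\<Sum>I\<in>Pow ?S. (\<Prod>i\<in>?S - I. - ?u * KX.tv ^ (\<sigma> i - 1)) * ?E I)"
    if \<sigma>: "\<sigma> permutes ?S" for \<sigma>
  proof -
    have "to_fract (compose_upto N (D_factor N \<sigma>) (KM.ev (psumX N) f)) =
        (\<Prod>i\<in>?S. X_fract i ^ (N - \<sigma> i)) * (\<Sum>J\<in>Pow ?S. (\<Prod>i\<in>J. - to_fract (Const (D_coeff \<sigma> i))) * to_fract (T_set J (KM.ev (psumX N) f)))"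
      unfolding compose_upto_def compose_D_factor[OF distinct_upt] upt_Suc_set
      by (simp only: hom_of_rings.hom_mult[OF hom_to_fract] hom_of_rings.hom_sum[OF hom_to_fract]
          hom_of_rings.hom_prod[OF hom_to_fract] hom_of_rings.hom_power[OF hom_to_fract] hom_of_rings.hom_uminus[OF hom_to_fract])
    also have "(\<Sum>J\<in>Pow ?S. (\<Prod>i\<in>J. - to_fract (Const (D_coeff \<sigma> i))) * to_fract (T_set J (KM.ev (psumX N) f))) =
        (\<Sum>J\<in>Pow ?S. (\<Prod>i\<in>J. - ?u * KX.tv ^ (\<sigma> i - 1)) * ?E (?S - J))"
    proof (intro sum.cong refl arg_cong2[of _ _ _ _ "(*)"] prod.cong)
      fix J assume "J \<in> Pow ?S"
      then show "to_fract (T_set J (KM.ev (psumX N) f)) = ?E (?S - J)"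
        by (intro to_fract_T_set) simp
      fix i assume "i \<in> J"
      then have "i \<in> ?S" using \<open>J \<in> Pow ?S\<close> by blast
      then show "- to_fract (Const (D_coeff \<sigma> i)) = - ?u * KX.tv ^ (\<sigma> i - 1)"
        by (simp only: coeff[OF \<sigma>] mult_minus_left)
    qed
    also have "\<dots> = (\<Sum>I\<in>Pow ?S. (\<Prod>i\<in>?S - I. - ?u * KX.tv ^ (\<sigma> i - 1)) * ?E I)"
      by (rule sum.reindex_bij_witness[of _ "\<lambda>I. ?S - I" "\<lambda>J. ?S - J"]) (auto simp: double_diff)
    finally show ?thesis .
  qed
  have pow: "(\<Prod>i=1..N. qX i ^ (N - \<sigma> i)) = ?q ^ C * (\<Prod>i=1..N. X_fract i ^ (N - \<sigma> i))" if "\<sigma> permutes ?S" for \<sigma>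
  proof -
    have "(\<Sum>i=1..N. N - \<sigma> i) = C"
      unfolding C_def by (rule sum.reindex_bij_betw[OF permutes_imp_bij[OF that]])
    then show ?thesis by (simp add: power_mult_distrib prod.distrib flip: power_sum)
  qed
  have van: "to_fract (vandermonde N) = (\<Prod>i=1..N. \<Prod>j=i+1..N. X_fract i - X_fract j)"
    by (simp only: vandermonde_def hom_of_rings.hom_prod[OF hom_to_fract] hom_of_rings.hom_diff[OF hom_to_fract])
  have diff: "(\<Prod>i=1..N. \<Prod>j=i+1..N. qX i - qX j) = ?q ^ C * to_fract (vandermonde N)"
  proof -
    have "(\<Prod>i=1..N. \<Prod>j=i+1..N. qX i - qX j) = (\<Prod>i=1..N. \<Prod>j=i+1..N. ?q * (X_fract i - X_fract j))"
      by (simp only: right_diff_distrib)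
    also have "\<dots> = (\<Prod>i=1..N. ?q ^ (N - i)) * to_fract (vandermonde N)"
      by (simp add: prod.distrib van)
    finally show ?thesis by (simp add: C_def power_sum)
  qed
  have target: "to_fract (T_set ?S (A_target d N f)) =
     (\<Sum>\<mu>\<in>parts_le d. Const_fract (emb (1 / HL_b \<mu>)) * Const_fract (emb (1 / q_par)) ^ sum_list \<mu> *
       (\<Prod>j=length \<mu>..<N. 1 - ?u * KX.tv ^ j) * KX.ev (KX.psums qX ?S) (HLM \<mu> * star wq (HLM \<mu>) f))"
  proof -
    have "to_fract (T_set ?S (KM.ev (psumX N) h)) = KX.ev (KX.psums qX ?S) h" for h
      unfolding to_fract_T_set[OF order.refl] by (rule KX.ev_cong) simp
    moreover have "to_fract (Const (emb (x * y ^ k) * (\<Prod>j=l..<N. 1 - u_par * inverse (emb t_par) ^ j))) =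
        Const_fract (emb x) * Const_fract (emb y) ^ k * (\<Prod>j=l..<N. 1 - ?u * KX.tv ^ j)" for x y k l
    proof -
      have "KX.tv = Const_fract (inverse (emb t_par))" by (simp add: KX.hom_inverse flip: emb_inverse)
      then show ?thesis
        unfolding Const_fract_def[symmetric]
        by (simp only: KC.hom_mult KC.hom_prod KC.hom_diff KC.hom_1 KC.hom_power KX.hom_mult KX.hom_power)
    qed
    ultimately show ?thesis
      unfolding A_target_def T_set_sum T_set_mult T_set_Const hom_of_rings.hom_sum[OF hom_to_fract]
        hom_of_rings.hom_mult[OF hom_to_fract] by (simp only:)
  qed
  have "?q ^ C * to_fract ?num = (\<Sum>\<sigma> | \<sigma> permutes ?S. of_int (sign \<sigma>) * ((\<Prod>i=1..N. qX i ^ (N - \<sigma> i)) *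
      (\<Sum>I\<in>Pow ?S. (\<Prod>i\<in>?S - I. - ?u * KX.tv ^ (\<sigma> i - 1)) * ?E I)))"
    unfolding hom_of_rings.hom_sum[OF hom_to_fract] hom_of_rings.hom_mult[OF hom_to_fract] of_int
    by (subst sum_distrib_left, rule sum.cong[OF refl]) (simp only: mem_Collect_eq trm pow, simp only: mult_ac)
  also have "\<dots> = ?q ^ C * (to_fract (vandermonde N) * to_fract (T_set ?S (A_target d N f)))"
    unfolding KX.macdonald_field[OF assms inj nz] diff target by (simp only: mult.assoc)
  finally have num: "to_fract ?num = to_fract (vandermonde N) * to_fract (T_set ?S (A_target d N f))"
    using q by (simp only: mult_cancel_left power_not_zero) simp
  have "?q ^ C * to_fract (vandermonde N) \<noteq> 0"
    unfolding diff[symmetric] by (rule KX.diff_prod_nonzero[OF inj])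
  then have "vandermonde N \<noteq> 0" by auto
  then have "Fract ?num (vandermonde N) = to_fract (T_set ?S (A_target d N f))"
    unfolding Fract_eq_divide[OF \<open>vandermonde N \<noteq> 0\<close>] num by simp
  then show ?thesis
    unfolding macdonald_D_def by (simp only: the_poly_to_fract)
qed

text \<open>Every branching step uses up one part and one point; when the points run out first, the
  sum is empty.\<close>

lemma (in F_field_hom) HLM_vanish:
  assumes "is_partition \<mu>" "finite I" "inj_on a I" "\<And>i. i \<in> I \<Longrightarrow> a i \<noteq> 0" "card I < length \<mu>"
  shows "ev (psums a I) (HLM \<mu>) = 0"
  using assms
proof (induction \<mu> arbitrary: I)
  case (Cons r \<mu>)
  have r: "r \<ge> 1" "is_partition \<mu>" using Cons.prems(1) is_partition_Cons by blast+
  have "ev (psums a (I - {i})) (HLM \<mu>) = 0" if "i \<in> I" for i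
  proof -
    have "card (I - {i}) < card I" using that Cons.prems(2) by (rule card_Diff1_less[rotated])
    then show ?thesis using Cons.prems r by (intro Cons.IH) (auto simp: inj_on_diff)
  qed
  then show ?case using Cons.prems r by (subst ev_HLM) simp_all
qed simp

section \<open>The denominators (u;t^(-1))_k\<close>

lemma u_v_power: "u_par * inverse (emb t_par) ^ k = to_fract ([:0, 1:] * [:inverse t_par ^ k:])"
proof -
  have "inverse (emb t_par) ^ k = to_fract [:inverse t_par ^ k:]"
    unfolding emb_inverse[symmetric] hom_of_rings.hom_power[OF hom_emb, symmetric] by (rule emb_eq)
  moreover have "u_par = to_fract [:0, 1:]" by (simp add: u_par_def to_fract_def)
  ultimately show ?thesis by (simp only: hom_of_rings.hom_mult[OF hom_to_fract])
qed

lemma qpoch_nonzero: "qpoch u_par (inverse (emb t_par)) n \<noteq> 0"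
proof -
  have "u_par * inverse (emb t_par) ^ k \<noteq> 1" for k
  proof -
    have "[:0, 1:] * [:inverse t_par ^ k:] \<noteq> (1 :: F poly)" by (simp add: one_pCons)
    then show ?thesis
      unfolding u_v_power by (metis hom_of_rings.hom_1[OF hom_to_fract] to_fract_inj)
  qed
  then show ?thesis by (simp add: qpoch_def)
qed

text \<open>The eigenvalue is the part of (u;t^(-1))_N beyond the index \<ell>(\<mu>), so the
  division leaves 1/(u;t^(-1))_k with k = \<ell>(\<mu>). Afterwards N occurs only in the projection,
  which makes the limit visible.\<close>

lemma macdonald_A_eq:
  assumes "bounded_wt d f"
  shows "macdonald_A N (KM.ev (psumX N) f) = (\<Sum>\<mu>\<in>parts_le d. Const (inverse (qpoch u_par (inverse (emb t_par)) (length \<mu>))) *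
     (Const (emb (1 / HL_b \<mu> * (1 / q_par) ^ sum_list \<mu>)) * KM.ev (psumX N) (HLM \<mu> * star wq (HLM \<mu>) f)))"
proof -
  let ?p = "qpoch u_par (inverse (emb t_par))"
  have "Const (inverse (?p N)) * (Const (c * (\<Prod>j=length \<mu>..<N. 1 - u_par * inverse (emb t_par) ^ j)) * KM.ev (psumX N) (HLM \<mu> * h)) =
      Const (inverse (?p (length \<mu>))) * (Const c * KM.ev (psumX N) (HLM \<mu> * h))" if \<mu>: "is_partition \<mu>" for c \<mu> h
  proof (cases "length \<mu> \<le> N")
    case True
    have "?p N = ?p (length \<mu>) * (\<Prod>j=length \<mu>..<N. 1 - u_par * inverse (emb t_par) ^ j)"
      unfolding qpoch_def lessThan_atLeast0 using True by (intro prod.atLeastLessThan_concat[symmetric]) simp_all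
    moreover from this have "?p (length \<mu>) \<noteq> 0" "(\<Prod>j=length \<mu>..<N. 1 - u_par * inverse (emb t_par) ^ j) \<noteq> 0"
      using qpoch_nonzero[of N] by auto
    moreover have "inverse (x * y) * (c * y) = inverse x * c" if "x \<noteq> 0" "y \<noteq> 0" for x y :: K
      using that by (simp add: field_simps)
    ultimately have "inverse (?p N) * (c * (\<Prod>j=length \<mu>..<N. 1 - u_par * inverse (emb t_par) ^ j)) = inverse (?p (length \<mu>)) * c"
      by (simp only:)
    then show ?thesis by (simp only: mult.assoc[symmetric] Const_mult[symmetric])
  next
    case False
    have "to_fract (KM.ev (psumX N) (HLM \<mu>)) = KX.ev (KX.psums X_fract {1..N}) (HLM \<mu>)"
      unfolding to_fract_KM_ev
      by (rule KX.ev_cong) (simp only: psumX_def KX.psums_def hom_of_rings.hom_sum[OF hom_to_fract] hom_of_rings.hom_power[OF hom_to_fract])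
    also have "\<dots> = 0" using False \<mu> by (intro KX.HLM_vanish) (auto simp: inj_on_def)
    finally show ?thesis by (simp add: KM.ev_mult)
  qed
  then show ?thesis
    unfolding macdonald_A_def macdonald_D_eq[OF assms] inv_compose_T_op A_target_def sum_distrib_left
    by (intro sum.cong refl) (simp add: parts_le_def)
qed

section \<open>Macdonald operators at infinity\<close>

text \<open>Multiplied by the last denominator, the relation becomes polynomial in u. At u = t^n
  every term except the top one contains the vanishing factor 1 - u t^(-n), so the top coefficient
  is 0 and induction applies.\<close>

lemma qpoch_independent:
  assumes "(\<Sum>k\<le>n. inverse (qpoch u_par (inverse (emb t_par)) k) * emb (c k)) = 0" "k \<le> n"
  shows "c k = 0"
  using assms
proof (induction n)
  case 0
  then show ?case by (simp add: qpoch_def)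
next
  case (Suc n)
  let ?p = "qpoch u_par (inverse (emb t_par))"
  let ?L = "\<lambda>j. [:1, - (inverse t_par ^ j):]"
  let ?P = "\<Sum>k\<le>Suc n. smult (c k) (\<Prod>j=k..<Suc n. ?L j)"
  have hom: "hom_of_rings (to_fract :: F poly \<Rightarrow> K)" by (rule hom_to_fract)
  have fac: "1 - u_par * inverse (emb t_par) ^ j = to_fract (?L j)" for j
  proof -
    have "?L j = 1 - [:0, 1:] * [:inverse t_par ^ j:]" by (simp add: one_pCons)
    then show ?thesis
      by (simp only: u_v_power hom_of_rings.hom_diff[OF hom] hom_of_rings.hom_1[OF hom])
  qed
  have "to_fract ?P = (\<Sum>k\<le>Suc n. ?p (Suc n) * (inverse (?p k) * emb (c k)))"
    unfolding hom_of_rings.hom_sum[OF hom]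
  proof (rule sum.cong[OF refl])
    fix k assume k: "k \<in> {..Suc n}"
    have "?p (Suc n) = ?p k * (\<Prod>j=k..<Suc n. 1 - u_par * inverse (emb t_par) ^ j)"
      unfolding qpoch_def lessThan_atLeast0 using k by (intro prod.atLeastLessThan_concat[symmetric]) simp_all
    moreover have "to_fract (smult (c k) (\<Prod>j=k..<Suc n. ?L j)) = emb (c k) * (\<Prod>j=k..<Suc n. to_fract (?L j))"
      using hom_of_rings.hom_mult[OF hom, of "[:c k:]" "\<Prod>j=k..<Suc n. ?L j"]
      by (simp only: hom_of_rings.hom_prod[OF hom]) (simp add: emb_def to_fract_def)
    ultimately show "to_fract (smult (c k) (\<Prod>j=k..<Suc n. ?L j)) = ?p (Suc n) * (inverse (?p k) * emb (c k))"
      unfolding fac using qpoch_nonzero[of k] by (simp add: field_simps)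
  qed
  also have "\<dots> = 0" unfolding sum_distrib_left[symmetric] Suc.prems(1) by simp
  finally have "?P = 0" by (simp only: to_fract_eq_0)
  then have "poly ?P (t_par ^ n) = 0" by simp
  moreover have "(\<Sum>k\<le>n. poly (smult (c k) (\<Prod>j=k..<Suc n. ?L j)) (t_par ^ n)) = 0"
  proof (rule sum.neutral[OF ballI])
    fix k assume that: "k \<in> {..n}"
    have "poly (?L n) (t_par ^ n) = 0" by (simp flip: power_mult_distrib)
    then have "poly (\<Prod>j=k..<Suc n. ?L j) (t_par ^ n) = 0"
      unfolding poly_prod using that by (intro prod_zero bexI[of _ n]) simp_all
    then show "poly (smult (c k) (\<Prod>j=k..<Suc n. ?L j)) (t_par ^ n) = 0" by (simp only: poly_smult mult_zero_right)
  qed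
  ultimately have "c (Suc n) = 0" by (simp only: sum.atMost_Suc poly_add poly_sum add_0_left) simp
  moreover from this have "c k = 0" if "k \<le> n" using Suc.IH Suc.prems(1) that by (simp add: hom_of_rings.hom_0[OF hom_emb])
  ultimately show ?case using Suc.prems(2) by (auto simp: le_Suc_eq)
qed

text \<open>For each projection and each monomial, the coefficients of two expansions form a
  relation over F among the 1/(u;t^(-1))_j. The bound \<open>n\<close> covers both finite supports
  and also the index \<open>k\<close> in question.\<close>

lemma A_expansion_unique:
  assumes A: "is_A_expansion A" and B: "is_A_expansion B"
  shows "A = B"
proof (intro ext)
  fix k f
  let ?p = "\<lambda>k. inverse (qpoch u_par (inverse (emb t_par)) k)"
  have fin: "finite {k. A k f \<noteq> 0}" "finite {k. B k f \<noteq> 0}"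
    using A B by (simp_all add: is_A_expansion_def)
  define n where "n = Max ({k} \<union> {k. A k f \<noteq> 0} \<union> {k. B k f \<noteq> 0})"
  have n: "k \<le> n" "\<And>j. A j f \<noteq> 0 \<Longrightarrow> j \<le> n" "\<And>j. B j f \<noteq> 0 \<Longrightarrow> j \<le> n"
    unfolding n_def using fin by (auto intro!: Max_ge)
  have eq: "macdonald_A_inf (ext_scalars f) = (\<Sum>j\<le>n. ?p j \<cdot> ext_scalars (C j f))"
    if "is_A_expansion C" "\<And>j. C j f \<noteq> 0 \<Longrightarrow> j \<le> n" for C
  proof -
    have "macdonald_A_inf (ext_scalars f) = (\<Sum>j | C j f \<noteq> 0. ?p j \<cdot> ext_scalars (C j f))"
      using that(1) by (simp add: is_A_expansion_def)
    also have "\<dots> = (\<Sum>j\<le>n. ?p j \<cdot> ext_scalars (C j f))"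
    proof (rule sum.mono_neutral_left)
      show "\<forall>j\<in>{..n} - {j. C j f \<noteq> 0}. ?p j \<cdot> ext_scalars (C j f) = 0"
        by (auto intro!: symf_eqI[of 0] simp: proj_scale)
    qed (use that(2) in auto)
    finally show ?thesis .
  qed
  have "lookup (proj N (A k f - B k f)) m = 0" for N m
  proof (rule qpoch_independent[OF _ n(1)])
    have s: "lookup (proj N (\<Sum>j\<le>n. ?p j \<cdot> ext_scalars (C j f))) m = (\<Sum>j\<le>n. ?p j * emb (lookup (proj N (C j f)) m))" for C
      by (simp add: proj_sum proj_scale lookup_sum lookup_Const_mult proj_ext_scalars lookup_map_emb flip: map_emb_eq)
    have "(\<Sum>j\<le>n. ?p j * emb (lookup (proj N (A j f)) m)) = (\<Sum>j\<le>n. ?p j * emb (lookup (proj N (B j f)) m))"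
      using eq[OF A n(2)] eq[OF B n(3)] unfolding s[symmetric] by simp
    then show "(\<Sum>j\<le>n. ?p j * emb (lookup (proj N (A j f - B j f)) m)) = 0"
      by (simp add: proj_diff lookup_minus hom_of_rings.hom_diff[OF hom_emb] right_diff_distrib sum_subtractf)
  qed
  then have "A k f - B k f = 0"
    by (intro symf_eqI[of 0] poly_mapping_eqI) simp
  then show "A k f = B k f" by simp
qed

section \<open>The Hall-Littlewood series as the expansion of A(u)\<close>

definition A_term :: "nat list \<Rightarrow> F symf \<Rightarrow> F symf" where
  "A_term \<mu> f = q_par powi (- int (sum_list \<mu>)) \<cdot> (HL_Q \<mu> * adj (HL_P \<mu>) f)"

definition A_series :: "nat \<Rightarrow> F symf \<Rightarrow> F symf" where
  "A_series k f = (\<Sum>\<mu> | is_partition \<mu> \<and> length \<mu> = k \<and> adj (HL_P \<mu>) f \<noteq> 0. A_term \<mu> f)"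

lemma scale_0 [simp]: "c \<cdot> 0 = 0"
  by (rule symf_eqI[of 0]) (simp add: proj_scale)

lemma scale_1 [simp]: "1 \<cdot> f = f"
  by (rule symf_eqI[of 0]) (simp add: proj_scale)

lemma adj_HL_P:
  "is_partition \<mu> \<Longrightarrow> adj (HL_P \<mu>) (of_psums g) = (1 / HL_b \<mu>) \<cdot> of_psums (star wq (HLM \<mu>) g)"
  by (simp only: HL_P_eq adj_eq) (simp add: star_scale_left of_psums_scale)

lemma A_term_eq:
  assumes "is_partition \<mu>"
  shows "A_term \<mu> (of_psums g) = (1 / HL_b \<mu> * (1 / q_par) ^ sum_list \<mu>) \<cdot> of_psums (HLM \<mu> * star wq (HLM \<mu>) g)"
proof -
  have "q_par powi (- int n) = (1 / q_par) ^ n" for n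
    by (simp add: power_int_minus power_one_over inverse_eq_divide)
  then show ?thesis
    by (simp only: A_term_def adj_HL_P[OF assms] HL_Q_eq[OF assms] of_psums_scale[symmetric] of_psums_mult[symmetric]
        Const_mult) (simp only: mult_ac)
qed

lemma adj_HL_P_zero:
  assumes "is_partition \<mu>" "bounded_wt d g" "d < sum_list \<mu>"
  shows "adj (HL_P \<mu>) (of_psums g) = 0"
  using star_homog_zero[OF homog_HLM assms(2,3), of wq]
  by (simp add: adj_HL_P[OF assms(1)])

lemma A_support:
  assumes "bounded_wt d g"
  shows "{\<mu>. is_partition \<mu> \<and> length \<mu> = k \<and> adj (HL_P \<mu>) (of_psums g) \<noteq> 0} \<subseteq> {\<mu> \<in> parts_le d. length \<mu> = k}"
  using adj_HL_P_zero[OF _ assms] by (auto simp: parts_le_def not_le[symmetric])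

text \<open>The index set in \<open>A_series\<close> varies with the argument. A set depending only
  on a weight bound allows sums for different arguments to be added and compared.\<close>

lemma A_series_eq:
  assumes "bounded_wt d g"
  shows "A_series k (of_psums g) = (\<Sum>\<mu>\<in>{\<mu> \<in> parts_le d. length \<mu> = k}. A_term \<mu> (of_psums g))"
  unfolding A_series_def
proof (rule sum.mono_neutral_left)
  have "A_term \<mu> f = 0" if "adj (HL_P \<mu>) f = 0" for \<mu> f
    by (rule symf_eqI[of 0]) (simp add: A_term_def that proj_scale)
  then show "\<forall>\<mu>\<in>{\<mu> \<in> parts_le d. length \<mu> = k} - {\<mu>. is_partition \<mu> \<and> length \<mu> = k \<and> adj (HL_P \<mu>) (of_psums g) \<noteq> 0}.
      A_term \<mu> (of_psums g) = 0"
    by (auto simp: parts_le_def)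
qed (use A_support[OF assms] in auto)

lemma length_le_sum_list: "0 \<notin> set \<mu> \<Longrightarrow> length \<mu> \<le> sum_list (\<mu> :: nat list)"
  by (induction \<mu>) (auto simp: Suc_le_eq)

lemma scale_add_right: "c \<cdot> (f + g) = c \<cdot> f + c \<cdot> g"
  by (rule symf_eqI[of 0]) (simp add: proj_scale proj_add distrib_left)

lemma scale_scale: "c \<cdot> d \<cdot> f = (c * d) \<cdot> f"
  by (rule symf_eqI[of 0]) (simp add: proj_scale Const_mult mult.assoc)

lemma scale_sum: "c \<cdot> sum f A = (\<Sum>i\<in>A. c \<cdot> f i)"
  by (rule symf_eqI[of 0]) (simp add: proj_scale proj_sum sum_distrib_left)

lemma linear_A_series: "Vector_Spaces.linear scale scale (A_series k)"
proof -
  have add: "A_series k (f + g) = A_series k f + A_series k g" for f g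
  proof -
    obtain d1 d2 where "bounded_wt d1 (to_psums f)" "bounded_wt d2 (to_psums g)" using bounded_wt_ex by metis
    then have d: "bounded_wt (max d1 d2) (to_psums f)" "bounded_wt (max d1 d2) (to_psums g)"
      by (auto intro: bounded_wt_mono)
    moreover have "bounded_wt (max d1 d2) (to_psums f + to_psums g)"
      using d keys_add[of "to_psums f" "to_psums g"] by (auto simp: bounded_wt_def)
    moreover have "A_term \<mu> (of_psums (to_psums f + to_psums g)) = A_term \<mu> (of_psums (to_psums f)) + A_term \<mu> (of_psums (to_psums g))"
      if "is_partition \<mu>" for \<mu>
      unfolding A_term_eq[OF that] by (simp only: star_add_right distrib_left of_psums_add scale_add_right)
    ultimately have "A_series k (of_psums (to_psums f + to_psums g)) = A_series k (of_psums (to_psums f)) + A_series k (of_psums (to_psums g))"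
      by (simp add: A_series_eq sum.distrib[symmetric] parts_le_def del: of_to_psums)
    then show ?thesis by (simp add: of_psums_add)
  qed
  have scl: "A_series k (c \<cdot> f) = c \<cdot> A_series k f" for c f
  proof -
    obtain d where d: "bounded_wt d (to_psums f)" using bounded_wt_ex by metis
    moreover have "bounded_wt d (Const c * to_psums f)"
      using d keys_Const_mult[of c "to_psums f"] by (auto simp: bounded_wt_def)
    moreover have "A_term \<mu> (of_psums (Const c * to_psums f)) = c \<cdot> A_term \<mu> (of_psums (to_psums f))"
      if "is_partition \<mu>" for \<mu>
      unfolding A_term_eq[OF that]
      by (simp only: star_scale_right mult.left_commute[of _ "Const c"] of_psums_scale scale_scale mult.commute[of c])
    ultimately have "A_series k (of_psums (Const c * to_psums f)) = c \<cdot> A_series k (of_psums (to_psums f))"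
      by (simp add: A_series_eq scale_sum parts_le_def del: of_to_psums)
    then show ?thesis by (simp add: of_psums_scale)
  qed
  show ?thesis by (simp add: Vector_Spaces.linear_iff vector_space_scale add scl)
qed

lemma A_series_0: "A_series 0 = id"
proof
  fix f
  obtain d where d: "bounded_wt d (to_psums f)" using bounded_wt_ex by metis
  have "{\<mu> \<in> parts_le d. length \<mu> = 0} = {[]}" by (auto simp: parts_le_def is_partition_def)
  then have "A_series 0 (of_psums (to_psums f)) = A_term [] (of_psums (to_psums f))"
    by (simp only: A_series_eq[OF d]) simp
  also have "\<dots> = of_psums (Const 1 * (1 * star wq 1 (to_psums f)))"
    by (subst A_term_eq) (simp_all add: is_partition_def of_psums_scale del: Const_1)
  also have "\<dots> = f" by (simp add: star_1[of wq, OF wq_nonzero])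
  finally show "A_series 0 f = id f" by simp
qed

text \<open>Both sides have the same projection for every N by \<open>macdonald_A_eq\<close>.
  Through \<open>symf_limI\<close> this also establishes that the limit defining
  \<open>macdonald_A_inf\<close> exists.\<close>

lemma is_A_expansion_series: "is_A_expansion A_series"
  unfolding is_A_expansion_def
proof (intro conjI allI A_series_0 linear_A_series)
  fix f
  let ?p = "\<lambda>k. inverse (qpoch u_par (inverse (emb t_par)) k)"
  define g where "g = to_psums f"
  have f: "f = of_psums g" by (simp add: g_def)
  obtain d where d: "bounded_wt d g" using bounded_wt_ex by metis
  have le: "length \<mu> \<le> d" if "\<mu> \<in> parts_le d" for \<mu>
    using that length_le_sum_list[of \<mu>] by (auto simp: parts_le_def is_partition_def)
  have sub: "{k. A_series k f \<noteq> 0} \<subseteq> {..d}"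
  proof
    fix k assume k: "k \<in> {k. A_series k f \<noteq> 0}"
    show "k \<in> {..d}"
    proof (rule ccontr)
      assume "k \<notin> {..d}"
      then have "{\<mu> \<in> parts_le d. length \<mu> = k} = {}" using le by auto
      then have "A_series k f = 0" by (simp only: f A_series_eq[OF d]) simp
      then show False using k by simp
    qed
  qed
  then show "finite {k. A_series k f \<noteq> 0}" by (rule finite_subset) simp
  show "macdonald_A_inf (ext_scalars f) = (\<Sum>k | A_series k f \<noteq> 0. ?p k \<cdot> ext_scalars (A_series k f))"
    unfolding macdonald_A_inf_def
  proof (rule symf_limI)
    fix N :: nat
    have "(\<Sum>k | A_series k f \<noteq> 0. ?p k \<cdot> ext_scalars (A_series k f)) = (\<Sum>k\<le>d. ?p k \<cdot> ext_scalars (A_series k f))"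
    proof (rule sum.mono_neutral_left)
      show "\<forall>k\<in>{..d} - {k. A_series k f \<noteq> 0}. ?p k \<cdot> ext_scalars (A_series k f) = 0"
        by (auto intro!: symf_eqI[of 0] simp: proj_scale)
    qed (use sub in auto)
    also have "\<dots> = (\<Sum>k\<le>d. \<Sum>\<mu>\<in>{\<mu> \<in> parts_le d. length \<mu> = k}. ?p (length \<mu>) \<cdot> ext_scalars (A_term \<mu> f))"
      by (simp add: f A_series_eq[OF d] ext_scalars_sum scale_sum)
    also have "\<dots> = (\<Sum>\<mu>\<in>parts_le d. ?p (length \<mu>) \<cdot> ext_scalars (A_term \<mu> f))"
      \<comment> \<open>Partitions of size at most \<open>d\<close> have at most \<open>d\<close>
        parts, so grouping them by length misses none.\<close>
      by (rule sum.group) (use le in auto)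
    finally have "proj N (\<Sum>k | A_series k f \<noteq> 0. ?p k \<cdot> ext_scalars (A_series k f)) =
        (\<Sum>\<mu>\<in>parts_le d. Const (?p (length \<mu>)) * proj N (ext_scalars (A_term \<mu> f)))"
      by (simp only: proj_sum proj_scale)
    also have "\<dots> = (\<Sum>\<mu>\<in>parts_le d. Const (?p (length \<mu>)) *
        (Const (emb (1 / HL_b \<mu> * (1 / q_par) ^ sum_list \<mu>)) * KM.ev (psumX N) (HLM \<mu> * star wq (HLM \<mu>) g)))"
    proof (rule sum.cong[OF refl])
      fix \<mu> assume "\<mu> \<in> parts_le d"
      then have "is_partition \<mu>" by (simp add: parts_le_def)
      then show "Const (?p (length \<mu>)) * proj N (ext_scalars (A_term \<mu> f)) = Const (?p (length \<mu>)) *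
          (Const (emb (1 / HL_b \<mu> * (1 / q_par) ^ sum_list \<mu>)) * KM.ev (psumX N) (HLM \<mu> * star wq (HLM \<mu>) g))"
        by (simp only: f A_term_eq ext_scalars_scale proj_scale proj_ext_of_psums)
    qed
    also have "\<dots> = macdonald_A N (proj N (ext_scalars f))"
      by (simp only: f proj_ext_of_psums macdonald_A_eq[OF d])
    finally show "proj N (\<Sum>k | A_series k f \<noteq> 0. ?p k \<cdot> ext_scalars (A_series k f)) = macdonald_A N (proj N (ext_scalars f))" .
  qed
qed

theorem mainTheorem1:
  fixes k :: nat and f :: "F symf"
  assumes "k \<ge> 1"
  shows "finite {\<mu>. is_partition \<mu> \<and> length \<mu> = k \<and> adj (HL_P \<mu>) f \<noteq> 0} \<and>
    macdonald_op k f =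
      (\<Sum>\<mu> | is_partition \<mu> \<and> length \<mu> = k \<and> adj (HL_P \<mu>) f \<noteq> 0.
         q_par powi (- int (sum_list \<mu>)) \<cdot> (HL_Q \<mu> * adj (HL_P \<mu>) f))"
proof
  obtain d where "bounded_wt d (to_psums f)" using bounded_wt_ex by metis
  from A_support[OF this, of k] show "finite {\<mu>. is_partition \<mu> \<and> length \<mu> = k \<and> adj (HL_P \<mu>) f \<noteq> 0}"
    by (auto intro: finite_subset)
  \<comment> \<open>Existence and uniqueness of the expansion identify the whole family at once,
    including the identity operator at index 0.\<close>
  have "macdonald_op = A_series"
    unfolding macdonald_op_def
    by (intro the_equality is_A_expansion_series A_expansion_unique)
  then show "macdonald_op k f =
      (\<Sum>\<mu> | is_partition \<mu> \<and> length \<mu> = k \<and> adj (HL_P \<mu>) f \<noteq> 0.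
         q_par powi (- int (sum_list \<mu>)) \<cdot> (HL_Q \<mu> * adj (HL_P \<mu>) f))"
    by (simp add: A_series_def A_term_def)
qed

end
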